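(* \textsc{Colored Clustering} restricted to bipartite graphs is W[1]-hard with respect to the vertex cover number of the input graph, and also W[1]-hard with respect to its tree-cut width.
   Context: \textsc{Colored Clustering}: given a graph $G=(V,E)$, an edge coloring $\ell\colon E\to C$, and $k\in\mathbb{N}$, decide whether there is a stable $F\subseteq E$ with $|F|\ge k$; $F$ is stable if $\ell(e)=\ell(e')$ whenever $e,e'\in F$ share a vertex. Tree-cut width: a rooted tree-cut decomposition of $G$ is $(T,\mathcal{X},t_0)$ with $T=(W,F)$ a tree rooted at $t_0$ and $\mathcal{X}=\{X_t: t\in W\}$ pairwise disjoint (possibly empty) sets with union $V$. For a tree edge $e$ splitting $T$ into $T_1,T_2$, $\mathrm{cut}(e)$ is the set of edges of $G$ with one endpoint in bags of $T_1$ and the other in bags of $T_2$. For $t\neq t_0$, $\mathrm{adh}(t)=|\mathrm{cut}(e(t))|$ where $e(t)$ is the edge from $t$ toward $t_0$; $\mathrm{adh}(t_0)=0$. The torso $H_t$ is obtained from $G$ by contracting, for each component $T_i$ of $T-t$, the union $Z_i$ of its bags into a single vertex (adjacent to all neighbors of $Z_i$, possibly with parallel edges); $\mathrm{tor}(t)$ is the number of vertices after exhaustively suppressing vertices of $H_t - X_t$ of degree at most two (degree-1 vertices are deleted, degree-2 vertices replaced by an edge between their neighbors). The width is $\max_t\max(\mathrm{adh}(t),\mathrm{tor}(t))$, and the tree-cut width of $G$ is the minimum width over all rooted tree-cut decompositions. *)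

theory Defs
  imports Main "HOL-Library.Multiset"
begin

section \<open>Model of computation\<close>

text \<open>
  Structured programs over stacks of bits.  A program mentions finitely many stacks, every basic
  step inspects or changes a single top symbol and costs one time unit.  Two stacks represent one
  tape, so this is multitape Turing machine time up to a constant factor (depending on the
  program), given structured control flow.
\<close>

type_synonym store = "nat \<Rightarrow> bool list"

datatype prog =
    Skip
  | Push nat bool
  | Pop nat
  | Seq prog prog
  | Branch nat prog prog prog
  | While nat prog

text \<open>
  \<open>exec p s t s'\<close>: started in \<open>s\<close>, program \<open>p\<close> halts in \<open>s'\<close> after \<open>t\<close> steps.
  \<open>Branch i p q r\<close> runs \<open>p\<close>, \<open>q\<close> or \<open>r\<close> if stack \<open>i\<close> is empty, has top symbol \<open>False\<close>, or has
  top symbol \<open>True\<close>, respectively; \<open>While i p\<close> iterates \<open>p\<close> as long as stack \<open>i\<close> is nonempty;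
  popping an empty stack has no effect.
\<close>

inductive exec :: "prog \<Rightarrow> store \<Rightarrow> nat \<Rightarrow> store \<Rightarrow> bool" where
  Skip: "exec Skip s 1 s"
| Push: "exec (Push i b) s 1 (s(i := b # s i))"
| Pop: "exec (Pop i) s 1 (s(i := tl (s i)))"
| Seq: "exec p s t s' \<Longrightarrow> exec q s' t' s'' \<Longrightarrow> exec (Seq p q) s (t + t') s''"
| Branch_empty: "s i = [] \<Longrightarrow> exec p s t s' \<Longrightarrow> exec (Branch i p q r) s (t + 1) s'"
| Branch_False: "s i = False # xs \<Longrightarrow> exec q s t s' \<Longrightarrow> exec (Branch i p q r) s (t + 1) s'"
| Branch_True: "s i = True # xs \<Longrightarrow> exec r s t s' \<Longrightarrow> exec (Branch i p q r) s (t + 1) s'"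
| While_done: "s i = [] \<Longrightarrow> exec (While i p) s 1 s"
| While_step: "s i \<noteq> [] \<Longrightarrow> exec p s t s' \<Longrightarrow> exec (While i p) s' t' s'' \<Longrightarrow>
    exec (While i p) s (t + t' + 1) s''"

text \<open>Input and output are on stack 0, all other stacks are initially empty.\<close>

definition init_store :: "bool list \<Rightarrow> store" where
  "init_store x = (\<lambda>_. [])(0 := x)"

definition computes_within ::
    "prog \<Rightarrow> (bool list \<Rightarrow> bool list) \<Rightarrow> (bool list \<Rightarrow> nat) \<Rightarrow> bool" where
  "computes_within p R T \<longleftrightarrow>
     (\<forall>x. \<exists>t s. exec p (init_store x) t s \<and> s 0 = R x \<and> t \<le> T x)"

definition computable :: "(nat \<Rightarrow> nat) \<Rightarrow> bool" where
  "computable f \<longleftrightarrow>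
     (\<exists>p. \<forall>n. \<exists>t s. exec p (init_store (replicate n True)) t s \<and> s 0 = replicate (f n) True)"


section \<open>Parameterized problems and W[1]-hardness\<close>

text \<open>A language over the binary alphabet together with the parameter of each input.\<close>

type_synonym param_problem = "bool list set \<times> (bool list \<Rightarrow> nat)"

text \<open>
  The reduction \<open>R\<close> is computable in time \<open>f(\<kappa>(x)) \<cdot> |x|\<^sup>O\<^sup>(\<^sup>1\<^sup>)\<close>; the summand 1 only
  accounts for the empty input.
\<close>

definition fpt_reducible :: "param_problem \<Rightarrow> param_problem \<Rightarrow> bool" where
  "fpt_reducible A B \<longleftrightarrow>
     (\<exists>p R f g c. computable f \<and> computable g \<and>
        computes_within p R (\<lambda>x. f (snd A x) * (length x + 1) ^ c) \<and>
        (\<forall>x. (x \<in> fst A \<longleftrightarrow> R x \<in> fst B) \<and> snd B (R x) \<le> g (snd A x)))"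

text \<open>
  Numbers in inputs are written in unary: a block of \<open>True\<close>s closed by a \<open>False\<close>.  An unclosed
  block at the end is ignored, so that every bit string denotes a list of numbers.  The first
  argument of \<open>nats_from\<close> is the length of the current block so far.
\<close>

fun nats_from :: "nat \<Rightarrow> bool list \<Rightarrow> nat list" where
  "nats_from a [] = []"
| "nats_from a (True # xs) = nats_from (Suc a) xs"
| "nats_from a (False # xs) = a # nats_from 0 xs"

fun pairs :: "nat list \<Rightarrow> (nat \<times> nat) list" where
  "pairs (u # v # xs) = (u, v) # pairs xs"
| "pairs _ = []"

fun triples :: "nat list \<Rightarrow> (nat \<times> nat \<times> nat) list" where
  "triples (u # v # c # xs) = (u, v, c) # triples xs"
| "triples _ = []"

text \<open>Number of vertices, target size \<open>k\<close>, and the remaining entries, which list the edges.\<close>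

definition instance_of :: "bool list \<Rightarrow> nat \<times> nat \<times> nat list" where
  "instance_of x = (case nats_from 0 x of n # k # r \<Rightarrow> (n, k, r) | _ \<Rightarrow> (0, 0, []))"

definition inst_vertices :: "bool list \<Rightarrow> nat set" where
  "inst_vertices x = {..<fst (instance_of x)}"

definition inst_k :: "bool list \<Rightarrow> nat" where
  "inst_k x = fst (snd (instance_of x))"

definition inst_entries :: "bool list \<Rightarrow> nat list" where
  "inst_entries x = snd (snd (instance_of x))"

definition is_clique :: "'a set \<Rightarrow> 'a set set \<Rightarrow> 'a set \<Rightarrow> bool" where
  "is_clique V E S \<longleftrightarrow> S \<subseteq> V \<and> (\<forall>u\<in>S. \<forall>v\<in>S. u \<noteq> v \<longrightarrow> {u, v} \<in> E)"

text \<open>Listed pairs that are loops or mention a non-vertex are ignored.\<close>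

definition clique_edges :: "bool list \<Rightarrow> nat set set" where
  "clique_edges x = {{u, v} | u v. (u, v) \<in> set (pairs (inst_entries x)) \<and>
     u \<in> inst_vertices x \<and> v \<in> inst_vertices x \<and> u \<noteq> v}"

definition p_clique :: param_problem where
  "p_clique =
     ({x. \<exists>S. is_clique (inst_vertices x) (clique_edges x) S \<and> card S = inst_k x}, inst_k)"

text \<open>
  W[1] is the closure of \<open>k\<close>-Clique, parameterized by \<open>k\<close>, under fpt-reductions; by Downey and
  Fellows this is the class obtained from weighted satisfiability of weft-1 circuits.
\<close>

definition W1 :: "param_problem set" where
  "W1 = {A. fpt_reducible A p_clique}"

definition W1_hard :: "param_problem \<Rightarrow> bool" where
  "W1_hard B \<longleftrightarrow> (\<forall>A\<in>W1. fpt_reducible A B)"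


section \<open>Graphs\<close>

text \<open>A simple graph is given by its vertex set and its edge set, edges being two-element sets.\<close>

definition bipartite :: "'a set \<Rightarrow> 'a set set \<Rightarrow> bool" where
  "bipartite V E \<longleftrightarrow>
     (\<exists>A B. A \<union> B = V \<and> A \<inter> B = {} \<and> (\<forall>e\<in>E. \<exists>a\<in>A. \<exists>b\<in>B. e = {a, b}))"

definition vertex_cover :: "'a set \<Rightarrow> 'a set set \<Rightarrow> 'a set \<Rightarrow> bool" where
  "vertex_cover V E S \<longleftrightarrow> S \<subseteq> V \<and> (\<forall>e\<in>E. e \<inter> S \<noteq> {})"

definition vertex_cover_number :: "'a set \<Rightarrow> 'a set set \<Rightarrow> nat" where
  "vertex_cover_number V E = (LEAST s. \<exists>S. vertex_cover V E S \<and> card S = s)"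

definition reachable :: "'a set set \<Rightarrow> 'a \<Rightarrow> 'a \<Rightarrow> bool" where
  "reachable E u v \<longleftrightarrow> (u, v) \<in> {(a, b). {a, b} \<in> E}\<^sup>*"

definition components :: "'a set \<Rightarrow> 'a set set \<Rightarrow> 'a set set" where
  "components V E = {{v \<in> V. reachable E u v} | u. u \<in> V}"

definition cycle :: "'a set set \<Rightarrow> 'a list \<Rightarrow> bool" where
  "cycle E vs \<longleftrightarrow> 3 \<le> length vs \<and> distinct vs \<and>
     (\<forall>i<length vs. {vs ! i, vs ! (Suc i mod length vs)} \<in> E)"

definition is_tree :: "'a set \<Rightarrow> 'a set set \<Rightarrow> bool" where
  "is_tree W F \<longleftrightarrow> finite W \<and> W \<noteq> {} \<and>
     F \<subseteq> {{u, v} | u v. u \<in> W \<and> v \<in> W \<and> u \<noteq> v} \<and>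
     (\<forall>u\<in>W. \<forall>v\<in>W. reachable F u v) \<and> (\<nexists>vs. cycle F vs)"


section \<open>Tree-cut width\<close>

definition rooted_tree_cut_decomposition ::
    "'a set \<Rightarrow> 'b set \<Rightarrow> 'b set set \<Rightarrow> ('b \<Rightarrow> 'a set) \<Rightarrow> 'b \<Rightarrow> bool" where
  "rooted_tree_cut_decomposition V W F X t0 \<longleftrightarrow>
     is_tree W F \<and> t0 \<in> W \<and> (\<Union>t\<in>W. X t) = V \<and>
     (\<forall>s\<in>W. \<forall>t\<in>W. s \<noteq> t \<longrightarrow> X s \<inter> X t = {})"

definition cut :: "'a set set \<Rightarrow> 'b set \<Rightarrow> 'b set set \<Rightarrow> ('b \<Rightarrow> 'a set) \<Rightarrow> 'b set \<Rightarrow> 'a set set" where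
  "cut E W F X e = {{u, v} | u v. {u, v} \<in> E \<and>
     (\<exists>T1\<in>components W (F - {e}). \<exists>T2\<in>components W (F - {e}). T1 \<noteq> T2 \<and>
        u \<in> (\<Union>t\<in>T1. X t) \<and> v \<in> (\<Union>t\<in>T2. X t))}"

definition edges_minus_node :: "'b set set \<Rightarrow> 'b \<Rightarrow> 'b set set" where
  "edges_minus_node F t = {f \<in> F. t \<notin> f}"

definition parent_edge :: "'b set set \<Rightarrow> 'b \<Rightarrow> 'b \<Rightarrow> 'b set" where
  "parent_edge F t0 t =
     (THE e. e \<in> F \<and> (\<exists>s. e = {t, s} \<and> reachable (edges_minus_node F t) s t0))"

definition adh ::
    "'a set set \<Rightarrow> 'b set \<Rightarrow> 'b set set \<Rightarrow> ('b \<Rightarrow> 'a set) \<Rightarrow> 'b \<Rightarrow> 'b \<Rightarrow> nat" where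
  "adh E W F X t0 t = (if t = t0 then 0 else card (cut E W F X (parent_edge F t0 t)))"

text \<open>Loopless multigraphs: a vertex set and a multiset of two-element edges.\<close>

type_synonym 'v multigraph = "'v set \<times> 'v set multiset"

text \<open>
  In the torso at \<open>t\<close>, \<open>Inl v\<close> is the bag vertex \<open>v\<close> and \<open>Inr C\<close> is the vertex obtained by
  contracting the bags of the component \<open>C\<close> of \<open>T - t\<close>.  Parallel edges are kept, and edges inside
  a contracted set disappear.
\<close>

definition torso_vertex ::
    "'b set \<Rightarrow> 'b set set \<Rightarrow> ('b \<Rightarrow> 'a set) \<Rightarrow> 'b \<Rightarrow> 'a \<Rightarrow> 'a + 'b set" where
  "torso_vertex W F X t v = (if v \<in> X t then Inl v else
     Inr (THE C. C \<in> components (W - {t}) (edges_minus_node F t) \<and> v \<in> (\<Union>s\<in>C. X s)))"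

definition torso ::
    "'a set set \<Rightarrow> 'b set \<Rightarrow> 'b set set \<Rightarrow> ('b \<Rightarrow> 'a set) \<Rightarrow> 'b \<Rightarrow> ('a + 'b set) multigraph" where
  "torso E W F X t =
     (Inl ` X t \<union> Inr ` components (W - {t}) (edges_minus_node F t),
      filter_mset (\<lambda>e. card e = 2)
        (image_mset (\<lambda>e. torso_vertex W F X t ` e) (mset_set E)))"

definition incident :: "'v \<Rightarrow> 'v set multiset \<Rightarrow> 'v set multiset" where
  "incident v M = filter_mset (\<lambda>e. v \<in> e) M"

text \<open>
  Suppression of a vertex outside \<open>X\<close>.  If both edges of a degree-2 vertex lead to the same
  neighbor, the resulting loop is dropped.
\<close>

inductive suppress :: "'v set \<Rightarrow> 'v multigraph \<Rightarrow> 'v multigraph \<Rightarrow> bool" for X where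
  deg_le_1: "v \<in> V - X \<Longrightarrow> size (incident v M) \<le> 1 \<Longrightarrow>
    suppress X (V, M) (V - {v}, M - incident v M)"
| deg_2: "v \<in> V - X \<Longrightarrow> incident v M = {#{v, a}, {v, b}#} \<Longrightarrow>
    suppress X (V, M)
      (V - {v}, (M - incident v M) + (if a = b then {#} else {#{a, b}#}))"

text \<open>
  Exhaustive suppression always ends with the same number of vertices, whatever the order;
  \<open>LEAST\<close> just selects this number.
\<close>

definition tor :: "'a set set \<Rightarrow> 'b set \<Rightarrow> 'b set set \<Rightarrow> ('b \<Rightarrow> 'a set) \<Rightarrow> 'b \<Rightarrow> nat" where
  "tor E W F X t = (LEAST n. \<exists>H. (suppress (Inl ` X t))\<^sup>*\<^sup>* (torso E W F X t) H \<and>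
     (\<nexists>H'. suppress (Inl ` X t) H H') \<and> card (fst H) = n)"

definition tree_cut_decomposition_width ::
    "'a set set \<Rightarrow> 'b set \<Rightarrow> 'b set set \<Rightarrow> ('b \<Rightarrow> 'a set) \<Rightarrow> 'b \<Rightarrow> nat" where
  "tree_cut_decomposition_width E W F X t0 =
     Max ((\<lambda>t. max (adh E W F X t0 t) (tor E W F X t)) ` W)"

text \<open>Every finite tree is isomorphic to one whose nodes are natural numbers.\<close>

definition tree_cut_width :: "'a set \<Rightarrow> 'a set set \<Rightarrow> nat" where
  "tree_cut_width V E = (LEAST w. \<exists>(W :: nat set) F X t0.
     rooted_tree_cut_decomposition V W F X t0 \<and> tree_cut_decomposition_width E W F X t0 = w)"


section \<open>Colored Clustering\<close>

definition stable :: "'a set set \<Rightarrow> ('a set \<Rightarrow> 'c) \<Rightarrow> 'a set set \<Rightarrow> bool" where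
  "stable E l F \<longleftrightarrow> F \<subseteq> E \<and> (\<forall>e\<in>F. \<forall>e'\<in>F. e \<inter> e' \<noteq> {} \<longrightarrow> l e = l e')"

definition colored_clustering :: "'a set set \<Rightarrow> ('a set \<Rightarrow> 'c) \<Rightarrow> nat \<Rightarrow> bool" where
  "colored_clustering E l k \<longleftrightarrow> (\<exists>F. stable E l F \<and> card F \<ge> k)"

text \<open>
  An entry \<open>(u, v, c)\<close> lists the edge \<open>{u, v}\<close> with color \<open>c\<close>.  Entries that are loops or mention
  a non-vertex are ignored; if an edge is listed repeatedly, its first entry determines the color.
\<close>

definition cc_edges :: "bool list \<Rightarrow> nat set set" where
  "cc_edges x = {{u, v} | u v c. (u, v, c) \<in> set (triples (inst_entries x)) \<and>
     u \<in> inst_vertices x \<and> v \<in> inst_vertices x \<and> u \<noteq> v}"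

definition cc_color :: "bool list \<Rightarrow> nat set \<Rightarrow> nat" where
  "cc_color x e = the (map_of (map (\<lambda>(u, v, c). ({u, v}, c)) (triples (inst_entries x))) e)"

definition bipartite_colored_clustering :: "bool list set" where
  "bipartite_colored_clustering =
     {x. bipartite (inst_vertices x) (cc_edges x) \<and>
         colored_clustering (cc_edges x) (cc_color x) (inst_k x)}"

definition vertex_cover_parameter :: "bool list \<Rightarrow> nat" where
  "vertex_cover_parameter x = vertex_cover_number (inst_vertices x) (cc_edges x)"

definition tree_cut_width_parameter :: "bool list \<Rightarrow> nat" where
  "tree_cut_width_parameter x = tree_cut_width (inst_vertices x) (cc_edges x)"

end

theory Submission
  imports Defs
begin

text \<open>
  Given a graph on \<open>n\<close> vertices and \<open>k\<close>, take \<open>k\<close> selectors; selector \<open>i\<close> chooses a vertex \<open>u\<close> by settling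
  on the color \<open>i * n + u\<close>.  All other vertices are adjacent to selectors only and have degree at most
  two with distinct colors, so each is worth 1 if one of its colors is chosen and 0 otherwise.  For
  selectors \<open>j < i\<close> and vertices \<open>u, v\<close> there are two pendant vertices, at \<open>i\<close> and at \<open>j\<close>, if \<open>u, v\<close> are
  adjacent, and one vertex shared by \<open>i\<close> and \<open>j\<close> otherwise; a further pendant for each \<open>i, u\<close> keeps the
  target positive if \<open>k = 1\<close> or \<open>n = 0\<close>.  A choice thus attains the maximal
  conceivable value iff no pair of chosen vertices is equal or nonadjacent, that is, iff the choice
  is a clique.  The selectors are a vertex cover, and the star with the selectors in its center has
  width at most \<open>max k 2\<close>, because degree-2 vertices are suppressed in the torso.
\<close>

section \<open>Running programs with time bounds\<close>

text \<open>W[1]-hardness concerns every problem that reduces to clique, so the construction has to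
  be composed with an arbitrary fpt-reduction. The time of that reduction bounds the length of its
  output, and the stacks it leaves behind must be erased before another program can start.

  The offset \<open>i * n\<close> keeps the color blocks of the selectors disjoint. Otherwise a
  shared vertex could have two edges of the same color and be worth 2. The color of \<open>u\<close>
  at selector \<open>i\<close> occurs once for every \<open>v\<close> in the gadgets of a pair
  \<open>i, j\<close>. Hence two selectors collect at most \<open>2 * n\<close> from their common
  gadgets, and one less if their two chosen vertices share a gadget.

  A stack is accessible at its top only, so the instance is written from its last entry to its
  first. This explains the descending lists and the vertex numbers counted from the back. The
  header, which comes first in the encoding, is pushed last, from counters kept up to date by the
  loops.\<close>

definition exec_le :: "prog \<Rightarrow> store \<Rightarrow> nat \<Rightarrow> store \<Rightarrow> bool" where
  "exec_le p s T s' \<longleftrightarrow> (\<exists>t\<le>T. exec p s t s')"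

lemma exec_le_mono: "exec_le p s T s' \<Longrightarrow> T \<le> T' \<Longrightarrow> exec_le p s T' s'"
  unfolding exec_le_def by (meson le_trans)

lemma exec_le_Skip: "exec_le Skip s 1 s"
  unfolding exec_le_def by (blast intro: exec.Skip)

lemma exec_le_Push: "exec_le (Push i b) s 1 (s(i := b # s i))"
  unfolding exec_le_def by (blast intro: exec.Push)

lemma exec_le_Pop: "exec_le (Pop i) s 1 (s(i := tl (s i)))"
  unfolding exec_le_def by (blast intro: exec.Pop)

lemma exec_le_Seq:
  "exec_le p s T s' \<Longrightarrow> exec_le q s' T' s'' \<Longrightarrow> exec_le (Seq p q) s (T + T') s''"
  unfolding exec_le_def by (meson exec.Seq add_mono)

lemma exec_le_Branch:
  assumes "s i = [] \<Longrightarrow> exec_le p s T s'"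
    and "\<And>xs. s i = False # xs \<Longrightarrow> exec_le q s T s'"
    and "\<And>xs. s i = True # xs \<Longrightarrow> exec_le r s T s'"
  shows "exec_le (Branch i p q r) s (T + 1) s'"
proof (cases "s i")
  case Nil
  with assms(1) show ?thesis
    unfolding exec_le_def by (meson Branch_empty add_le_mono1)
next
  case (Cons b xs)
  show ?thesis
  proof (cases b)
    case True
    with Cons have "s i = True # xs" by simp
    with assms(3)[OF this] show ?thesis
      unfolding exec_le_def by (meson Branch_True add_le_mono1)
  next
    case False
    with Cons have "s i = False # xs" by simp
    with assms(2)[OF this] show ?thesis
      unfolding exec_le_def by (meson Branch_False add_le_mono1)
  qed
qed

text \<open>The bit is popped before the body runs, so the body sees the rest of the stack. The
  \<open>Skip\<close> branch is unreachable, since \<open>While\<close> has already found the stack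
  nonempty.\<close>

definition each_bit :: "nat \<Rightarrow> prog \<Rightarrow> prog \<Rightarrow> prog" where
  "each_bit i p q = While i (Branch i Skip (Seq (Pop i) p) (Seq (Pop i) q))"

lemma exec_le_While_step:
  assumes "s i \<noteq> []" "exec_le p s T s'" "exec_le (While i p) s' T' s''"
  shows "exec_le (While i p) s (T + T' + 1) s''"
  using assms unfolding exec_le_def by (meson While_step add_mono le_refl)

text \<open>\<open>S ys\<close> is the loop invariant after consuming the prefix \<open>ys\<close>;
  stack \<open>i\<close> is overwritten separately by the unread suffix, so \<open>S\<close> need
  not describe it. The 3 extra steps per bit are those of \<open>While\<close>,
  \<open>Branch\<close> and \<open>Pop\<close>.\<close>

lemma exec_le_each_bit:
  assumes step: "\<And>ys b zs. xs = ys @ b # zs \<Longrightarrow>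
    exec_le (if b then q else p) ((S ys)(i := zs)) T ((S (ys @ [b]))(i := zs))"
    and s: "s = (S [])(i := xs)" and s': "s' = (S xs)(i := [])"
  shows "exec_le (each_bit i p q) s (length xs * (T + 3) + 1) s'"
proof -
  have "exec_le (each_bit i p q) ((S ys)(i := zs)) (length zs * (T + 3) + 1) ((S xs)(i := []))"
    if "xs = ys @ zs" for ys zs
    using that
  proof (induction zs arbitrary: ys)
    case Nil
    then show ?case
      unfolding each_bit_def exec_le_def by (auto intro!: exI[of _ 1] exec.While_done)
  next
    case (Cons b zs)
    have rest: "exec_le (each_bit i p q) ((S (ys @ [b]))(i := zs)) (length zs * (T + 3) + 1)
        ((S xs)(i := []))"
      using Cons.prems by (intro Cons.IH) simp
    have pop: "exec_le (Pop i) ((S ys)(i := b # zs)) 1 ((S ys)(i := zs))"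
      using exec_le_Pop[of i "(S ys)(i := b # zs)"] by simp
    have "exec_le (Branch i Skip (Seq (Pop i) p) (Seq (Pop i) q)) ((S ys)(i := b # zs)) (1 + T + 1)
        ((S (ys @ [b]))(i := zs))"
      using exec_le_Seq[OF pop step[OF Cons.prems]] by (intro exec_le_Branch) auto
    from exec_le_While_step[OF _ this rest[unfolded each_bit_def]]
    show ?case
      unfolding each_bit_def by (rule exec_le_mono) (simp_all add: algebra_simps)
  qed
  from this[of "[]" xs] show ?thesis
    by (simp add: s s')
qed

lemma exec_le_each_bit_unary:
  assumes step: "\<And>m. m < n \<Longrightarrow>
    exec_le p ((S m)(i := replicate (n - Suc m) True)) T
      ((S (Suc m))(i := replicate (n - Suc m) True))"
    and s: "s = (S 0)(i := replicate n True)" and s': "s' = (S n)(i := [])"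
  shows "exec_le (each_bit i p p) s (n * (T + 3) + 1) s'"
proof -
  have "exec_le (each_bit i p p) s (length (replicate n True) * (T + 3) + 1) s'"
  proof (rule exec_le_each_bit[where S = "\<lambda>ys. S (length ys)"])
    fix ys b and zs :: "bool list"
    assume eq: "replicate n True = ys @ b # zs"
    then have "n = length ys + Suc (length zs)"
      by (metis length_Cons length_append length_replicate)
    moreover from eq have "zs = replicate (length zs) True"
      by (metis in_set_conv_decomp in_set_replicate replicate_eqI append_Cons append_assoc
          append_is_Nil_conv in_set_conv_decomp Un_iff set_append list.set_intros(2))
    ultimately show "exec_le (if b then p else p) ((S (length ys))(i := zs)) T
        ((S (length (ys @ [b])))(i := zs))"
      using step[of "length ys"] by simp
  qed (auto simp: s s')
  then show ?thesis by simp
qed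

definition clear :: "nat \<Rightarrow> prog" where
  "clear i = each_bit i Skip Skip"

lemma exec_le_clear:
  assumes "length (s i) \<le> Z"
  shows "exec_le (clear i) s (4 * Z + 1) (s(i := []))"
proof -
  have "exec_le (clear i) s (length (s i) * (1 + 3) + 1) (s(i := []))"
    unfolding clear_def
    by (rule exec_le_each_bit[where S = "\<lambda>_. s"]) (use exec_le_Skip in auto)
  then show ?thesis
    using assms by (auto elim!: exec_le_mono)
qed

definition move :: "nat \<Rightarrow> nat \<Rightarrow> prog" where
  "move i j = each_bit i (Push j False) (Push j True)"

lemma exec_le_move:
  assumes "i \<noteq> j" "length (s i) \<le> Z"
  shows "exec_le (move i j) s (4 * Z + 1) (s(i := [], j := rev (s i) @ s j))"
proof -
  have "exec_le (move i j) s (length (s i) * (1 + 3) + 1) (s(i := [], j := rev (s i) @ s j))"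
    unfolding move_def
  proof (rule exec_le_each_bit[where S = "\<lambda>ys. s(j := rev ys @ s j)"])
    fix ys b zs
    show "exec_le (if b then Push j True else Push j False) ((s(j := rev ys @ s j))(i := zs)) 1
        ((s(j := rev (ys @ [b]) @ s j))(i := zs))"
      using exec_le_Push[of j b "(s(j := rev ys @ s j))(i := zs)"] assms(1)
      by (cases b) (simp_all add: fun_upd_twist)
  qed (use assms(1) in \<open>auto simp: fun_eq_iff\<close>)
  then show ?thesis
    using assms by (auto elim!: exec_le_mono)
qed

text \<open>\<open>move\<close> reverses the word onto the empty scratch stack \<open>t\<close>;
  unloading \<open>t\<close> reverses it back, onto the target and onto the emptied source.\<close>

definition copy :: "nat \<Rightarrow> nat \<Rightarrow> nat \<Rightarrow> prog" where
  "copy i j t = Seq (move i t)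
     (each_bit t (Seq (Push i False) (Push j False)) (Seq (Push i True) (Push j True)))"

lemma exec_le_copy:
  assumes "i \<noteq> j" "i \<noteq> t" "j \<noteq> t" "s t = []" "length (s i) \<le> Z"
  shows "exec_le (copy i j t) s (9 * Z + 2) (s(j := s i @ s j))"
proof -
  let ?s = "s(i := [], t := rev (s i))"
  have push: "exec_le (Seq (Push i b) (Push j b)) s' 2 (s'(i := b # s' i, j := b # s' j))" for b s'
    using exec_le_Seq[OF exec_le_Push[of i b s'] exec_le_Push[of j b]] assms(1) by (simp add: numeral_2_eq_2)
  have "exec_le (each_bit t (Seq (Push i False) (Push j False)) (Seq (Push i True) (Push j True)))
     ?s (length (rev (s i)) * (2 + 3) + 1) (s(j := s i @ s j))"
  proof (rule exec_le_each_bit[where S = "\<lambda>ys. ?s(i := rev ys, j := rev ys @ s j)"])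
    fix ys b zs
    show "exec_le (if b then Seq (Push i True) (Push j True) else Seq (Push i False) (Push j False))
        ((?s(i := rev ys, j := rev ys @ s j))(t := zs)) 2
        ((?s(i := rev (ys @ [b]), j := rev (ys @ [b]) @ s j))(t := zs))"
      using push[of b "(?s(i := rev ys, j := rev ys @ s j))(t := zs)"] assms(1-3)
      by (cases b) (simp_all add: fun_upd_twist)
  qed (use assms in \<open>auto simp: fun_eq_iff\<close>)
  moreover have "exec_le (move i t) s (4 * Z + 1) ?s"
    using exec_le_move[of i t s Z] assms by simp
  ultimately have "exec_le (copy i j t) s
      (4 * Z + 1 + (length (rev (s i)) * (2 + 3) + 1)) (s(j := s i @ s j))"
    unfolding copy_def by (rule exec_le_Seq[rotated])
  then show ?thesis
    using assms(5) by (auto elim!: exec_le_mono)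
qed

section \<open>Composing programs\<close>

fun stacks :: "prog \<Rightarrow> nat list" where
  "stacks Skip = []"
| "stacks (Push i b) = [i]"
| "stacks (Pop i) = [i]"
| "stacks (Seq p q) = stacks p @ stacks q"
| "stacks (Branch i p q r) = i # stacks p @ stacks q @ stacks r"
| "stacks (While i p) = i # stacks p"

lemma exec_frame: "exec p s t s' \<Longrightarrow> i \<notin> set (stacks p) \<Longrightarrow> s' i = s i"
  by (induction rule: exec.induct) auto

text \<open>A step pushes at most one symbol. The running time therefore bounds both the output
  handed to a second program and the garbage to be erased before it starts.\<close>

lemma exec_length: "exec p s t s' \<Longrightarrow> length (s' i) \<le> length (s i) + t"
  by (induction rule: exec.induct) auto

definition clear_all :: "nat list \<Rightarrow> prog" where
  "clear_all is = foldr (\<lambda>i. Seq (clear i)) is Skip"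

lemma exec_le_clear_all:
  "(\<And>i. length (s i) \<le> Z) \<Longrightarrow>
   exec_le (clear_all is) s (length is * (4 * Z + 1) + 1) (\<lambda>i. if i \<in> set is then [] else s i)"
proof (induction "is" arbitrary: s)
  case Nil
  then show ?case
    using exec_le_Skip[of s] by (simp add: clear_all_def)
next
  case (Cons j "is")
  have "exec_le (Seq (clear j) (clear_all is)) s
      (4 * Z + 1 + (length is * (4 * Z + 1) + 1))
      (\<lambda>i. if i \<in> set is then [] else (s(j := [])) i)"
    by (rule exec_le_Seq[OF exec_le_clear[OF Cons.prems]], rule Cons.IH) (simp add: Cons.prems)
  moreover have "(\<lambda>i. if i \<in> set is then [] else (s(j := [])) i) =
      (\<lambda>i. if i \<in> set (j # is) then [] else s i)"
    by (auto simp: fun_eq_iff)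
  ultimately show ?case
    by (simp add: clear_all_def algebra_simps)
qed

text \<open>A second program expects every stack but 0 to be empty. Only stacks mentioned in
  \<open>p\<close> can be dirty, and these are finitely many.\<close>

definition tidy :: "prog \<Rightarrow> prog" where
  "tidy p = Seq p (clear_all (filter (\<lambda>i. i \<noteq> 0) (stacks p)))"

lemma exec_tidy:
  assumes "exec p (init_store x) t s"
  shows "exec_le (tidy p) (init_store x)
    (t + (length (stacks p) * (4 * (length x + t) + 1) + 1)) (init_store (s 0))"
proof -
  let ?is = "filter (\<lambda>i. i \<noteq> 0) (stacks p)"
  have "length (s i) \<le> length x + t" for i
    using exec_length[OF assms, of i] by (auto simp: init_store_def split: if_splits)
  then have "exec_le (clear_all ?is) s (length ?is * (4 * (length x + t) + 1) + 1)
      (\<lambda>i. if i \<in> set ?is then [] else s i)"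
    by (rule exec_le_clear_all)
  moreover have "(\<lambda>i. if i \<in> set ?is then [] else s i) = init_store (s 0)"
    using exec_frame[OF assms] by (auto simp: fun_eq_iff init_store_def)
  moreover have "length ?is * (4 * (length x + t) + 1) \<le> length (stacks p) * (4 * (length x + t) + 1)"
    by (intro mult_le_mono1) simp
  ultimately have "exec_le (clear_all ?is) s
      (length (stacks p) * (4 * (length x + t) + 1) + 1) (init_store (s 0))"
    by (auto elim!: exec_le_mono)
  moreover have "exec_le p (init_store x) t s"
    using assms unfolding exec_le_def by blast
  ultimately show ?thesis
    unfolding tidy_def by (rule exec_le_Seq[rotated])
qed

section \<open>Computable time bounds and composition with an fpt-reduction\<close>

lemma computable_comp:
  assumes "computable g" "computable f"
  shows "computable (\<lambda>n. g (f n))"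
proof -
  from assms obtain p q where
    p: "\<And>n. \<exists>t s. exec p (init_store (replicate n True)) t s \<and> s 0 = replicate (f n) True" and
    q: "\<And>n. \<exists>t s. exec q (init_store (replicate n True)) t s \<and> s 0 = replicate (g n) True"
    unfolding computable_def by metis
  have "\<exists>t s. exec (Seq (tidy p) q) (init_store (replicate n True)) t s \<and>
      s 0 = replicate (g (f n)) True" for n
  proof -
    from p obtain t s where "exec p (init_store (replicate n True)) t s" "s 0 = replicate (f n) True"
      by blast
    with exec_tidy[OF this(1)] obtain t' where
      "exec (tidy p) (init_store (replicate n True)) t' (init_store (replicate (f n) True))"
      unfolding exec_le_def by auto
    with q[of "f n"] show ?thesis
      by (blast intro: exec.Seq)
  qed
  then show ?thesis
    unfolding computable_def by blast
qed

lemma computable_Suc: "computable Suc"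
  unfolding computable_def
proof (intro exI allI conjI)
  fix n
  show "exec (Push 0 True) (init_store (replicate n True)) 1
      ((init_store (replicate n True))(0 := True # init_store (replicate n True) 0))"
    by (rule exec.Push)
qed (simp add: init_store_def)

lemma computable_square: "computable (\<lambda>n. n ^ 2)"
proof -
  let ?p = "Seq (copy 0 1 2) (Seq (each_bit 1 (copy 0 3 2) (copy 0 3 2)) (Seq (clear 0) (move 3 0)))"
  have "\<exists>T. exec_le ?p (init_store (replicate n True)) T (init_store (replicate (n ^ 2) True))" for n
  proof -
    define s where "s = init_store (replicate n True)"
    have s: "s 0 = replicate n True" "s 1 = []" "s (Suc 0) = []" "s 2 = []" "s 3 = []"
      by (simp_all add: s_def init_store_def)
    let ?s1 = "s(1 := replicate n True)"
    let ?s2 = "s(3 := replicate (n * n) True)"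
    have 1: "exec_le (copy 0 1 2) s (9 * n + 2) ?s1"
      using exec_le_copy[of 0 1 2 s n] s by simp
    have 2: "exec_le (each_bit 1 (copy 0 3 2) (copy 0 3 2)) ?s1 (n * (9 * n + 2 + 3) + 1) ?s2"
    proof (rule exec_le_each_bit_unary[where S = "\<lambda>m. s(3 := replicate (m * n) True)"])
      fix m
      show "exec_le (copy 0 3 2) ((s(3 := replicate (m * n) True))(1 := replicate (n - Suc m) True))
         (9 * n + 2)
         ((s(3 := replicate (Suc m * n) True))(1 := replicate (n - Suc m) True))"
        using exec_le_copy[of 0 3 2 "(s(3 := replicate (m * n) True))(1 := replicate (n - Suc m) True)" n] s
        by (simp add: replicate_add fun_upd_twist)
    qed (use s in \<open>auto simp: fun_eq_iff\<close>)
    have 3: "exec_le (clear 0) ?s2 (4 * n + 1) (?s2(0 := []))"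
      using s by (intro exec_le_clear) auto
    have "?s2(0 := [], 3 := [], 0 := rev (replicate (n * n) True)) = init_store (replicate (n ^ 2) True)"
      by (auto simp: fun_eq_iff s_def init_store_def power2_eq_square)
    with exec_le_move[of 3 0 "?s2(0 := [])" "n * n"]
    have 4: "exec_le (move 3 0) (?s2(0 := [])) (4 * (n * n) + 1) (init_store (replicate (n ^ 2) True))"
      by simp
    from exec_le_Seq[OF 1 exec_le_Seq[OF 2 exec_le_Seq[OF 3 4]]] show ?thesis
      unfolding s_def by blast
  qed
  then show ?thesis
    unfolding computable_def exec_le_def by (metis fun_upd_same init_store_def)
qed

lemma computable_add_const: "computable f \<Longrightarrow> computable (\<lambda>n. f n + c)"
  by (induction c) (auto intro: computable_comp[OF computable_Suc])

text \<open>Iterated squaring suffices here: any fixed power of a positive base is majorized by one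
  whose exponent is a power of two.\<close>

lemma computable_power_of_two_power:
  "computable f \<Longrightarrow> computable (\<lambda>n. f n ^ (2 ^ e))"
proof (induction e)
  case (Suc e)
  from computable_comp[OF computable_square Suc.IH[OF Suc.prems]] show ?case
    by (simp add: power_mult[symmetric] mult.commute)
qed simp

text \<open>Here \<open>t\<close> is the time of the first program and \<open>v\<close> the number
  of its stack mentions; \<open>n\<close> and \<open>l\<close> are the input length and the
  intermediate length, both plus 1. The middle summand pays for \<open>tidy\<close>. All terms are
  compared with a power of the single quantity \<open>q\<close>.\<close>

lemma composed_time_bound:
  fixes a n c C d v :: nat
  assumes "t \<le> a * n ^ c" "1 \<le> n" "l \<le> n + t"
  shows "t + (v * (4 * (n + t) + 1) + 1) + C * l ^ d
    \<le> (a + 2) ^ (2 ^ (5 * v + C + 2 + Suc d)) * n ^ (Suc c * Suc d)"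
proof -
  \<comment> \<open>The base \<open>a + 2\<close> serves twice: it makes \<open>q\<close> dominate
    \<open>n + t\<close>, and, being at least 2, it can absorb constant factors as extra
    powers.\<close>
  define q where "q = (a + 2) * n ^ Suc c"
  have "n \<le> n ^ Suc c" and nc: "n ^ c \<le> n ^ Suc c"
    using power_increasing[of 1 "Suc c" n] power_increasing[of c "Suc c" n] assms(2) by simp_all
  moreover have "a * n ^ c \<le> a * n ^ Suc c"
    using nc by (intro mult_le_mono2)
  ultimately have nt: "n + t \<le> q" and tq: "t \<le> q"
    using assms(1) unfolding q_def add_mult_distrib by linarith+
  have q1: "1 \<le> q"
    using nt assms(2) by linarith
  define r where "r = q ^ Suc d"
  have qd: "q \<le> r" "1 \<le> r" "q ^ d \<le> r"
    using power_increasing[of 1 "Suc d" q] power_increasing[of d "Suc d" q] q1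
    unfolding r_def by simp_all
  have "v * (4 * (n + t) + 1) \<le> v * (5 * r)"
  proof (intro mult_le_mono2)
    have "4 * (n + t) \<le> 4 * r"
      using nt qd(1) by simp
    with qd(2) show "4 * (n + t) + 1 \<le> 5 * r" by simp
  qed
  moreover have "C * l ^ d \<le> C * r"
  proof -
    have "l ^ d \<le> q ^ d"
      using assms(3) nt by (intro power_mono) auto
    then show ?thesis
      using qd by (intro mult_le_mono2) linarith
  qed
  ultimately have "t + (v * (4 * (n + t) + 1) + 1) + C * l ^ d \<le> (5 * v + C + 2) * r"
  proof -
    have "(5 * v + C + 2) * r = v * (5 * r) + C * r + r + r"
      by (simp add: algebra_simps)
    moreover have "t \<le> r"
      using tq qd(1) by simp
    ultimately show ?thesis
      using \<open>v * (4 * (n + t) + 1) \<le> v * (5 * r)\<close> \<open>C * l ^ d \<le> C * r\<close> qd(2) by presburger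
  qed
  also have "\<dots> \<le> (a + 2) ^ (5 * v + C + 2) * r"
  proof (intro mult_le_mono1)
    \<comment> \<open>By \<open>m < 2 ^ m\<close> the constant factor turns into a power of
      \<open>a + 2\<close>, so that the parameter-dependent factor remains a pure power.\<close>
    have "5 * v + C + 2 < 2 ^ (5 * v + C + 2)"
      by (rule less_exp)
    also have "\<dots> \<le> (a + 2) ^ (5 * v + C + 2)"
      by (intro power_mono) auto
    finally show "5 * v + C + 2 \<le> (a + 2) ^ (5 * v + C + 2)" by simp
  qed
  also have "\<dots> = (a + 2) ^ (5 * v + C + 2 + Suc d) * n ^ (Suc c * Suc d)"
    unfolding r_def q_def power_mult_distrib power_add power_mult by (simp only: mult.assoc)
  \<comment> \<open>The exponent is inflated to a power of two, the form shown to be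
    computable.\<close>
  also have "\<dots> \<le> (a + 2) ^ (2 ^ (5 * v + C + 2 + Suc d)) * n ^ (Suc c * Suc d)"
    by (intro mult_le_mono1 power_increasing less_imp_le less_exp) auto
  finally show ?thesis .
qed

text \<open>The time of \<open>q\<close> depends on the input length alone, so no time bound has to
  be evaluated at the intermediate parameter \<open>snd P (R x)\<close>, which is bounded but not
  determined by \<open>snd A x\<close>. A parameter-dependent time would call for a monotone
  computable majorant.\<close>

lemma fpt_reducible_poly_trans:
  assumes "fpt_reducible A P"
    and q: "computes_within q Q (\<lambda>y. C * (length y + 1) ^ d)"
    and Q: "\<And>y. y \<in> fst P \<longleftrightarrow> Q y \<in> fst B" "\<And>y. snd B (Q y) \<le> snd P y + e"
  shows "fpt_reducible A B"
proof -
  from assms(1) obtain p R f g c where fg: "computable f" "computable g"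
    and p: "computes_within p R (\<lambda>x. f (snd A x) * (length x + 1) ^ c)"
    and R: "\<And>x. x \<in> fst A \<longleftrightarrow> R x \<in> fst P" "\<And>x. snd P (R x) \<le> g (snd A x)"
    unfolding fpt_reducible_def by auto
  define v where "v = length (stacks p)"
  define f' where "f' = (\<lambda>k. (f k + 2) ^ (2 ^ (5 * v + C + 2 + Suc d)))"
  have "computes_within (Seq (tidy p) q) (\<lambda>x. Q (R x))
      (\<lambda>x. f' (snd A x) * (length x + 1) ^ (Suc c * Suc d))"
    unfolding computes_within_def
  proof
    fix x
    from p obtain t s where ts: "exec p (init_store x) t s" "s 0 = R x"
      "t \<le> f (snd A x) * (length x + 1) ^ c"
      unfolding computes_within_def by blast
    from q obtain t' s' where ts': "exec q (init_store (R x)) t' s'" "s' 0 = Q (R x)"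
      "t' \<le> C * (length (R x) + 1) ^ d"
      unfolding computes_within_def by blast
    have len: "length (R x) \<le> length x + t"
      using exec_length[OF ts(1), of 0] ts(2) by (simp add: init_store_def)
    obtain t1 where t1: "exec (tidy p) (init_store x) t1 (init_store (R x))"
      "t1 \<le> t + (v * (4 * (length x + t) + 1) + 1)"
      using exec_tidy[OF ts(1)] ts(2) unfolding exec_le_def v_def by auto
    have "v * (4 * (length x + t) + 1) \<le> v * (4 * ((length x + 1) + t) + 1)"
      by (intro mult_le_mono2) simp
    then have "t1 + t' \<le> t + (v * (4 * ((length x + 1) + t) + 1) + 1) + C * (length (R x) + 1) ^ d"
      using t1(2) ts'(3) by linarith
    also have "\<dots> \<le> f' (snd A x) * (length x + 1) ^ (Suc c * Suc d)"
      unfolding f'_def using ts(3) len by (intro composed_time_bound) auto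
    finally show "\<exists>t s. exec (Seq (tidy p) q) (init_store x) t s \<and> s 0 = Q (R x) \<and>
        t \<le> f' (snd A x) * (length x + 1) ^ (Suc c * Suc d)"
      using exec.Seq[OF t1(1) ts'(1)] ts'(2) by blast
  qed
  moreover have "computable f'"
    unfolding f'_def using fg(1) by (intro computable_power_of_two_power computable_add_const)
  moreover have "computable (\<lambda>k. g k + e)"
    using fg(2) by (rule computable_add_const)
  moreover have "snd B (Q (R x)) \<le> g (snd A x) + e" for x
    using Q(2)[of "R x"] R(2)[of x] by linarith
  ultimately show ?thesis
    unfolding fpt_reducible_def using R(1) Q(1) by blast
qed

section \<open>The constructed instance\<close>

definition enc :: "nat list \<Rightarrow> bool list" where
  "enc xs = concat (map (\<lambda>n. replicate n True @ [False]) xs)"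

lemma enc_simps [simp]:
  "enc [] = []" "enc (n # xs) = replicate n True @ False # enc xs" "enc (xs @ ys) = enc xs @ enc ys"
  by (simp_all add: enc_def)

lemma nats_from_block: "nats_from a (replicate n True @ False # xs) = (a + n) # nats_from 0 xs"
  by (induction n arbitrary: a) auto

lemma nats_from_enc: "nats_from 0 (enc xs) = xs"
  by (induction xs) (simp_all add: nats_from_block)

definition flat :: "(nat \<times> nat \<times> nat) list \<Rightarrow> nat list" where
  "flat es = concat (map (\<lambda>(u, v, c). [u, v, c]) es)"

lemma flat_simps [simp]:
  "flat [] = []" "flat ((u, v, c) # es) = u # v # c # flat es" "flat (es @ es') = flat es @ flat es'"
  by (simp_all add: flat_def)

lemma triples_flat: "triples (flat es) = es"
  by (induction es) auto

text \<open>
  A gadget \<open>[(i\<^sub>1, c\<^sub>1), \<dots>]\<close> stands for a vertex of its own that is joined to each selector \<open>i\<^sub>r\<close> by an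
  edge of color \<open>c\<^sub>r\<close>.  Gadget lists are built up from the back, so a gadget's vertex is numbered by
  the length of the tail behind it.
\<close>

type_synonym gadget = "(nat \<times> nat) list"

fun gadget_entries :: "nat \<Rightarrow> gadget list \<Rightarrow> (nat \<times> nat \<times> nat) list" where
  "gadget_entries k [] = []"
| "gadget_entries k (g # gs) = map (\<lambda>(i, c). (i, k + length gs, c)) g @ gadget_entries k gs"

text \<open>Equal vertices count as nonadjacent even if a loop is listed, so two selectors that
  agree on a vertex are penalized like any nonadjacent pair.\<close>

definition listed_adjacent :: "nat list \<Rightarrow> nat \<Rightarrow> nat \<Rightarrow> bool" where
  "listed_adjacent r u v \<longleftrightarrow> u \<noteq> v \<and> ((u, v) \<in> set (pairs r) \<or> (v, u) \<in> set (pairs r))"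

text \<open>Both cases list the same two edges in the same order; they differ only in whether these
  end in two new vertices or in one. The program thus needs a single conditional increment of its
  vertex counter between the two edges.\<close>

definition pair_gadgets :: "(nat \<Rightarrow> nat \<Rightarrow> bool) \<Rightarrow> nat \<Rightarrow> nat \<Rightarrow> nat \<Rightarrow> nat \<Rightarrow> nat \<Rightarrow> gadget list" where
  "pair_gadgets adj n i j u v =
     (if adj u v then [[(j, j * n + v)], [(i, i * n + u)]] else [[(j, j * n + v), (i, i * n + u)]])"

text \<open>A loop with ascending index that prepends to its output leaves the blocks in descending
  order.\<close>

definition downfrom :: "nat \<Rightarrow> (nat \<Rightarrow> 'b list) \<Rightarrow> 'b list" where
  "downfrom m f = concat (map f (rev [0..<m]))"

lemma downfrom_simps [simp]: "downfrom 0 f = []" "downfrom (Suc m) f = f m @ downfrom m f"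
  by (simp_all add: downfrom_def)

definition selector_gadgets :: "(nat \<Rightarrow> nat \<Rightarrow> bool) \<Rightarrow> nat \<Rightarrow> nat \<Rightarrow> gadget list" where
  "selector_gadgets adj n i =
     downfrom i (\<lambda>j. downfrom n (\<lambda>u. downfrom n (\<lambda>v. pair_gadgets adj n i j u v))) @
     downfrom n (\<lambda>u. [[(i, i * n + u)]])"

definition all_gadgets :: "(nat \<Rightarrow> nat \<Rightarrow> bool) \<Rightarrow> nat \<Rightarrow> nat \<Rightarrow> gadget list" where
  "all_gadgets adj n k = downfrom k (selector_gadgets adj n)"

text \<open>Selector \<open>i\<close> can collect 1 from its own pendant vertices, and the gadgets
  it has in common with each \<open>j < i\<close> yield at most \<open>2 * n\<close>:
  \<open>n\<close> through the color of \<open>i\<close>, once for each \<open>v\<close>, and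
  \<open>n\<close> through that of \<open>j\<close>.\<close>

definition target :: "nat \<Rightarrow> nat \<Rightarrow> nat" where
  "target n k = (\<Sum>i<k. 1 + i * (2 * n))"

definition reduction :: "bool list \<Rightarrow> bool list" where
  "reduction x = (case instance_of x of (n, k, r) \<Rightarrow>
     let gs = all_gadgets (listed_adjacent r) n k
     in enc ((k + length gs) # target n k # flat (gadget_entries k gs)))"

section \<open>Tree-cut width of a star decomposition\<close>

text \<open>Every suppression removes a vertex, so the process ends and never gains
  vertices.\<close>

lemma suppress_exhaustively:
  assumes "finite V"
  shows "\<exists>H. (suppress X)\<^sup>*\<^sup>* (V, M) H \<and> (\<nexists>H'. suppress X H H') \<and> card (fst H) \<le> card V"
  using assms
proof (induction "card V" arbitrary: V M rule: less_induct)
  case less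
  show ?case
  proof (cases "\<exists>H'. suppress X (V, M) H'")
    case True
    then obtain V' M' where step: "suppress X (V, M) (V', M')"
      by auto
    then obtain v where "v \<in> V" "V' = V - {v}"
      by cases auto
    then have "card V' < card V" "finite V'"
      using less.prems card_Diff1_less[of V v] by simp_all
    with less.hyps[of V' M'] obtain H where
      "(suppress X)\<^sup>*\<^sup>* (V', M') H" "\<nexists>H'. suppress X H H'" "card (fst H) \<le> card V'"
      by blast
    with step \<open>card V' < card V\<close> show ?thesis
      by (meson converse_rtranclp_into_rtranclp le_trans less_imp_le)
  next
    case False
    then show ?thesis by (intro exI[of _ "(V, M)"]) auto
  qed
qed

lemma tor_le_card:
  assumes "finite (fst (torso E W F X t))"
  shows "tor E W F X t \<le> card (fst (torso E W F X t))"
proof -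
  obtain V M where VM: "torso E W F X t = (V, M)"
    by (cases "torso E W F X t")
  with assms suppress_exhaustively[of V "Inl ` X t" M] obtain H where
    "(suppress (Inl ` X t))\<^sup>*\<^sup>* (V, M) H" "\<nexists>H'. suppress (Inl ` X t) H H'" "card (fst H) \<le> card V"
    by auto
  then have "tor E W F X t \<le> card (fst H)"
    unfolding tor_def VM by (intro Least_le) blast
  with \<open>card (fst H) \<le> card V\<close> show ?thesis
    by (simp add: VM)
qed

lemma size_incident_mono: "M \<subseteq># N \<Longrightarrow> size (incident v M) \<le> size (incident v N)"
  unfolding incident_def by (intro size_mset_mono multiset_filter_mono)

text \<open>No edge lies inside \<open>Y\<close>, so both neighbors of a degree-2 vertex of
  \<open>Y\<close> are in \<open>X\<close>. Replacing it by an edge inside \<open>X\<close> leaves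
  the degrees of the rest of \<open>Y\<close> alone. The invariant
  \<open>b \<in> X \<union> Y\<close> admits these new edges.\<close>

lemma suppress_star:
  assumes "finite Y" "X \<inter> Y = {}" "\<And>y. y \<in> Y \<Longrightarrow> size (incident y M) \<le> 2"
    and "\<And>e. e \<in># M \<Longrightarrow> \<exists>a b. e = {a, b} \<and> a \<in> X \<and> b \<in> X \<union> Y \<and> a \<noteq> b"
  shows "\<exists>M'. (suppress X)\<^sup>*\<^sup>* (X \<union> Y, M) (X, M')"
  using assms
proof (induction Y arbitrary: M rule: finite_induct)
  case empty
  then show ?case by auto
next
  case (insert y Y)
  have y: "y \<notin> X" "y \<notin> Y"
    using insert by auto
  have V: "X \<union> insert y Y - {y} = X \<union> Y"
    using y by auto
  have no_y: "y \<notin> e" if "e \<in># M - incident y M" for e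
    using that by (auto simp: incident_def in_diff_count count_filter_mset)
  have "\<exists>M'. suppress X (X \<union> insert y Y, M) (X \<union> Y, M') \<and> (\<forall>z\<in>Y. size (incident z M') \<le> 2) \<and>
      (\<forall>e\<in>#M'. \<exists>a b. e = {a, b} \<and> a \<in> X \<and> b \<in> X \<union> Y \<and> a \<noteq> b)"
  proof (cases "size (incident y M) \<le> 1")
    case True
    let ?M' = "M - incident y M"
    have "suppress X (X \<union> insert y Y, M) (X \<union> insert y Y - {y}, ?M')"
      using y True by (intro suppress.deg_le_1) auto
    moreover have "size (incident z ?M') \<le> 2" if "z \<in> Y" for z
      using that size_incident_mono[of ?M' M z] insert.prems(2)[of z] by simp
    moreover have "\<exists>a b. e = {a, b} \<and> a \<in> X \<and> b \<in> X \<union> Y \<and> a \<noteq> b" if "e \<in># ?M'" for e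
      using insert.prems(3)[of e] no_y[OF that] in_diffD[OF that] by auto
    ultimately show ?thesis
      unfolding V by blast
  next
    case False
    then have "size (incident y M) = 2"
      using insert.prems(2)[of y] by simp
    then obtain e1 N where N: "incident y M = add_mset e1 N"
      by (metis Suc_1 size_eq_Suc_imp_eq_union)
    with \<open>size (incident y M) = 2\<close> obtain e2 where "N = {#e2#}"
      using size_1_singleton_mset[of N] by auto
    with N have e12: "incident y M = {#e1, e2#}"
      by simp
    have ex: "\<exists>a\<in>X. e = {y, a}" if "e \<in># incident y M" for e
      using that insert.prems(3)[of e] y by (auto simp: incident_def)
    obtain a b where "a \<in> X" "e1 = {y, a}" "b \<in> X" "e2 = {y, b}"
      using ex[of e1] ex[of e2] e12 by auto
    with e12 have ab: "a \<in> X" "b \<in> X" "incident y M = {#{y, a}, {y, b}#}"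
      by simp_all
    let ?N = "if a = b then {#} else {#{a, b}#}"
    let ?M' = "(M - incident y M) + ?N"
    have "suppress X (X \<union> insert y Y, M) (X \<union> insert y Y - {y}, ?M')"
      using y ab by (intro suppress.deg_2) auto
    moreover have "size (incident z ?M') \<le> 2" if "z \<in> Y" for z
    proof -
      have "z \<noteq> a" "z \<noteq> b"
        using that ab insert.prems(1) by auto
      then have "incident z ?M' = incident z (M - incident y M)"
        by (simp add: incident_def)
      then show ?thesis
        using that size_incident_mono[of "M - incident y M" M z] insert.prems(2)[of z] by simp
    qed
    moreover have "\<exists>a b. e = {a, b} \<and> a \<in> X \<and> b \<in> X \<union> Y \<and> a \<noteq> b" if "e \<in># ?M'" for e
    proof (cases "e \<in># M - incident y M")
      case True
      then show ?thesis
        using insert.prems(3)[of e] no_y[OF True] in_diffD[OF True] by auto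
    next
      case False
      with that have "e = {a, b}" "a \<noteq> b"
        by (auto split: if_splits)
      with ab show ?thesis by blast
    qed
    ultimately show ?thesis
      unfolding V by blast
  qed
  then obtain M' where step: "suppress X (X \<union> insert y Y, M) (X \<union> Y, M')"
    and deg: "\<forall>z\<in>Y. size (incident z M') \<le> 2"
    and edge: "\<forall>e\<in>#M'. \<exists>a b. e = {a, b} \<and> a \<in> X \<and> b \<in> X \<union> Y \<and> a \<noteq> b"
    by (elim exE conjE)
  have "\<exists>M''. (suppress X)\<^sup>*\<^sup>* (X \<union> Y, M') (X, M'')"
  proof (rule insert.IH)
    show "X \<inter> Y = {}"
      using insert.prems(1) by blast
    show "size (incident z M') \<le> 2" if "z \<in> Y" for z
      using deg that by (rule bspec)
    show "\<exists>a b. e = {a, b} \<and> a \<in> X \<and> b \<in> X \<union> Y \<and> a \<noteq> b" if "e \<in># M'" for e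
      using edge that by (rule bspec)
  qed
  then obtain M'' where "(suppress X)\<^sup>*\<^sup>* (X \<union> Y, M') (X, M'')" ..
  from converse_rtranclp_into_rtranclp[of "suppress X", OF step this] show ?case ..
qed

context
  fixes k m :: nat and E :: "nat set set"
  assumes edges: "\<And>e. e \<in> E \<Longrightarrow> \<exists>i w. e = {i, w} \<and> i < k \<and> k \<le> w \<and> w < k + m"
    and degree: "\<And>w. k \<le> w \<Longrightarrow> w < k + m \<Longrightarrow> card {e \<in> E. w \<in> e} \<le> 2"
begin

definition star :: "nat set set" where
  "star = {{0, p} | p. 1 \<le> p \<and> p \<le> m}"

definition star_bag :: "nat \<Rightarrow> nat set" where
  "star_bag t = (if t = 0 then {..<k} else {k + t - 1})"

lemma finite_edges: "finite E"
proof (rule finite_subset)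
  show "E \<subseteq> Pow {..<k + m}"
    using edges by fastforce
qed simp

lemma star_edgeD: "{a, b} \<in> star \<Longrightarrow> a \<noteq> b \<and> (a = 0 \<or> b = 0) \<and> a \<le> m \<and> b \<le> m"
  by (auto simp: star_def doubleton_eq_iff)

lemma reachable_through_center:
  assumes "u = 0 \<or> {0, u} \<in> F" "v = 0 \<or> {0, v} \<in> F"
  shows "reachable F u v"
proof -
  let ?r = "{(a, b). {a, b} \<in> F}"
  have "(u, 0) \<in> ?r\<^sup>*" "(0, v) \<in> ?r\<^sup>*"
    using assms by (auto simp: insert_commute)
  then show ?thesis
    unfolding reachable_def by (rule rtrancl_trans)
qed

lemma not_reachable_isolated:
  assumes "\<And>a. {a, t} \<notin> F" "reachable F u v" "u = t \<or> v = t"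
  shows "u = v"
proof -
  have "{t, a} \<notin> F" for a
    using assms(1)[of a] by (simp add: insert_commute)
  with assms show ?thesis
    unfolding reachable_def by (auto elim: rtranclE converse_rtranclE)
qed

text \<open>Every edge contains the center. The first two edges of a cycle share only
  \<open>vs ! 1\<close>, so this is the center, and the third edge avoids it.\<close>

lemma no_cycle_star: "\<not> cycle star vs"
proof
  assume "cycle star vs"
  then have len: "3 \<le> length vs" and dist: "distinct vs"
    and e: "\<And>i. i < length vs \<Longrightarrow> {vs ! i, vs ! (Suc i mod length vs)} \<in> star"
    by (auto simp: cycle_def)
  have neq: "vs ! i \<noteq> vs ! j" if "i < length vs" "j < length vs" "i \<noteq> j" for i j
    using dist that nth_eq_iff_index_eq by blast
  have l: "0 < length vs" "1 < length vs" "2 < length vs" "3 mod length vs < length vs"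
    using len mod_less_divisor[of "length vs" 3] by linarith+
  have "{vs ! 0, vs ! 1} \<in> star" "{vs ! 1, vs ! 2} \<in> star" "{vs ! 2, vs ! (3 mod length vs)} \<in> star"
    using e[OF l(1)] e[OF l(2)] e[OF l(3)] l by (simp_all add: numeral_2_eq_2 numeral_3_eq_3)
  from this[THEN star_edgeD] have center: "vs ! 0 = 0 \<or> vs ! 1 = 0" "vs ! 1 = 0 \<or> vs ! 2 = 0"
    "vs ! 2 = 0 \<or> vs ! (3 mod length vs) = 0"
    by simp_all
  have one: "vs ! 1 = 0"
    using center(1,2) neq[OF l(1) l(3)] by auto
  \<comment> \<open>In a triangle the third edge closes at position 0, otherwise it ends at position
    3; neither is position 1.\<close>
  have "3 mod length vs \<noteq> 1"
    using len by (cases "length vs = 3") auto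
  then have "vs ! 2 \<noteq> 0" "vs ! (3 mod length vs) \<noteq> 0"
    using one neq[OF l(3) l(2)] neq[OF l(4) l(2)] by auto
  with center(3) show False by blast
qed

lemma is_tree_star: "is_tree {..m} star"
  unfolding is_tree_def
proof (intro conjI ballI)
  show "star \<subseteq> {{u, v} | u v. u \<in> {..m} \<and> v \<in> {..m} \<and> u \<noteq> v}"
    unfolding star_def by fastforce
next
  fix u v assume "u \<in> {..m}" "v \<in> {..m}"
  then show "reachable star u v"
    by (intro reachable_through_center) (auto simp: star_def)
qed (auto simp: no_cycle_star)

lemma star_decomposition: "rooted_tree_cut_decomposition {..<k + m} {..m} star star_bag 0"
  unfolding rooted_tree_cut_decomposition_def
proof (intro conjI is_tree_star)
  show "(\<Union>t\<in>{..m}. star_bag t) = {..<k + m}"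
  proof (intro equalityI subsetI)
    fix v assume "v \<in> {..<k + m}"
    then have "v \<in> star_bag (if v < k then 0 else v - k + 1)" "(if v < k then 0 else v - k + 1) \<in> {..m}"
      by (auto simp: star_bag_def)
    then show "v \<in> (\<Union>t\<in>{..m}. star_bag t)" by blast
  qed (auto simp: star_bag_def split: if_splits)
  show "\<forall>s\<in>{..m}. \<forall>t\<in>{..m}. s \<noteq> t \<longrightarrow> star_bag s \<inter> star_bag t = {}"
    by (auto simp: star_bag_def)
qed simp

text \<open>Deleting \<open>{t, 0}\<close> splits off the leaf \<open>t\<close>, whose bag is one
  vertex, so every cut edge contains that vertex.\<close>

lemma adh_star:
  assumes "t \<le> m"
  shows "adh E {..m} star star_bag 0 t \<le> 2"
proof (cases "t = 0")
  case False
  have parent: "parent_edge star 0 t = {t, 0}"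
    unfolding parent_edge_def
  proof (rule the_equality)
    show "{t, 0} \<in> star \<and> (\<exists>s. {t, 0} = {t, s} \<and> reachable (edges_minus_node star t) s 0)"
      using False assms by (auto simp: star_def reachable_def doubleton_eq_iff)
  next
    fix e assume "e \<in> star \<and> (\<exists>s. e = {t, s} \<and> reachable (edges_minus_node star t) s 0)"
    then show "e = {t, 0}"
      using False star_edgeD by blast
  qed
  let ?F = "star - {{t, 0}}"
  have isolated: "{a, t} \<notin> ?F" for a
    using star_edgeD[of a t] False by (auto simp: insert_commute)
  have comp: "C = {t} \<or> C = {..m} - {t}" if "C \<in> components {..m} ?F" for C
  proof -
    from that obtain u where u: "u \<le> m" "C = {v \<in> {..m}. reachable ?F u v}"
      by (auto simp: components_def)
    show ?thesis
    proof (cases "u = t")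
      case True
      then have "C = {t}"
        using u not_reachable_isolated[OF isolated] by (auto simp: reachable_def)
      then show ?thesis ..
    next
      case ut: False
      have "reachable ?F u v" if "v \<le> m" "v \<noteq> t" for v
        using that u ut by (intro reachable_through_center) (auto simp: star_def doubleton_eq_iff)
      then have "C = {..m} - {t}"
        using u ut not_reachable_isolated[OF isolated, of u t] by auto
      then show ?thesis ..
    qed
  qed
  let ?w = "k + t - 1"
  have "cut E {..m} star star_bag {t, 0} \<subseteq> {e \<in> E. ?w \<in> e}"
  proof
    fix e assume "e \<in> cut E {..m} star star_bag {t, 0}"
    then obtain u v T1 T2 where uv: "e = {u, v}" "{u, v} \<in> E"
      "T1 \<in> components {..m} ?F" "T2 \<in> components {..m} ?F" "T1 \<noteq> T2"
      "u \<in> (\<Union>t\<in>T1. star_bag t)" "v \<in> (\<Union>t\<in>T2. star_bag t)"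
      unfolding cut_def by blast
    with comp[of T1] comp[of T2] have "T1 = {t} \<or> T2 = {t}"
      by blast
    with uv False have "u = ?w \<or> v = ?w"
      by (auto simp: star_bag_def)
    with uv show "e \<in> {e \<in> E. ?w \<in> e}" by auto
  qed
  then have "card (cut E {..m} star star_bag {t, 0}) \<le> card {e \<in> E. ?w \<in> e}"
    using finite_edges by (intro card_mono) auto
  also have "\<dots> \<le> 2"
    using False assms by (intro degree) auto
  finally show ?thesis
    using False by (simp add: adh_def parent)
qed (simp add: adh_def)

text \<open>Without the leaf the star stays connected, so the torso has only the bag vertex and one
  contracted vertex.\<close>

lemma tor_star_leaf:
  assumes "t \<noteq> 0" "t \<le> m"
  shows "tor E {..m} star star_bag t \<le> 2"
proof -
  let ?F = "edges_minus_node star t"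
  have "C = {..m} - {t}" if "C \<in> components ({..m} - {t}) ?F" for C
  proof -
    from that obtain u where u: "u \<in> {..m} - {t}" "C = {v \<in> {..m} - {t}. reachable ?F u v}"
      by (auto simp: components_def)
    have "reachable ?F u v" if "v \<in> {..m} - {t}" for v
      using that u assms by (intro reachable_through_center) (auto simp: star_def edges_minus_node_def)
    with u show ?thesis by auto
  qed
  then have sub: "components ({..m} - {t}) ?F \<subseteq> {{..m} - {t}}"
    by blast
  have V: "fst (torso E {..m} star star_bag t) \<subseteq> {Inl (k + t - 1), Inr ({..m} - {t})}"
    using sub assms by (auto simp: torso_def star_bag_def)
  have "tor E {..m} star star_bag t \<le> card (fst (torso E {..m} star star_bag t))"
    by (rule tor_le_card) (rule finite_subset[OF V], simp)
  also have "\<dots> \<le> card {Inl (k + t - 1) :: nat + nat set, Inr ({..m} - {t})}"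
    by (rule card_mono[OF _ V]) simp
  finally show ?thesis by simp
qed

text \<open>Every component at the center is a single leaf, so the torso is the graph itself with
  the vertices from \<open>k\<close> on renamed. These have degree at most 2 and are all suppressed,
  while the \<open>k\<close> bag vertices may not be.\<close>

lemma tor_star_center: "tor E {..m} star star_bag 0 \<le> k"
proof -
  let ?X = "Inl ` star_bag 0 :: (nat + nat set) set"
  have F: "edges_minus_node star 0 = {}"
    by (auto simp: edges_minus_node_def star_def)
  have reach: "reachable {} u v \<longleftrightarrow> u = v" for u v :: nat
    by (auto simp: reachable_def)
  have comp: "components ({..m} - {0}) {} = (\<lambda>p. {p}) ` {1..m}"
    by (auto simp: components_def reach image_def set_eq_iff)
  let ?Y = "Inr ` (\<lambda>p. {p}) ` {1..m} :: (nat + nat set) set"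
  let ?f = "torso_vertex {..m} star star_bag 0"
  define M where "M = snd (torso E {..m} star star_bag 0)"
  have torso: "torso E {..m} star star_bag 0 = (?X \<union> ?Y, M)"
    unfolding M_def torso_def F comp by simp
  have f_low: "?f v = Inl v" if "v < k" for v
    using that by (simp add: torso_vertex_def star_bag_def)
  have f_high: "?f v = Inr {v - k + 1}" if v: "k \<le> v" "v < k + m" for v
  proof -
    have "(THE C. C \<in> components ({..m} - {0}) (edges_minus_node star 0) \<and> v \<in> (\<Union>s\<in>C. star_bag s))
        = {v - k + 1}"
      unfolding F comp
    proof (rule the_equality)
      show "{v - k + 1} \<in> (\<lambda>p. {p}) ` {1..m} \<and> v \<in> (\<Union>s\<in>{v - k + 1}. star_bag s)"
        using v by (auto simp: star_bag_def)
    next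
      fix C assume "C \<in> (\<lambda>p. {p}) ` {1..m} \<and> v \<in> (\<Union>s\<in>C. star_bag s)"
      then show "C = {v - k + 1}"
        by (auto simp: star_bag_def)
    qed
    with v show ?thesis
      by (simp add: torso_vertex_def star_bag_def)
  qed
  have M: "M = filter_mset (\<lambda>e. card e = 2) (image_mset (\<lambda>e. ?f ` e) (mset_set E))"
    by (simp add: M_def torso_def)
  have deg: "size (incident y M) \<le> 2" if "y \<in> ?Y" for y
  proof -
    from that obtain p where p: "y = Inr {p}" "1 \<le> p" "p \<le> m"
      by auto
    have "{e \<in> E. card (?f ` e) = 2 \<and> y \<in> ?f ` e} \<subseteq> {e \<in> E. k + p - 1 \<in> e}"
    proof
      fix e assume e: "e \<in> {e \<in> E. card (?f ` e) = 2 \<and> y \<in> ?f ` e}"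
      with edges obtain i w where iw: "e = {i, w}" "i < k" "k \<le> w" "w < k + m"
        by blast
      with e p f_low f_high have "p = w - k + 1"
        by auto
      with e iw show "e \<in> {e \<in> E. k + p - 1 \<in> e}" by auto
    qed
    then have "card {e \<in> E. card (?f ` e) = 2 \<and> y \<in> ?f ` e} \<le> card {e \<in> E. k + p - 1 \<in> e}"
      using finite_edges by (intro card_mono) auto
    also have "\<dots> \<le> 2"
      using p by (intro degree) auto
    finally show ?thesis
      using finite_edges
      by (simp add: incident_def M filter_mset_image_mset filter_filter_mset conj_ac)
  qed
  have "\<exists>M'. (suppress ?X)\<^sup>*\<^sup>* (?X \<union> ?Y, M) (?X, M')"
  proof (rule suppress_star)
    fix e assume "e \<in># M"
    then obtain e' where e': "e' \<in> E" "e = ?f ` e'"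
      using finite_edges by (auto simp: M)
    with edges obtain i w where "e' = {i, w}" "i < k" "k \<le> w" "w < k + m"
      by blast
    with e' f_low f_high show "\<exists>a b. e = {a, b} \<and> a \<in> ?X \<and> b \<in> ?X \<union> ?Y \<and> a \<noteq> b"
      by (intro exI[of _ "Inl i"] exI[of _ "Inr {w - k + 1}"]) (auto simp: star_bag_def)
  qed (use deg in auto)
  then obtain M' where M': "(suppress ?X)\<^sup>*\<^sup>* (torso E {..m} star star_bag 0) (?X, M')"
    unfolding torso by blast
  have "\<nexists>H'. suppress ?X (?X, M') H'"
    by (auto elim: suppress.cases)
  with M' have "tor E {..m} star star_bag 0 \<le> card ?X"
    unfolding tor_def by (intro Least_le exI[of _ "(?X, M')"]) simp
  also have "card ?X = k"
    by (simp add: star_bag_def card_image)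
  finally show ?thesis .
qed

lemma tree_cut_width_le: "tree_cut_width {..<k + m} E \<le> max k 2"
proof -
  let ?w = "tree_cut_decomposition_width E {..m} star star_bag 0"
  have "tree_cut_width {..<k + m} E \<le> ?w"
    unfolding tree_cut_width_def
    by (rule Least_le) (use star_decomposition in blast)
  also have "?w \<le> max k 2"
    unfolding tree_cut_decomposition_width_def
  proof (rule Max.boundedI)
    fix a assume "a \<in> (\<lambda>t. max (adh E {..m} star star_bag 0 t) (tor E {..m} star star_bag t)) ` {..m}"
    then obtain t where t: "t \<le> m"
      "a = max (adh E {..m} star star_bag 0 t) (tor E {..m} star star_bag t)"
      by auto
    then show "a \<le> max k 2"
      using adh_star[of t] tor_star_leaf[of t] tor_star_center by (cases "t = 0") auto
  qed auto
  finally show ?thesis .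
qed

end

section \<open>Graphs built from gadgets\<close>

text \<open>Distinct selectors exclude a second color for the same edge; distinct colors make a
  gadget worth at most 1; length 2 bounds the degree, which matters for adhesion and torso.\<close>

definition gadget_ok :: "nat \<Rightarrow> gadget \<Rightarrow> bool" where
  "gadget_ok k g \<longleftrightarrow> length g \<le> 2 \<and> (\<forall>(i, c)\<in>set g. i < k) \<and> distinct (map fst g) \<and> distinct (map snd g)"

definition chosen :: "(nat \<Rightarrow> nat) \<Rightarrow> gadget \<Rightarrow> bool" where
  "chosen \<phi> g \<longleftrightarrow> (\<exists>(i, c)\<in>set g. \<phi> i = c)"

text \<open>\<open>hs\<close> stands for a reversed gadget list, in which position \<open>p\<close>
  belongs to the vertex \<open>k + p\<close>.\<close>

definition gadget_edges :: "nat \<Rightarrow> gadget list \<Rightarrow> nat set set" where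
  "gadget_edges k hs = {{i, k + p} | i p c. p < length hs \<and> (i, c) \<in> set (hs ! p)}"

lemma doubleton_low_high:
  "i < k \<Longrightarrow> i' < k \<Longrightarrow> {i, k + p} = {i', k + p'} \<longleftrightarrow> i = i' \<and> p = (p' :: nat)"
  by (auto simp: doubleton_eq_iff)

lemma gadget_edge_high:
  assumes "\<And>g. g \<in> set hs \<Longrightarrow> gadget_ok k g" "e \<in> gadget_edges k hs" "k + p \<in> e"
  shows "p < length hs \<and> (\<exists>(i, c)\<in>set (hs ! p). e = {i, k + p})"
proof -
  from assms(2) obtain i q c where e: "e = {i, k + q}" "q < length hs" "(i, c) \<in> set (hs ! q)"
    by (auto simp: gadget_edges_def)
  then have "i < k"
    using assms(1)[of "hs ! q"] by (auto simp: gadget_ok_def)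
  with e assms(3) have "q = p" by auto
  with e show ?thesis by blast
qed

lemma gadget_edges_shape:
  assumes "\<And>g. g \<in> set hs \<Longrightarrow> gadget_ok k g" "e \<in> gadget_edges k hs"
  shows "\<exists>i w. e = {i, w} \<and> i < k \<and> k \<le> w \<and> w < k + length hs"
proof -
  from assms(2) obtain i p c where e: "e = {i, k + p}" "p < length hs" "(i, c) \<in> set (hs ! p)"
    by (auto simp: gadget_edges_def)
  then have "i < k"
    using assms(1)[of "hs ! p"] by (auto simp: gadget_ok_def)
  with e show ?thesis by (intro exI[of _ i] exI[of _ "k + p"]) auto
qed

lemma gadget_edges_degree:
  assumes "\<And>g. g \<in> set hs \<Longrightarrow> gadget_ok k g" "k \<le> w" "w < k + length hs"
  shows "card {e \<in> gadget_edges k hs. w \<in> e} \<le> 2"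
proof -
  define p where "p = w - k"
  have p: "w = k + p" "p < length hs"
    using assms(2,3) by (auto simp: p_def)
  have "{e \<in> gadget_edges k hs. w \<in> e} \<subseteq> (\<lambda>(i, c). {i, w}) ` set (hs ! p)"
    using gadget_edge_high[OF assms(1), of hs] p by fastforce
  then have "card {e \<in> gadget_edges k hs. w \<in> e} \<le> card ((\<lambda>(i, c). {i, w}) ` set (hs ! p))"
    by (intro card_mono) auto
  also have "\<dots> \<le> length (hs ! p)"
    by (meson List.finite_set card_image_le card_length le_trans)
  also have "\<dots> \<le> 2"
    using assms(1)[of "hs ! p"] p by (auto simp: gadget_ok_def)
  finally show ?thesis .
qed

text \<open>
  An independent vertex contributes at most one edge to a stable set, as its edges have different
  colors; it contributes one iff one of its edges has the color chosen by its other end.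
\<close>

lemma colored_clustering_gadgets:
  assumes ok: "\<And>g. g \<in> set hs \<Longrightarrow> gadget_ok k g"
    and col: "\<And>p i c. p < length hs \<Longrightarrow> (i, c) \<in> set (hs ! p) \<Longrightarrow> l {i, k + p} = c"
  shows "colored_clustering (gadget_edges k hs) l K \<longleftrightarrow>
    (\<exists>\<phi>. K \<le> card {p. p < length hs \<and> chosen \<phi> (hs ! p)})"
proof
  assume "colored_clustering (gadget_edges k hs) l K"
  then obtain F where F: "F \<subseteq> gadget_edges k hs" "K \<le> card F"
    and st: "\<And>e e'. e \<in> F \<Longrightarrow> e' \<in> F \<Longrightarrow> e \<inter> e' \<noteq> {} \<Longrightarrow> l e = l e'"
    by (auto simp: colored_clustering_def stable_def)
  \<comment> \<open>All edges of \<open>F\<close> at \<open>i\<close> have one color by stability,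
    so any of them determines \<open>\<phi> i\<close>. At a selector without such edges the value is
    arbitrary, which cannot hurt a lower bound.\<close>
  define \<phi> where "\<phi> i = l (SOME e. e \<in> F \<and> i \<in> e)" for i
  have \<phi>: "\<phi> i = l e" if "e \<in> F" "i \<in> e" for i e
  proof -
    have "(SOME e. e \<in> F \<and> i \<in> e) \<in> F \<and> i \<in> (SOME e. e \<in> F \<and> i \<in> e)"
      using that by (intro someI[where P = "\<lambda>e. e \<in> F \<and> i \<in> e"]) simp
    with that st show ?thesis
      unfolding \<phi>_def by blast
  qed
  have "\<exists>p i c. p < length hs \<and> (i, c) \<in> set (hs ! p) \<and> e = {i, k + p}" if "e \<in> F" for e
    using that F(1) unfolding gadget_edges_def by blast
  then obtain P I C where PIC: "\<And>e. e \<in> F \<Longrightarrow> P e < length hs"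
    "\<And>e. e \<in> F \<Longrightarrow> (I e, C e) \<in> set (hs ! P e)" "\<And>e. e \<in> F \<Longrightarrow> e = {I e, k + P e}"
    by metis
  have lC: "l e = C e" if "e \<in> F" for e
    using col[OF PIC(1)[OF that] PIC(2)[OF that]] PIC(3)[OF that] by simp
  have "inj_on P F"
  proof (rule inj_onI)
    fix e e' assume e: "e \<in> F" "e' \<in> F" "P e = P e'"
    then have "e \<inter> e' \<noteq> {}"
      using PIC(3)[of e] PIC(3)[of e'] by auto
    then have "C e = C e'"
      using st e lC by metis
    moreover have "distinct (map snd (hs ! P e))"
      using ok[of "hs ! P e"] PIC(1)[OF e(1)] by (auto simp: gadget_ok_def)
    ultimately have "(I e, C e) = (I e', C e')"
      using PIC(2)[OF e(1)] PIC(2)[OF e(2)] e(3)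
      by (metis distinct_map inj_onD snd_conv)
    then show "e = e'"
      using PIC(3)[OF e(1)] PIC(3)[OF e(2)] e(3) by simp
  qed
  moreover have "P ` F \<subseteq> {p. p < length hs \<and> chosen \<phi> (hs ! p)}"
  proof
    fix p assume "p \<in> P ` F"
    then obtain e where e: "e \<in> F" "p = P e" by blast
    then have "\<phi> (I e) = C e"
      using \<phi>[of e "I e"] PIC(3)[of e] lC[of e] by (metis insertI1)
    with PIC[OF e(1)] e show "p \<in> {p. p < length hs \<and> chosen \<phi> (hs ! p)}"
      by (auto simp: chosen_def)
  qed
  ultimately have "card F \<le> card {p. p < length hs \<and> chosen \<phi> (hs ! p)}"
    by (intro card_inj_on_le[of P]) auto
  with F show "\<exists>\<phi>. K \<le> card {p. p < length hs \<and> chosen \<phi> (hs ! p)}"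
    using le_trans by blast
next
  assume "\<exists>\<phi>. K \<le> card {p. p < length hs \<and> chosen \<phi> (hs ! p)}"
  then obtain \<phi> where K: "K \<le> card {p. p < length hs \<and> chosen \<phi> (hs ! p)}"
    by blast
  let ?S = "{p. p < length hs \<and> chosen \<phi> (hs ! p)}"
  have "\<exists>i. (i, \<phi> i) \<in> set (hs ! p)" if "p \<in> ?S" for p
    using that by (auto simp: chosen_def)
  then obtain I where I: "\<And>p. p \<in> ?S \<Longrightarrow> (I p, \<phi> (I p)) \<in> set (hs ! p)"
    by metis
  have Ik: "I p < k" if "p \<in> ?S" for p
    using I[OF that] ok[of "hs ! p"] that by (auto simp: gadget_ok_def)
  \<comment> \<open>One edge is taken per chosen gadget. Two of them can meet at a selector
    \<open>i\<close>, where both have color \<open>\<phi> i\<close>, or at a gadget vertex, where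
    they coincide.\<close>
  define ed where "ed p = {I p, k + p}" for p
  have led: "l (ed p) = \<phi> (I p)" if "p \<in> ?S" for p
    unfolding ed_def using that I by (intro col) auto
  have "inj_on ed ?S"
  proof (rule inj_onI)
    fix p q assume pq: "p \<in> ?S" "q \<in> ?S" "ed p = ed q"
    then show "p = q"
      using doubleton_low_high[OF Ik[OF pq(1)] Ik[OF pq(2)]] by (simp add: ed_def)
  qed
  then have "card (ed ` ?S) = card ?S"
    by (rule card_image)
  moreover have "stable (gadget_edges k hs) l (ed ` ?S)"
    unfolding stable_def
  proof (intro conjI ballI impI)
    show "ed ` ?S \<subseteq> gadget_edges k hs"
      unfolding gadget_edges_def ed_def using I by blast
  next
    fix e e' assume "e \<in> ed ` ?S" "e' \<in> ed ` ?S" and int: "e \<inter> e' \<noteq> {}"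
    then obtain p q where pq: "p \<in> ?S" "e = ed p" "q \<in> ?S" "e' = ed q"
      by blast
    with int Ik[of p] Ik[of q] have "I p = I q \<or> p = q"
      by (auto simp: ed_def)
    then show "l e = l e'"
      using pq led[of p] led[of q] by auto
  qed
  ultimately show "colored_clustering (gadget_edges k hs) l K"
    unfolding colored_clustering_def using K by metis
qed

text \<open>The tail behind a gadget has \<open>p\<close> elements exactly if the gadget is entry
  \<open>p\<close> of the reversed list; this translates the recursive numbering into indices of
  \<open>rev gs\<close>.\<close>

lemma mem_gadget_entries:
  "(i, w, c) \<in> set (gadget_entries k gs) \<longleftrightarrow>
   (\<exists>p. p < length gs \<and> w = k + p \<and> (i, c) \<in> set (rev gs ! p))"
proof (induction gs)
  case (Cons g gs)
  define Q where "Q p \<longleftrightarrow> (i, c) \<in> set (rev (g # gs) ! p)" for p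
  have low: "Q p \<longleftrightarrow> (i, c) \<in> set (rev gs ! p)" if "p < length gs" for p
    using that by (simp add: Q_def nth_append)
  have top: "Q (length gs) \<longleftrightarrow> (i, c) \<in> set g"
    by (simp add: Q_def nth_append)
  have "(i, w, c) \<in> set (gadget_entries k (g # gs)) \<longleftrightarrow>
      w = k + length gs \<and> (i, c) \<in> set g \<or> (i, w, c) \<in> set (gadget_entries k gs)"
    by auto
  also have "\<dots> \<longleftrightarrow> (\<exists>p. p < length (g # gs) \<and> w = k + p \<and> (i, c) \<in> set (rev (g # gs) ! p))"
    unfolding Cons.IH length_Cons less_Suc_eq Q_def[symmetric] using low top by blast
  finally show ?case .
qed simp

lemma set_gadget_entries:
  "set (gadget_entries k gs) = {(i, k + p, c) | i p c. p < length gs \<and> (i, c) \<in> set (rev gs ! p)}"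
  by (intro set_eqI) (auto simp: mem_gadget_entries)

section \<open>Encoded instances made of gadgets\<close>

definition gadget_instance :: "nat \<Rightarrow> nat \<Rightarrow> gadget list \<Rightarrow> bool list" where
  "gadget_instance k K gs = enc ((k + length gs) # K # flat (gadget_entries k gs))"

lemma gadget_instance_simps:
  "inst_vertices (gadget_instance k K gs) = {..<k + length gs}"
  "inst_k (gadget_instance k K gs) = K"
  "triples (inst_entries (gadget_instance k K gs)) = gadget_entries k gs"
  unfolding inst_vertices_def inst_k_def inst_entries_def instance_of_def gadget_instance_def nats_from_enc
  by (simp_all add: triples_flat)

context
  fixes k K :: nat and gs :: "gadget list"
  assumes ok: "\<And>g. g \<in> set gs \<Longrightarrow> gadget_ok k g"
begin

lemma ok_rev: "g \<in> set (rev gs) \<Longrightarrow> gadget_ok k g"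
  using ok by simp

lemma selector_less: "p < length gs \<Longrightarrow> (i, c) \<in> set (rev gs ! p) \<Longrightarrow> i < k"
  using ok_rev[of "rev gs ! p"] nth_mem[of p "rev gs"] by (auto simp: gadget_ok_def)

lemma cc_edges_gadget_instance: "cc_edges (gadget_instance k K gs) = gadget_edges k (rev gs)"
proof (intro equalityI subsetI)
  fix e assume "e \<in> gadget_edges k (rev gs)"
  then obtain i p c where e: "e = {i, k + p}" "p < length gs" "(i, c) \<in> set (rev gs ! p)"
    by (auto simp: gadget_edges_def)
  moreover from e have "i < k" by (intro selector_less)
  ultimately show "e \<in> cc_edges (gadget_instance k K gs)"
    unfolding cc_edges_def gadget_instance_simps set_gadget_entries by fastforce
qed (auto simp: cc_edges_def gadget_instance_simps set_gadget_entries gadget_edges_def)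

text \<open>The first listed entry decides the color, but no edge is listed with two colors: an edge
  determines its gadget and its selector, and the selectors within a gadget are distinct.\<close>

lemma cc_color_gadget_instance:
  assumes "p < length gs" "(i, c) \<in> set (rev gs ! p)"
  shows "cc_color (gadget_instance k K gs) {i, k + p} = c"
proof -
  let ?m = "map (\<lambda>(u, v, c). ({u, v}, c)) (gadget_entries k gs)"
  have "({i, k + p}, c) \<in> set ?m"
  proof -
    have "(i, k + p, c) \<in> set (gadget_entries k gs)"
      using assms unfolding mem_gadget_entries by blast
    then have "(\<lambda>(u, v, c). ({u, v}, c)) (i, k + p, c) \<in> set ?m"
      unfolding set_map by (rule imageI)
    then show ?thesis by simp
  qed
  then obtain c' where c': "map_of ?m {i, k + p} = Some c'"
    by (metis weak_map_of_SomeI)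
  then have "({i, k + p}, c') \<in> set ?m"
    by (rule map_of_SomeD)
  then obtain i' p' where i': "p' < length gs" "(i', c') \<in> set (rev gs ! p')" "{i, k + p} = {i', k + p'}"
    by (auto simp: set_gadget_entries)
  then have "i' = i" "p' = p"
    using doubleton_low_high[of i k i' p p'] selector_less[OF assms] selector_less[OF i'(1,2)] by auto
  moreover have "distinct (map fst (rev gs ! p))"
    using ok_rev[of "rev gs ! p"] nth_mem[of p "rev gs"] assms(1) by (auto simp: gadget_ok_def)
  ultimately have "c' = c"
    using i'(2) assms(2) by (metis eq_key_imp_eq_value)
  with c' show ?thesis
    by (simp add: cc_color_def gadget_instance_simps)
qed

lemma gadget_instance_iff:
  "gadget_instance k K gs \<in> bipartite_colored_clustering \<longleftrightarrow>
   (\<exists>\<phi>. K \<le> length (filter (chosen \<phi>) gs))"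
proof -
  have "bipartite {..<k + length gs} (gadget_edges k (rev gs))"
    unfolding bipartite_def
  proof (intro exI conjI ballI)
    show "{..<k} \<union> {k..<k + length gs} = {..<k + length gs}" "{..<k} \<inter> {k..<k + length gs} = {}"
      by auto
    fix e assume "e \<in> gadget_edges k (rev gs)"
    from gadget_edges_shape[OF ok_rev this]
    obtain i w where "e = {i, w}" "i < k" "k \<le> w" "w < k + length gs"
      by auto
    then show "\<exists>a\<in>{..<k}. \<exists>b\<in>{k..<k + length gs}. e = {a, b}"
      by (intro bexI[of _ i] bexI[of _ w]) auto
  qed
  moreover have "colored_clustering (gadget_edges k (rev gs)) (cc_color (gadget_instance k K gs)) K \<longleftrightarrow>
      (\<exists>\<phi>. K \<le> card {p. p < length (rev gs) \<and> chosen \<phi> (rev gs ! p)})"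
    by (rule colored_clustering_gadgets) (use ok_rev cc_color_gadget_instance in auto)
  moreover have "card {p. p < length (rev gs) \<and> chosen \<phi> (rev gs ! p)} = length (filter (chosen \<phi>) gs)" for \<phi>
    by (metis length_filter_conv_card length_rev rev_filter)
  ultimately show ?thesis
    unfolding bipartite_colored_clustering_def
    by (simp add: cc_edges_gadget_instance gadget_instance_simps)
qed

lemma vertex_cover_parameter_gadget_instance: "vertex_cover_parameter (gadget_instance k K gs) \<le> k"
  unfolding vertex_cover_parameter_def vertex_cover_number_def gadget_instance_simps
    cc_edges_gadget_instance
proof (rule Least_le, intro exI conjI)
  show "vertex_cover {..<k + length gs} (gadget_edges k (rev gs)) {..<k}"
    unfolding vertex_cover_def
  proof (intro conjI ballI)
    fix e assume "e \<in> gadget_edges k (rev gs)"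
    from gadget_edges_shape[OF ok_rev this] show "e \<inter> {..<k} \<noteq> {}"
      by auto
  qed auto
qed simp

lemma tree_cut_width_parameter_gadget_instance:
  "tree_cut_width_parameter (gadget_instance k K gs) \<le> max k 2"
  unfolding tree_cut_width_parameter_def gadget_instance_simps cc_edges_gadget_instance
proof (rule tree_cut_width_le)
  fix e assume "e \<in> gadget_edges k (rev gs)"
  from gadget_edges_shape[OF ok_rev this]
  show "\<exists>i w. e = {i, w} \<and> i < k \<and> k \<le> w \<and> w < k + length gs" by simp
next
  fix w assume "k \<le> w" "w < k + length gs"
  then show "card {e \<in> gadget_edges k (rev gs). w \<in> e} \<le> 2"
    by (intro gadget_edges_degree ok_rev) auto
qed

end

section \<open>The value of the constructed instance\<close>

definition value_of :: "(nat \<Rightarrow> nat) \<Rightarrow> gadget list \<Rightarrow> nat" where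
  "value_of \<phi> gs = length (filter (chosen \<phi>) gs)"

lemma value_of_append: "value_of \<phi> (gs @ gs') = value_of \<phi> gs + value_of \<phi> gs'"
  by (simp add: value_of_def)

lemma value_of_downfrom: "value_of \<phi> (downfrom m f) = (\<Sum>i<m. value_of \<phi> (f i))"
  by (induction m) (simp_all add: value_of_append, simp add: value_of_def)

definition takes :: "(nat \<Rightarrow> nat) \<Rightarrow> nat \<Rightarrow> nat \<Rightarrow> nat \<Rightarrow> nat" where
  "takes \<phi> n i u = (if \<phi> i = i * n + u then 1 else 0)"

lemma value_of_single: "value_of \<phi> [[(i, i * n + u)]] = takes \<phi> n i u"
  by (simp add: value_of_def takes_def chosen_def)

lemma takes_eq_0: "\<phi> i \<noteq> i * n + u \<Longrightarrow> takes \<phi> n i u = 0"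
  by (simp add: takes_def)

lemma takes_eq_1: "\<phi> i = i * n + u \<Longrightarrow> takes \<phi> n i u = 1"
  by (simp add: takes_def)

lemma value_of_pair_adjacent:
  "adj u v \<Longrightarrow> value_of \<phi> (pair_gadgets adj n i j u v) = takes \<phi> n i u + takes \<phi> n j v"
  by (simp add: value_of_def takes_def chosen_def pair_gadgets_def)

lemma value_of_pair_nonadjacent:
  assumes "\<not> adj u v"
  shows "value_of \<phi> (pair_gadgets adj n i j u v) =
    (if \<phi> i = i * n + u \<and> \<phi> j = j * n + v then 1 else takes \<phi> n i u + takes \<phi> n j v)"
  using assms by (simp add: value_of_def takes_def chosen_def pair_gadgets_def)

lemma value_of_pair_le: "value_of \<phi> (pair_gadgets adj n i j u v) \<le> takes \<phi> n i u + takes \<phi> n j v"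
proof (cases "adj u v")
  case True
  then show ?thesis by (simp add: value_of_pair_adjacent)
next
  case False
  show ?thesis
  proof (cases "\<phi> i = i * n + u \<and> \<phi> j = j * n + v")
    case True
    with False show ?thesis
      by (simp add: value_of_pair_nonadjacent takes_eq_1)
  next
    case f: False
    show ?thesis
      unfolding value_of_pair_nonadjacent[of adj u v, OF False] if_not_P[OF f] ..
  qed
qed

lemma sum_takes:
  assumes "u < n" "\<phi> i = i * n + u"
  shows "(\<Sum>u<n. takes \<phi> n i u) = 1"
proof -
  have "(\<Sum>u<n. takes \<phi> n i u) = takes \<phi> n i u + (\<Sum>u\<in>{..<n} - {u}. takes \<phi> n i u)"
    using assms(1) by (intro sum.remove) auto
  moreover have "(\<Sum>u\<in>{..<n} - {u}. takes \<phi> n i u) = 0"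
    using assms(2) by (intro sum.neutral ballI takes_eq_0) auto
  ultimately show ?thesis
    using assms(2) by (simp add: takes_eq_1)
qed

text \<open>\<open>\<phi> i\<close> may be any number, for instance a color of another selector;
  then selector \<open>i\<close> collects nothing.\<close>

lemma sum_takes_cases:
  obtains u where "u < n" "\<phi> i = i * n + u" | "(\<Sum>u<n. takes \<phi> n i u) = 0"
proof (cases "\<exists>u<n. \<phi> i = i * n + u")
  case True
  with that(1) show ?thesis by blast
next
  case False
  then have "(\<Sum>u<n. takes \<phi> n i u) = 0"
    by (intro sum.neutral ballI takes_eq_0) auto
  with that(2) show ?thesis .
qed

lemma sum_takes_le: "(\<Sum>u<n. takes \<phi> n i u) \<le> 1"
  by (cases rule: sum_takes_cases[of n \<phi> i]) (simp_all add: sum_takes)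

abbreviation pair_value :: "(nat \<Rightarrow> nat \<Rightarrow> bool) \<Rightarrow> nat \<Rightarrow> (nat \<Rightarrow> nat) \<Rightarrow> nat \<Rightarrow> nat \<Rightarrow> nat" where
  "pair_value adj n \<phi> i j \<equiv> (\<Sum>u<n. \<Sum>v<n. value_of \<phi> (pair_gadgets adj n i j u v))"

lemma value_of_selector_gadgets:
  "value_of \<phi> (selector_gadgets adj n i) = (\<Sum>j<i. pair_value adj n \<phi> i j) + (\<Sum>u<n. takes \<phi> n i u)"
  by (simp add: selector_gadgets_def value_of_append value_of_downfrom value_of_single)

lemma sum_takes_pairs:
  "(\<Sum>u<n. \<Sum>v<n. takes \<phi> n i u + takes \<phi> n j v) =
   n * (\<Sum>u<n. takes \<phi> n i u) + n * (\<Sum>v<n. takes \<phi> n j v)"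
  by (simp add: sum.distrib sum_distrib_left)

lemma pair_value_le: "pair_value adj n \<phi> i j \<le> 2 * n"
proof -
  have "pair_value adj n \<phi> i j \<le> (\<Sum>u<n. \<Sum>v<n. takes \<phi> n i u + takes \<phi> n j v)"
    by (intro sum_mono value_of_pair_le)
  also have "\<dots> \<le> n * 1 + n * 1"
    unfolding sum_takes_pairs by (intro add_mono mult_le_mono2 sum_takes_le)
  finally show ?thesis by simp
qed

text \<open>The gadget of the two chosen vertices is shared, so it yields 1 where both selectors
  together would have yielded 2.\<close>

lemma pair_value_less:
  assumes "\<phi> i = i * n + u" "\<phi> j = j * n + v" "u < n" "v < n" "\<not> adj u v"
  shows "pair_value adj n \<phi> i j < 2 * n"
proof -
  have "value_of \<phi> (pair_gadgets adj n i j u v) < takes \<phi> n i u + takes \<phi> n j v"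
    using assms by (simp add: value_of_pair_nonadjacent takes_eq_1)
  then have "(\<Sum>v<n. value_of \<phi> (pair_gadgets adj n i j u v)) < (\<Sum>v<n. takes \<phi> n i u + takes \<phi> n j v)"
    using assms(4) by (intro sum_strict_mono_ex1 ballI value_of_pair_le) auto
  then have "pair_value adj n \<phi> i j < (\<Sum>u<n. \<Sum>v<n. takes \<phi> n i u + takes \<phi> n j v)"
    using assms(3) by (intro sum_strict_mono_ex1 ballI sum_mono value_of_pair_le) auto
  also have "\<dots> = 2 * n"
    unfolding sum_takes_pairs using assms by (simp add: sum_takes)
  finally show ?thesis .
qed

text \<open>A shared gadget causes a loss only if both of its ends choose it. The only doubly chosen
  pair is \<open>u, v\<close>, and that one is adjacent.\<close>

lemma pair_value_adjacent:
  assumes "\<phi> i = i * n + u" "\<phi> j = j * n + v" "u < n" "v < n" "adj u v"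
  shows "pair_value adj n \<phi> i j = 2 * n"
proof -
  have "value_of \<phi> (pair_gadgets adj n i j u' v') = takes \<phi> n i u' + takes \<phi> n j v'" for u' v'
  proof (cases "adj u' v'")
    case True
    then show ?thesis by (rule value_of_pair_adjacent)
  next
    case False
    with assms have f: "\<not> (\<phi> i = i * n + u' \<and> \<phi> j = j * n + v')"
      by auto
    show ?thesis
      unfolding value_of_pair_nonadjacent[of adj u' v', OF False] if_not_P[OF f] ..
  qed
  then have "pair_value adj n \<phi> i j = (\<Sum>u<n. \<Sum>v<n. takes \<phi> n i u + takes \<phi> n j v)"
    by simp
  also have "\<dots> = 2 * n"
    unfolding sum_takes_pairs using assms by (simp add: sum_takes)
  finally show ?thesis .
qed

text \<open>\<open>target\<close> is the sum of the upper bounds for the single selectors, so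
  reaching it makes each of them tight. A tight bound in turn forces every pair value in it to be
  \<open>2 * n\<close>, which means adjacency.\<close>

lemma target_reached_iff:
  "(\<exists>\<phi>. target n k \<le> value_of \<phi> (all_gadgets adj n k)) \<longleftrightarrow>
   (\<exists>h. (\<forall>i<k. h i < n) \<and> (\<forall>i<k. \<forall>j<i. adj (h i) (h j)))"
proof
  assume "\<exists>\<phi>. target n k \<le> value_of \<phi> (all_gadgets adj n k)"
  then obtain \<phi> where ge: "target n k \<le> value_of \<phi> (all_gadgets adj n k)"
    by blast
  let ?t = "\<lambda>i. value_of \<phi> (selector_gadgets adj n i)"
  have le_pairs: "(\<Sum>j<i. pair_value adj n \<phi> i j) \<le> i * (2 * n)" for i
    using sum_bounded_above[of "{..<i}" "pair_value adj n \<phi> i" "2 * n"] pair_value_le by simp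
  have le: "?t i \<le> 1 + i * (2 * n)" for i
    unfolding value_of_selector_gadgets using le_pairs[of i] sum_takes_le[where n = n and \<phi> = \<phi> and i = i]
    by linarith
  have eq: "?t i = 1 + i * (2 * n)" if "i < k" for i
  proof (rule ccontr)
    assume "?t i \<noteq> 1 + i * (2 * n)"
    with le[of i] have "?t i < 1 + i * (2 * n)"
      by linarith
    with that have "(\<Sum>i<k. ?t i) < (\<Sum>i<k. 1 + i * (2 * n))"
      by (intro sum_strict_mono_ex1 ballI le) auto
    with ge show False
      by (simp add: all_gadgets_def value_of_downfrom target_def)
  qed
  \<comment> \<open>This is where the additional pendants act: without a color of its own, selector
    \<open>i\<close> misses the summand 1.\<close>
  have "\<exists>u<n. \<phi> i = i * n + u" if "i < k" for i
  proof (cases rule: sum_takes_cases[of n \<phi> i])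
    case 2
    with eq[OF that] le_pairs[of i] show ?thesis
      unfolding value_of_selector_gadgets by linarith
  qed blast
  then obtain h where h: "\<And>i. i < k \<Longrightarrow> h i < n" "\<And>i. i < k \<Longrightarrow> \<phi> i = i * n + h i"
    by metis
  have "adj (h i) (h j)" if ij: "i < k" "j < i" for i j
  proof (rule ccontr)
    assume "\<not> adj (h i) (h j)"
    with h ij have "pair_value adj n \<phi> i j < 2 * n"
      by (intro pair_value_less[where u = "h i" and v = "h j"]) auto
    with ij have "(\<Sum>j<i. pair_value adj n \<phi> i j) < (\<Sum>j<i. 2 * n)"
      by (intro sum_strict_mono_ex1 ballI pair_value_le) auto
    with eq[OF ij(1)] sum_takes_le[where n = n and \<phi> = \<phi> and i = i] show False
      unfolding value_of_selector_gadgets by simp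
  qed
  with h(1) show "\<exists>h. (\<forall>i<k. h i < n) \<and> (\<forall>i<k. \<forall>j<i. adj (h i) (h j))"
    by blast
next
  assume "\<exists>h. (\<forall>i<k. h i < n) \<and> (\<forall>i<k. \<forall>j<i. adj (h i) (h j))"
  then obtain h where h: "\<And>i. i < k \<Longrightarrow> h i < n" "\<And>i j. i < k \<Longrightarrow> j < i \<Longrightarrow> adj (h i) (h j)"
    by blast
  define \<phi> where "\<phi> i = i * n + h i" for i
  have "value_of \<phi> (selector_gadgets adj n i) = 1 + i * (2 * n)" if "i < k" for i
  proof -
    have "(\<Sum>u<n. takes \<phi> n i u) = 1"
      using h(1)[OF that] by (rule sum_takes) (simp add: \<phi>_def)
    moreover have "pair_value adj n \<phi> i j = 2 * n" if "j \<in> {..<i}" for j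
      using h(1)[of i] h(1)[of j] h(2)[of i j] that \<open>i < k\<close>
      by (intro pair_value_adjacent[where u = "h i" and v = "h j"]) (auto simp: \<phi>_def)
    then have "(\<Sum>j<i. pair_value adj n \<phi> i j) = (\<Sum>j<i. 2 * n)"
      by (intro sum.cong) auto
    ultimately show ?thesis
      by (simp add: value_of_selector_gadgets)
  qed
  then have "value_of \<phi> (all_gadgets adj n k) = target n k"
    by (simp add: all_gadgets_def value_of_downfrom target_def)
  then show "\<exists>\<phi>. target n k \<le> value_of \<phi> (all_gadgets adj n k)"
    by (metis le_refl)
qed

lemma set_downfrom: "set (downfrom m f) = (\<Union>i<m. set (f i))"
  by (auto simp: downfrom_def)

lemma all_gadgets_ok:
  assumes "g \<in> set (all_gadgets adj n k)"
  shows "gadget_ok k g"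
proof -
  from assms obtain i where i: "i < k" "g \<in> set (selector_gadgets adj n i)"
    by (auto simp: all_gadgets_def set_downfrom)
  then consider u where "g = [(i, i * n + u)]"
    | j u v where "j < i" "v < n" "g \<in> set (pair_gadgets adj n i j u v)"
    by (auto simp: selector_gadgets_def set_downfrom)
  then show ?thesis
  proof cases
    case 1
    with i show ?thesis by (simp add: gadget_ok_def)
  next
    case (2 j u v)
    \<comment> \<open>The colors of \<open>j\<close> lie entirely below the block that starts at
      \<open>i * n\<close>, so a shared vertex has two different colors.\<close>
    have "j * n + v < Suc j * n"
      using 2 by simp
    also have "\<dots> \<le> i * n"
      using 2 by (intro mult_le_mono1) simp
    finally have "j * n + v \<noteq> i * n + u"
      by linarith
    with 2 i show ?thesis
      by (auto simp: gadget_ok_def pair_gadgets_def split: if_splits)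
  qed
qed

section \<open>Cliques as indexed families, and correctness of the reduction\<close>

lemma clique_edges_iff:
  assumes "instance_of x = (n, k, r)" "u < n" "v < n" "u \<noteq> v"
  shows "{u, v} \<in> clique_edges x \<longleftrightarrow> listed_adjacent r u v"
  using assms by (auto simp: clique_edges_def listed_adjacent_def inst_entries_def inst_vertices_def
      doubleton_eq_iff)

lemma listed_adjacent_sym: "listed_adjacent r u v \<longleftrightarrow> listed_adjacent r v u"
  by (auto simp: listed_adjacent_def)

text \<open>An enumeration of the clique serves as \<open>h\<close>. Conversely, adjacency excludes
  equality, so \<open>h\<close> is injective below \<open>k\<close> and its image has exactly
  \<open>k\<close> elements.\<close>

lemma p_clique_iff:
  assumes x: "instance_of x = (n, k, r)"
  shows "x \<in> fst p_clique \<longleftrightarrow>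
    (\<exists>h. (\<forall>i<k. h i < n) \<and> (\<forall>i<k. \<forall>j<i. listed_adjacent r (h i) (h j)))"
proof -
  have inst: "inst_vertices x = {..<n}" "inst_k x = k"
    using x by (simp_all add: inst_vertices_def inst_k_def)
  show ?thesis
  proof
    assume "x \<in> fst p_clique"
    then obtain S where S: "S \<subseteq> {..<n}" "card S = k"
      "\<And>u v. u \<in> S \<Longrightarrow> v \<in> S \<Longrightarrow> u \<noteq> v \<Longrightarrow> {u, v} \<in> clique_edges x"
      by (auto simp: p_clique_def is_clique_def inst)
    then have "finite S"
      using finite_subset by blast
    then obtain h where h: "bij_betw h {0..<k} S"
      using ex_bij_betw_nat_finite S(2) by blast
    have hS: "h i \<in> S" if "i < k" for i
      using h that by (auto simp: bij_betw_def)
    have "h i \<noteq> h j" if "i < k" "j < i" for i j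
      using inj_on_eq_iff[OF bij_betw_imp_inj_on[OF h], of i j] that by simp
    then have "listed_adjacent r (h i) (h j)" if "i < k" "j < i" for i j
      using that S hS[of i] hS[of j] clique_edges_iff[OF x, of "h i" "h j"] by auto
    moreover have "h i < n" if "i < k" for i
      using hS[OF that] S(1) by auto
    ultimately show "\<exists>h. (\<forall>i<k. h i < n) \<and> (\<forall>i<k. \<forall>j<i. listed_adjacent r (h i) (h j))"
      by blast
  next
    assume "\<exists>h. (\<forall>i<k. h i < n) \<and> (\<forall>i<k. \<forall>j<i. listed_adjacent r (h i) (h j))"
    then obtain h where h: "\<And>i. i < k \<Longrightarrow> h i < n"
      "\<And>i j. i < k \<Longrightarrow> j < i \<Longrightarrow> listed_adjacent r (h i) (h j)"
      by blast
    have adj: "listed_adjacent r (h i) (h j)" if "i < k" "j < k" "i \<noteq> j" for i j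
      using that h(2)[of i j] h(2)[of j i] listed_adjacent_sym[of r "h i" "h j"] by (cases i j rule: linorder_cases) auto
    then have neq: "h i \<noteq> h j" if "i < k" "j < k" "i \<noteq> j" for i j
      using that by (auto simp: listed_adjacent_def)
    have "is_clique (inst_vertices x) (clique_edges x) (h ` {..<k})"
      unfolding is_clique_def inst using h(1) adj clique_edges_iff[OF x] by auto
    moreover have "card (h ` {..<k}) = k"
      using neq by (subst card_image) (auto intro: inj_onI)
    ultimately show "x \<in> fst p_clique"
      by (auto simp: p_clique_def inst)
  qed
qed

lemma reduction_gadget_instance:
  "instance_of x = (n, k, r) \<Longrightarrow>
   reduction x = gadget_instance k (target n k) (all_gadgets (listed_adjacent r) n k)"
  by (simp add: reduction_def gadget_instance_def Let_def)

lemma reduction_correct: "x \<in> fst p_clique \<longleftrightarrow> reduction x \<in> bipartite_colored_clustering"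
proof -
  obtain n k r where x: "instance_of x = (n, k, r)"
    by (rule prod_cases3[of "instance_of x"])
  have "reduction x \<in> bipartite_colored_clustering \<longleftrightarrow>
      (\<exists>\<phi>. target n k \<le> value_of \<phi> (all_gadgets (listed_adjacent r) n k))"
    unfolding reduction_gadget_instance[OF x] value_of_def
    by (rule gadget_instance_iff[OF all_gadgets_ok])
  then show ?thesis
    unfolding p_clique_iff[OF x] target_reached_iff by simp
qed

lemma reduction_parameters:
  "vertex_cover_parameter (reduction x) \<le> inst_k x"
  "tree_cut_width_parameter (reduction x) \<le> inst_k x + 2"
proof -
  obtain n k r where x: "instance_of x = (n, k, r)"
    by (rule prod_cases3[of "instance_of x"])
  then have k: "inst_k x = k"
    by (simp add: inst_k_def)
  show "vertex_cover_parameter (reduction x) \<le> inst_k x"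
    unfolding k reduction_gadget_instance[OF x]
    by (rule vertex_cover_parameter_gadget_instance[OF all_gadgets_ok])
  have "tree_cut_width_parameter (reduction x) \<le> max k 2"
    unfolding reduction_gadget_instance[OF x]
    by (rule tree_cut_width_parameter_gadget_instance[OF all_gadgets_ok])
  then show "tree_cut_width_parameter (reduction x) \<le> inst_k x + 2"
    by (simp add: k)
qed

section \<open>The program\<close>

text \<open>
  Stacks \<open>rI\<close>, \<open>rJ\<close>, \<open>rU\<close>, \<open>rV\<close> hold loop indices and \<open>cI\<close>, \<open>cJ\<close>, \<open>cU\<close>, \<open>cV\<close> the remaining iterations;
  \<open>rBi\<close> and \<open>rBj\<close> hold the color offsets \<open>i * n\<close> and \<open>j * n\<close>, \<open>rW\<close> the next unused vertex and \<open>rTgt\<close> the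
  target size.  The others serve parsing and the search for a pair in the edge list \<open>rL\<close>: \<open>rNum\<close> is
  the block being read, \<open>rPh\<close> its position, \<open>rFst\<close> the first entry of a pair, and \<open>rHit\<close> is nonempty once
  the pair has been found.
\<close>

abbreviation (input) rOut :: nat where "rOut \<equiv> 0"
abbreviation (input) rN :: nat where "rN \<equiv> 2"
abbreviation (input) rK :: nat where "rK \<equiv> 3"
abbreviation (input) rL :: nat where "rL \<equiv> 4"
abbreviation (input) rNum :: nat where "rNum \<equiv> 5"
abbreviation (input) rPh :: nat where "rPh \<equiv> 6"
abbreviation (input) rI :: nat where "rI \<equiv> 7"
abbreviation (input) rJ :: nat where "rJ \<equiv> 8"
abbreviation (input) rU :: nat where "rU \<equiv> 9"
abbreviation (input) rV :: nat where "rV \<equiv> 10"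
abbreviation (input) rBi :: nat where "rBi \<equiv> 11"
abbreviation (input) rBj :: nat where "rBj \<equiv> 12"
abbreviation (input) rW :: nat where "rW \<equiv> 13"
abbreviation (input) rTgt :: nat where "rTgt \<equiv> 14"
abbreviation (input) rT :: nat where "rT \<equiv> 15"
abbreviation (input) rX :: nat where "rX \<equiv> 16"
abbreviation (input) rY :: nat where "rY \<equiv> 17"
abbreviation (input) rD :: nat where "rD \<equiv> 18"
abbreviation (input) rHit :: nat where "rHit \<equiv> 19"
abbreviation (input) rNe :: nat where "rNe \<equiv> 20"
abbreviation (input) rFst :: nat where "rFst \<equiv> 21"
abbreviation (input) rScan :: nat where "rScan \<equiv> 22"
abbreviation (input) cI :: nat where "cI \<equiv> 23"
abbreviation (input) cJ :: nat where "cJ \<equiv> 24"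
abbreviation (input) cU :: nat where "cU \<equiv> 25"
abbreviation (input) cV :: nat where "cV \<equiv> 26"

section \<open>Unary loops, output of edges, and comparison of numbers\<close>

abbreviation unary :: "nat \<Rightarrow> bool list" where
  "unary n \<equiv> replicate n True"

lemma unary_neq_False_Cons [simp]: "unary n \<noteq> False # xs"
  by (cases n) auto

lemma exec_le_eq: "exec_le p s T s1 \<Longrightarrow> s1 = s' \<Longrightarrow> exec_le p s T s'"
  by simp

lemma exec_le_copy_unary:
  assumes "i \<noteq> j" "i \<noteq> t" "j \<noteq> t" "s t = []" "s i = unary m" "m \<le> Z"
  shows "exec_le (copy i j t) s (9 * Z + 2) (s(j := unary m @ s j))"
  using exec_le_copy[of i j t s Z] assms by simp

text \<open>The loop consumes the copy \<open>c\<close>, so the number on stack \<open>i\<close>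
  survives.\<close>

definition for_unary :: "nat \<Rightarrow> nat \<Rightarrow> prog \<Rightarrow> prog" where
  "for_unary i c p = Seq (copy i c rT) (each_bit c p p)"

lemma exec_le_for_unary:
  assumes "i \<noteq> c" "i \<noteq> rT" "c \<noteq> rT" "s rT = []" "s c = []" "s i = unary n" "n \<le> Z"
    and step: "\<And>m. m < n \<Longrightarrow> exec_le p ((S m)(c := unary (n - Suc m))) T
      ((S (Suc m))(c := unary (n - Suc m)))"
    and S: "S 0 = s" "S n c = []"
  shows "exec_le (for_unary i c p) s (9 * Z + 3 + Z * (T + 3)) (S n)"
proof -
  have "exec_le (copy i c rT) s (9 * Z + 2) (s(c := unary n @ s c))"
    using assms by (intro exec_le_copy_unary) auto
  moreover have "exec_le (each_bit c p p) (s(c := unary n @ s c)) (n * (T + 3) + 1) (S n)"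
    using S assms(5) by (intro exec_le_each_bit_unary[where S = S] step) (auto simp: fun_eq_iff)
  ultimately have "exec_le (for_unary i c p) s (9 * Z + 2 + (n * (T + 3) + 1)) (S n)"
    unfolding for_unary_def by (rule exec_le_Seq)
  moreover have "n * (T + 3) \<le> Z * (T + 3)"
    using assms(7) by (rule mult_le_mono1)
  ultimately show ?thesis
    by (auto elim!: exec_le_mono)
qed

text \<open>The blocks of the triple are pushed from last to first. The color is a sum, formed by
  pushing two unary blocks without a separator between them.\<close>

definition emit :: "nat \<Rightarrow> nat \<Rightarrow> nat \<Rightarrow> prog" where
  "emit a b c = Seq (Push rOut False) (Seq (copy c rOut rT) (Seq (copy b rOut rT)
     (Seq (Push rOut False) (Seq (copy rW rOut rT) (Seq (Push rOut False) (copy a rOut rT))))))"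

lemma exec_le_emit:
  assumes "a \<notin> {rOut, rT}" "b \<notin> {rOut, rT}" "c \<notin> {rOut, rT}" "s rT = []"
    and "s a = unary i" "s b = unary m" "s c = unary l" "s rW = unary w"
    and "i \<le> Z" "m \<le> Z" "l \<le> Z" "w \<le> Z"
  shows "exec_le (emit a b c) s (36 * Z + 11) (s(rOut := enc [i, w, m + l] @ s rOut))"
  unfolding emit_def
  apply (rule exec_le_mono)
   apply (rule exec_le_eq)
    apply (rule exec_le_Seq, rule exec_le_Push)
    apply (rule exec_le_Seq, rule exec_le_copy_unary[where m = l and Z = Z])
          apply (use assms in simp_all)[6]
    apply (rule exec_le_Seq, rule exec_le_copy_unary[where m = m and Z = Z])
          apply (use assms in simp_all)[6]
    apply (rule exec_le_Seq, rule exec_le_Push)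
    apply (rule exec_le_Seq, rule exec_le_copy_unary[where m = w and Z = Z])
          apply (use assms in simp_all)[6]
    apply (rule exec_le_Seq, rule exec_le_Push)
    apply (rule exec_le_copy_unary[where m = i and Z = Z])
         apply (use assms in simp_all)[6]
   apply (simp add: fun_eq_iff replicate_add)
  apply simp
  done

text \<open>Adds the absolute difference of the two numbers to \<open>d\<close>: the first cancels a
  copy of the second, and whatever is left over on either side is pushed. As \<open>d\<close>
  accumulates, several equalities hold together iff an initially empty \<open>d\<close> stays
  empty.\<close>

definition differ :: "nat \<Rightarrow> nat \<Rightarrow> nat \<Rightarrow> prog" where
  "differ a b d = Seq (copy b rY rT) (Seq
     (for_unary a rX (Branch rY (Push d True) (Pop rY) (Pop rY)))
     (each_bit rY (Push d True) (Push d True)))"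

lemma exec_le_differ:
  assumes "a \<notin> {rX, rY, rT}" "b \<notin> {rX, rY, rT}" "d \<notin> {a, b, rX, rY, rT}"
    and "s rX = []" "s rY = []" "s rT = []"
    and "s a = unary m" "s b = unary l" "m \<le> Z" "l \<le> Z"
  shows "exec_le (differ a b d) s (27 * Z + 6) (s(d := unary ((m - l) + (l - m)) @ s d))"
proof -
  \<comment> \<open>Subtraction is truncated: after \<open>t\<close> rounds at most one of
    \<open>l - t\<close> and \<open>t - l\<close> is nonzero.\<close>
  let ?S1 = "\<lambda>t. s(rY := unary (l - t), d := unary (t - l) @ s d)"
  let ?S2 = "\<lambda>t. s(d := unary (t + (m - l)) @ s d)"
  have 1: "exec_le (copy b rY rT) s (9 * Z + 2) (?S1 0)"
    using exec_le_copy_unary[of b rY rT s l Z] assms by (simp add: fun_upd_idem)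
  have 2: "exec_le (for_unary a rX (Branch rY (Push d True) (Pop rY) (Pop rY))) (?S1 0)
      (9 * Z + 3 + Z * (2 + 3)) (?S1 m)"
  proof (rule exec_le_for_unary[where S = ?S1])
    fix t
    let ?s = "(?S1 t)(rX := unary (m - Suc t))"
    let ?s' = "(?S1 (Suc t))(rX := unary (m - Suc t))"
    have "exec_le (Branch rY (Push d True) (Pop rY) (Pop rY)) ?s (1 + 1) ?s'"
    proof (rule exec_le_Branch)
      assume "?s rY = []"
      then have "l \<le> t" using assms by simp
      then show "exec_le (Push d True) ?s 1 ?s'"
        using exec_le_Push[of d True ?s] assms
        by (auto simp: Suc_diff_le fun_eq_iff elim!: exec_le_eq)
    next
      fix xs assume "?s rY = True # xs"
      then have "t < l" using assms by (cases "t < l") auto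
      then show "exec_le (Pop rY) ?s 1 ?s'"
        using exec_le_Pop[of rY ?s] assms
        by (auto simp: fun_eq_iff elim!: exec_le_eq)
    next
      fix xs assume "?s rY = False # xs"
      then show "exec_le (Pop rY) ?s 1 ?s'"
        using assms by simp
    qed
    then show "exec_le (Branch rY (Push d True) (Pop rY) (Pop rY)) ?s 2 ?s'"
      by (simp add: numeral_2_eq_2)
  qed (use assms in auto)
  have 3: "exec_le (each_bit rY (Push d True) (Push d True)) (?S1 m) ((l - m) * (1 + 3) + 1) (?S2 (l - m))"
  proof (rule exec_le_each_bit_unary[where S = ?S2])
    fix t
    show "exec_le (Push d True) ((?S2 t)(rY := unary (l - m - Suc t))) 1
        ((?S2 (Suc t))(rY := unary (l - m - Suc t)))"
      using exec_le_Push[of d True "(?S2 t)(rY := unary (l - m - Suc t))"] assms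
      by (auto simp: fun_eq_iff elim!: exec_le_eq)
  qed (use assms in \<open>auto simp: fun_eq_iff\<close>)
  have "exec_le (differ a b d) s
      (9 * Z + 2 + (9 * Z + 3 + Z * (2 + 3) + ((l - m) * (1 + 3) + 1))) (?S2 (l - m))"
    unfolding differ_def by (rule exec_le_Seq[OF 1 exec_le_Seq[OF 2 3]])
  moreover have "l - m \<le> Z" "?S2 (l - m) = s(d := unary ((m - l) + (l - m)) @ s d)"
    using assms by (auto simp: add.commute)
  ultimately show ?thesis
    by (auto elim!: exec_le_mono)
qed

section \<open>Matching pairs and scanning the edge list\<close>

definition mark :: "bool \<Rightarrow> bool list" where
  "mark P = (if P then [True] else [])"

lemma mark_simps: "mark P = [] \<longleftrightarrow> \<not> P" "length (mark P) \<le> Suc 0"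
  by (simp_all add: mark_def)

definition match_pair :: "nat \<Rightarrow> nat \<Rightarrow> prog" where
  "match_pair a b = Seq (differ rFst a rD) (Seq (differ rNum b rD)
     (Seq (Branch rD (Push rHit True) Skip Skip) (clear rD)))"

lemma exec_le_match_pair:
  assumes "a \<notin> {rX, rY, rT, rD}" "b \<notin> {rX, rY, rT, rD}"
    and "s rX = []" "s rY = []" "s rT = []" "s rD = []"
    and "s rFst = unary m" "s rNum = unary l" "s a = unary m'" "s b = unary l'"
    and "m \<le> Z" "l \<le> Z" "m' \<le> Z" "l' \<le> Z"
  shows "exec_le (match_pair a b) s (62 * Z + 15)
    (s(rHit := mark (m = m' \<and> l = l') @ s rHit))"
proof -
  let ?d = "(l - l') + (l' - l) + ((m - m') + (m' - m))"
  let ?s = "s(rD := unary ?d)"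
  let ?hit = "mark (m = m' \<and> l = l') @ s rHit"
  have 1: "exec_le (differ rFst a rD) s (27 * Z + 6) (s(rD := unary ((m - m') + (m' - m))))"
    using exec_le_differ[of rFst a rD s m m' Z] assms by auto
  have 2: "exec_le (differ rNum b rD) (s(rD := unary ((m - m') + (m' - m)))) (27 * Z + 6) ?s"
    using exec_le_differ[of rNum b rD "s(rD := unary ((m - m') + (m' - m)))" l l' Z] assms
    by (auto simp: replicate_add)
  have 3: "exec_le (Branch rD (Push rHit True) Skip Skip) ?s (1 + 1) (?s(rHit := ?hit))"
  proof (rule exec_le_Branch)
    assume "?s rD = []"
    then have "m = m' \<and> l = l'" by auto
    then show "exec_le (Push rHit True) ?s 1 (?s(rHit := ?hit))"
      using exec_le_Push[of rHit True ?s] by (simp add: mark_def)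
  next
    fix xs assume "?s rD = True # xs"
    then have "\<not> (m = m' \<and> l = l')" by auto
    then show "exec_le Skip ?s 1 (?s(rHit := ?hit))"
      using exec_le_Skip[of ?s] by (auto simp: fun_upd_idem mark_def)
  next
    fix xs assume "?s rD = False # xs"
    then have "\<not> (m = m' \<and> l = l')" by auto
    then show "exec_le Skip ?s 1 (?s(rHit := ?hit))"
      using exec_le_Skip[of ?s] by (auto simp: fun_upd_idem mark_def)
  qed
  \<comment> \<open>\<open>rD\<close> holds the sum of two differences, each at most
    \<open>Z\<close>.\<close>
  have 4: "exec_le (clear rD) (?s(rHit := ?hit)) (4 * (2 * Z) + 1) (s(rHit := ?hit))"
    using exec_le_clear[of "?s(rHit := ?hit)" rD "2 * Z"] assms
    by (auto simp: fun_upd_twist fun_upd_idem)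
  from exec_le_Seq[OF 1 exec_le_Seq[OF 2 exec_le_Seq[OF 3 4]]] show ?thesis
    unfolding match_pair_def by (auto elim!: exec_le_mono)
qed

text \<open>The state consists of the length \<open>a\<close> of the current block, the first entry
  \<open>b\<close> of an open pair, whether a pair is open, and the hits. The sum
  \<open>a + b\<close> mirrors \<open>move\<close>, which prepends to \<open>rFst\<close>; in a run
  from the initial state \<open>b\<close> is 0 at that point.\<close>

definition scan_step ::
    "nat \<Rightarrow> nat \<Rightarrow> nat \<times> nat \<times> bool \<times> bool list \<Rightarrow> bool \<Rightarrow> nat \<times> nat \<times> bool \<times> bool list" where
  "scan_step u v = (\<lambda>(a, b, ph, c) x.
     if x then (Suc a, b, ph, c)
     else if \<not> ph then (0, a + b, True, c)
     else (0, 0, False, mark (b = v \<and> a = u) @ mark (b = u \<and> a = v) @ c))"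

lemma scan_step_simps [simp]:
  "scan_step u v (a, b, ph, c) True = (Suc a, b, ph, c)"
  "scan_step u v (a, b, False, c) False = (0, a + b, True, c)"
  "scan_step u v (a, b, True, c) False =
     (0, 0, False, mark (b = v \<and> a = u) @ mark (b = u \<and> a = v) @ c)"
  by (simp_all add: scan_step_def)

definition hits :: "nat \<Rightarrow> nat \<Rightarrow> bool list \<Rightarrow> bool list" where
  "hits u v xs = snd (snd (snd (foldl (scan_step u v) (0, 0, False, []) xs)))"

lemma scan_step_bounds:
  assumes "scan_step u v (a, b, ph, c) x = (a', b', ph', c')" "a + b \<le> n" "length c \<le> 2 * n"
  shows "a' + b' \<le> Suc n \<and> length c' \<le> 2 * Suc n"
proof -
  have "length (mark (b = v \<and> a = u)) \<le> Suc 0" "length (mark (b = u \<and> a = v)) \<le> Suc 0"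
    by (rule mark_simps)+
  with assms show ?thesis
    by (cases x; cases ph) auto
qed

lemma scan_bounds:
  "foldl (scan_step u v) (0, 0, False, []) xs = (a, b, ph, c) \<Longrightarrow>
   a + b \<le> length xs \<and> length c \<le> 2 * length xs"
proof (induction xs arbitrary: a b ph c rule: rev_induct)
  case (snoc x xs)
  obtain a' b' ph' c' where *: "foldl (scan_step u v) (0, 0, False, []) xs = (a', b', ph', c')"
    by (rule prod_cases4[of "foldl (scan_step u v) (0, 0, False, []) xs"])
  have "scan_step u v (a', b', ph', c') x = (a, b, ph, c)"
    using snoc.prems by (simp only: foldl_append foldl.simps *)
  from scan_step_bounds[OF this] snoc.IH[OF *] show ?case
    by simp
qed simp

lemma length_hits: "length (hits u v xs) \<le> 2 * length xs"
proof -
  obtain a b ph c where "foldl (scan_step u v) (0, 0, False, []) xs = (a, b, ph, c)"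
    by (rule prod_cases4[of "foldl (scan_step u v) (0, 0, False, []) xs"])
  with scan_bounds[OF this] show ?thesis
    by (simp add: hits_def)
qed

text \<open>For the induction, an open pair puts its first entry in front of the numbers still to be
  read. Without an open pair \<open>b\<close> must be 0, since it is added to the next
  entry.\<close>

lemma foldl_scan_step:
  "(ph \<or> b = 0) \<Longrightarrow> snd (snd (snd (foldl (scan_step u v) (a, b, ph, c) xs))) \<noteq> [] \<longleftrightarrow>
     c \<noteq> [] \<or> (\<exists>(p, q) \<in> set (pairs ((if ph then [b] else []) @ nats_from a xs)).
       p = u \<and> q = v \<or> p = v \<and> q = u)"
proof (induction xs arbitrary: a b ph c)
  case Nil
  then show ?case by (cases ph) auto
next
  case (Cons x xs)
  show ?case
  proof (cases x)
    case True
    then show ?thesis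
      using Cons.IH[of ph b "Suc a" c] Cons.prems by simp
  next
    case x: False
    show ?thesis
    proof (cases ph)
      case True
      then show ?thesis
        using x Cons.IH[of False 0 0] by (auto simp: mark_simps)
    next
      case False
      then show ?thesis
        using x Cons.IH[of True a 0] Cons.prems by simp
    qed
  qed
qed

lemma hits_iff: "hits u v xs \<noteq> [] \<longleftrightarrow>
   (u, v) \<in> set (pairs (nats_from 0 xs)) \<or> (v, u) \<in> set (pairs (nats_from 0 xs))"
  using foldl_scan_step[of False 0 u v 0 "[]" xs] unfolding hits_def by auto

definition close_pair :: prog where
  "close_pair = Seq (match_pair rU rV) (Seq (match_pair rV rU) (Seq (clear rNum) (Seq (clear rFst) (clear rPh))))"

lemma exec_le_close_pair:
  assumes "s rFst = unary b" "s rNum = unary a" "s rU = unary u" "s rV = unary v"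
    and "s rX = []" "s rY = []" "s rT = []" "s rD = []"
    and "a \<le> Z" "b \<le> Z" "u \<le> Z" "v \<le> Z" "length (s rPh) \<le> 1"
  shows "exec_le close_pair s (132 * Z + 37)
    (s(rHit := mark (b = v \<and> a = u) @ mark (b = u \<and> a = v) @ s rHit,
       rNum := [], rFst := [], rPh := []))"
proof -
  define h1 h2 where "h1 = mark (b = u \<and> a = v)"
    and "h2 = mark (b = v \<and> a = u)"
  let ?s1 = "s(rHit := h1 @ s rHit)"
  let ?s2 = "s(rHit := h2 @ h1 @ s rHit)"
  have 1: "exec_le (match_pair rU rV) s (62 * Z + 15) ?s1"
    unfolding h1_def by (rule exec_le_match_pair) (simp_all add: assms)
  have "exec_le (match_pair rV rU) ?s1 (62 * Z + 15) (?s1(rHit := h2 @ ?s1 rHit))"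
    unfolding h2_def by (rule exec_le_match_pair) (simp_all add: assms)
  then have 2: "exec_le (match_pair rV rU) ?s1 (62 * Z + 15) ?s2"
    by simp
  have 3: "exec_le (clear rNum) ?s2 (4 * Z + 1) (?s2(rNum := []))"
    by (rule exec_le_clear) (simp add: assms)
  have 4: "exec_le (clear rFst) (?s2(rNum := [])) (4 * Z + 1) (?s2(rNum := [], rFst := []))"
    by (rule exec_le_clear) (simp add: assms)
  have 5: "exec_le (clear rPh) (?s2(rNum := [], rFst := [])) (4 * 1 + 1) (?s2(rNum := [], rFst := [], rPh := []))"
    by (rule exec_le_clear) (use assms in simp)
  show ?thesis
    unfolding close_pair_def h1_def[symmetric] h2_def[symmetric]
    by (rule exec_le_mono,
        rule exec_le_Seq[OF 1 exec_le_Seq[OF 2 exec_le_Seq[OF 3 exec_le_Seq[OF 4 5]]]]) simp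
qed

text \<open>A copy is consumed, as \<open>rL\<close> is queried again for every pair. The final
  clearing removes an unclosed block or an unpaired entry left over at the end of the list.\<close>

definition scan :: prog where
  "scan = Seq (copy rL rScan rT) (Seq
     (each_bit rScan (Branch rPh (Seq (move rNum rFst) (Push rPh True)) close_pair close_pair) (Push rNum True))
     (Seq (clear rNum) (Seq (clear rFst) (clear rPh))))"

definition scan_store :: "store \<Rightarrow> nat \<times> nat \<times> bool \<times> bool list \<Rightarrow> store" where
  "scan_store s st = (case st of (a, b, ph, c) \<Rightarrow>
     s(rNum := unary a, rFst := unary b, rPh := mark ph, rHit := c))"

lemma exec_le_scan_step:
  assumes st: "st = (a, b, ph, c)"
    and "s rU = unary u" "s rV = unary v" "s rX = []" "s rY = []" "s rT = []" "s rD = []"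
    and "a + b \<le> Z" "u \<le> Z" "v \<le> Z"
  shows "exec_le (if x then Push rNum True
      else Branch rPh (Seq (move rNum rFst) (Push rPh True)) close_pair close_pair)
     (scan_store s st) (132 * Z + 38) (scan_store s (scan_step u v st x))"
proof (cases x)
  case True
  have "scan_store s (scan_step u v st True) = (scan_store s st)(rNum := True # scan_store s st rNum)"
    by (simp add: st scan_store_def fun_eq_iff)
  with exec_le_Push[of rNum True "scan_store s st"] have
    "exec_le (Push rNum True) (scan_store s st) 1 (scan_store s (scan_step u v st True))"
    by simp
  then show ?thesis
    using True by (auto elim!: exec_le_mono)
next
  case x: False
  let ?s = "scan_store s st" and ?s' = "scan_store s (scan_step u v st False)"
  have close: "exec_le close_pair ?s (132 * Z + 37) ?s'" if ph
  proof (rule exec_le_eq)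
    show "exec_le close_pair ?s (132 * Z + 37)
       (?s(rHit := mark (b = v \<and> a = u) @ mark (b = u \<and> a = v) @ ?s rHit,
        rNum := [], rFst := [], rPh := []))"
      by (rule exec_le_close_pair) (use assms in \<open>simp_all add: scan_store_def mark_simps\<close>)
    show "?s(rHit := mark (b = v \<and> a = u) @ mark (b = u \<and> a = v) @ ?s rHit,
        rNum := [], rFst := [], rPh := []) = ?s'"
      using that mark_simps(1)[of False] by (simp add: scan_store_def st fun_eq_iff)
  qed
  have open1: "exec_le (Seq (move rNum rFst) (Push rPh True)) ?s (132 * Z + 37) ?s'" if "\<not> ph"
  proof -
    let ?t = "?s(rNum := [], rFst := unary (a + b))"
    have "exec_le (move rNum rFst) ?s (4 * Z + 1) ?t"
      using exec_le_move[of rNum rFst ?s Z] assms by (simp add: scan_store_def replicate_add)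
    moreover have "?t(rPh := True # ?t rPh) = ?s'"
      using that by (simp add: scan_store_def st fun_eq_iff mark_def)
    then have "exec_le (Push rPh True) ?t 1 ?s'"
      using exec_le_Push[of rPh True ?t] by simp
    ultimately have "exec_le (Seq (move rNum rFst) (Push rPh True)) ?s (4 * Z + 1 + 1) ?s'"
      by (rule exec_le_Seq)
    then show ?thesis
      by (rule exec_le_mono) simp
  qed
  have "exec_le (Branch rPh (Seq (move rNum rFst) (Push rPh True)) close_pair close_pair) ?s (132 * Z + 37 + 1) ?s'"
  proof (rule exec_le_Branch)
    assume "?s rPh = []"
    then have "\<not> ph" by (simp add: scan_store_def st mark_def split: if_splits)
    then show "exec_le (Seq (move rNum rFst) (Push rPh True)) ?s (132 * Z + 37) ?s'"
      by (rule open1)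
  next
    fix xs assume "?s rPh = True # xs"
    then have ph by (simp add: scan_store_def st mark_def split: if_splits)
    then show "exec_le close_pair ?s (132 * Z + 37) ?s'"
      by (rule close)
  next
    fix xs assume "?s rPh = False # xs"
    then have ph by (simp add: scan_store_def st mark_def split: if_splits)
    then show "exec_le close_pair ?s (132 * Z + 37) ?s'"
      by (rule close)
  qed
  then show ?thesis
    using x by (simp add: add.commute)
qed

lemma exec_le_scan:
  assumes "s rU = unary u" "s rV = unary v" "s rX = []" "s rY = []" "s rT = []" "s rD = []"
    and "s rNum = []" "s rFst = []" "s rPh = []" "s rHit = []" "s rScan = []"
    and "length (s rL) \<le> Z" "u \<le> Z" "v \<le> Z"
  shows "exec_le scan s (21 * Z + 20 + Z * (132 * Z + 41)) (s(rHit := hits u v (s rL)))"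
proof -
  let ?S = "\<lambda>ys. scan_store s (foldl (scan_step u v) (0, 0, False, []) ys)"
  have 1: "exec_le (copy rL rScan rT) s (9 * Z + 2) (s(rScan := s rL))"
    using exec_le_copy[of rL rScan rT s Z] assms by simp
  have 2: "exec_le (each_bit rScan
       (Branch rPh (Seq (move rNum rFst) (Push rPh True)) close_pair close_pair)
       (Push rNum True)) (s(rScan := s rL)) (length (s rL) * (132 * Z + 38 + 3) + 1) ((?S (s rL))(rScan := []))"
  proof (rule exec_le_each_bit[where S = ?S])
    fix ys x zs assume eq: "s rL = ys @ x # zs"
    obtain a b ph c where st: "foldl (scan_step u v) (0, 0, False, []) ys = (a, b, ph, c)"
      by (rule prod_cases4[of "foldl (scan_step u v) (0, 0, False, []) ys"])
    have "a + b \<le> Z"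
      using scan_bounds[OF st] assms(12) eq by simp
    then have "exec_le (if x then Push rNum True
        else Branch rPh (Seq (move rNum rFst) (Push rPh True)) close_pair close_pair)
        (scan_store (s(rScan := zs)) (foldl (scan_step u v) (0, 0, False, []) ys)) (132 * Z + 38)
        (scan_store (s(rScan := zs)) (scan_step u v (foldl (scan_step u v) (0, 0, False, []) ys) x))"
      by (intro exec_le_scan_step[OF st]) (simp_all add: assms)
    moreover have "scan_store (s(rScan := zs)) st' = (scan_store s st')(rScan := zs)" for st'
      by (simp add: scan_store_def fun_eq_iff split: prod.splits)
    ultimately show "exec_le (if x then Push rNum True
        else Branch rPh (Seq (move rNum rFst) (Push rPh True)) close_pair close_pair)
        ((?S ys)(rScan := zs)) (132 * Z + 38) ((?S (ys @ [x]))(rScan := zs))"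
      by (simp only: foldl_append foldl.simps)
  qed (use assms in \<open>auto simp: scan_store_def fun_eq_iff mark_def\<close>)
  obtain a b ph c where st: "foldl (scan_step u v) (0, 0, False, []) (s rL) = (a, b, ph, c)"
    by (rule prod_cases4[of "foldl (scan_step u v) (0, 0, False, []) (s rL)"])
  have ab: "a + b \<le> Z" and c: "hits u v (s rL) = c"
    using scan_bounds[OF st] assms(12) st by (auto simp: hits_def)
  have 3: "exec_le (Seq (clear rNum) (Seq (clear rFst) (clear rPh))) ((?S (s rL))(rScan := []))
      (4 * Z + 1 + (4 * Z + 1 + (4 * 1 + 1))) (s(rHit := hits u v (s rL)))"
    unfolding st c scan_store_def
    apply (rule exec_le_eq)
     apply (rule exec_le_Seq, rule exec_le_clear[where Z = Z])
      apply (use ab in simp)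
     apply (rule exec_le_Seq, rule exec_le_clear[where Z = Z])
      apply (use ab in simp)
     apply (rule exec_le_clear[where Z = 1])
     apply (simp add: mark_def)
    apply (use assms in \<open>simp add: fun_eq_iff\<close>)
    done
  have "length (s rL) * (132 * Z + 38 + 3) \<le> Z * (132 * Z + 41)"
    using assms(12) by (intro mult_le_mono) auto
  then show ?thesis
    using exec_le_Seq[OF 1 exec_le_Seq[OF 2 3]]
    unfolding scan_def by (auto elim!: exec_le_mono)
qed

section \<open>The nested loops that write the gadgets\<close>

definition scratch_empty :: "store \<Rightarrow> bool" where
  "scratch_empty s \<longleftrightarrow> (\<forall>i\<in>{rNum, rPh, rT, rX, rY, rD, rHit, rNe, rFst, rScan}. s i = [])"

text \<open>The effect of a loop on output and vertex counter is stated as replacing one gadget list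
  by a longer one.\<close>

definition put :: "nat \<Rightarrow> gadget list \<Rightarrow> store \<Rightarrow> store" where
  "put k gs s = s(rOut := enc (flat (gadget_entries k gs)), rW := unary (k + length gs))"

definition pair_step :: prog where
  "pair_step = Seq (emit rI rBi rU) (Seq scan (Seq (differ rU rV rNe)
     (Seq (let p = Branch rHit Skip (Push rW True) (Push rW True) in Branch rNe Skip p p)
     (Seq (clear rHit) (Seq (clear rNe) (Seq (emit rJ rBj rV) (Seq (Push rW True) (Push rV True))))))))"

lemma exec_le_pair_step:
  assumes free: "scratch_empty s" and out: "s rOut = enc (flat (gadget_entries k gs))" "s rW = unary (k + length gs)"
    and ij: "s rI = unary i" "s rJ = unary j" "s rBi = unary (i * n)" "s rBj = unary (j * n)"
    and uv: "s rU = unary u" "s rV = unary v"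
    and le: "length (s rL) \<le> Z" "i \<le> Z" "j \<le> Z" "u \<le> Z" "v \<le> Z" "i * n \<le> Z" "j * n \<le> Z"
      "k + length gs < Z"
  shows "exec_le pair_step s (132 * (Z * Z) + 200 * Z + 100)
    (put k (pair_gadgets (listed_adjacent (nats_from 0 (s rL))) n i j u v @ gs)
      (s(rV := unary (Suc v))))"
proof -
  let ?adj = "listed_adjacent (nats_from 0 (s rL)) u v"
  let ?w = "k + length gs"
  let ?w' = "if ?adj then Suc ?w else ?w"
  let ?h = "hits u v (s rL)"
  let ?d = "(u - v) + (v - u)"
  let ?s1 = "s(rOut := enc [i, ?w, i * n + u] @ s rOut)"
  let ?s2 = "?s1(rHit := ?h)"
  let ?s3 = "?s2(rNe := unary ?d)"
  let ?s4 = "?s3(rW := unary ?w')"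
  let ?s5 = "?s1(rW := unary ?w')"
  have adj: "?adj \<longleftrightarrow> ?d > 0 \<and> ?h \<noteq> []"
    unfolding hits_iff listed_adjacent_def by auto
  \<comment> \<open>The counter may be raised between the two edges, hence the strict bound on
    \<open>k + length gs\<close>.\<close>
  have w: "?w' \<le> Z"
    using le by auto
  have emptys: "s rNum = []" "s rPh = []" "s rT = []" "s rX = []" "s rY = []" "s rD = []" "s rHit = []"
    "s rNe = []" "s rFst = []" "s rScan = []"
    using free by (simp_all add: scratch_empty_def)
  have 1: "exec_le (emit rI rBi rU) s (36 * Z + 11) ?s1"
    by (rule exec_le_emit) (use ij uv out le emptys in auto)
  have 2: "exec_le scan ?s1 (21 * Z + 20 + Z * (132 * Z + 41)) ?s2"
    using exec_le_scan[of ?s1 u v Z] uv le emptys by simp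
  have 3: "exec_le (differ rU rV rNe) ?s2 (27 * Z + 6) ?s3"
    using exec_le_differ[of rU rV rNe ?s2 u v Z] uv le emptys by simp
  have hit: "exec_le (Branch rHit Skip (Push rW True) (Push rW True)) ?s3 (1 + 1) ?s4" if "?d > 0"
  proof (rule exec_le_Branch)
    assume "?s3 rHit = []"
    with adj have "\<not> ?adj" by simp
    with exec_le_Skip[of ?s3] show "exec_le Skip ?s3 1 ?s4"
      using out by (simp add: fun_upd_idem)
  next
    fix xs assume "?s3 rHit = True # xs"
    with adj that have ?adj by simp
    with exec_le_Push[of rW True ?s3] show "exec_le (Push rW True) ?s3 1 ?s4"
      using out by simp
  next
    fix xs assume "?s3 rHit = False # xs"
    with adj that have ?adj by simp
    with exec_le_Push[of rW True ?s3] show "exec_le (Push rW True) ?s3 1 ?s4"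
      using out by simp
  qed
  have eq: "exec_le Skip ?s3 1 ?s4" if "?d = 0"
    using exec_le_Skip[of ?s3] that adj out by (simp add: fun_upd_idem)
  have "exec_le (let p = Branch rHit Skip (Push rW True) (Push rW True) in Branch rNe Skip p p)
     ?s3 ((1 + 1) + 1) ?s4"
    unfolding Let_def
  proof (rule exec_le_Branch)
    assume "?s3 rNe = []"
    then have "?d = 0" by simp
    then show "exec_le Skip ?s3 (1 + 1) ?s4"
      by (rule exec_le_mono[OF eq]) simp
  next
    fix xs assume "?s3 rNe = True # xs"
    then have "?d > 0" by (intro Nat.gr0I) simp
    then show "exec_le (Branch rHit Skip (Push rW True) (Push rW True)) ?s3 (1 + 1) ?s4"
      by (rule hit)
  next
    fix xs assume "?s3 rNe = False # xs"
    then have "?d > 0" by (intro Nat.gr0I) simp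
    then show "exec_le (Branch rHit Skip (Push rW True) (Push rW True)) ?s3 (1 + 1) ?s4"
      by (rule hit)
  qed
  then have 4: "exec_le (let p = Branch rHit Skip (Push rW True) (Push rW True) in Branch rNe Skip p p)
     ?s3 3 ?s4"
    by (simp add: numeral_3_eq_3)
  have "length ?h \<le> 2 * Z"
    using length_hits[of u v "s rL"] le by linarith
  then have 5: "exec_le (clear rHit) ?s4 (4 * (2 * Z) + 1) (?s4(rHit := []))"
    by (intro exec_le_clear) simp
  have "?d \<le> 2 * Z"
    using le by linarith
  then have "exec_le (clear rNe) (?s4(rHit := [])) (4 * (2 * Z) + 1) (?s4(rHit := [], rNe := []))"
    by (intro exec_le_clear) simp
  moreover have "?s4(rHit := [], rNe := []) = ?s5"
    using emptys by (simp add: fun_eq_iff)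
  ultimately have 6: "exec_le (clear rNe) (?s4(rHit := [])) (4 * (2 * Z) + 1) ?s5"
    by simp
  let ?s6 = "?s5(rOut := enc [j, ?w', j * n + v] @ ?s5 rOut)"
  have 7: "exec_le (emit rJ rBj rV) ?s5 (36 * Z + 11) ?s6"
    by (rule exec_le_emit) (use ij uv out le w emptys in auto)
  have 8: "exec_le (Seq (Push rW True) (Push rV True)) ?s6 (1 + 1)
      (?s6(rW := unary (Suc ?w'), rV := unary (Suc v)))"
    using exec_le_Seq[OF exec_le_Push[of rW True ?s6] exec_le_Push[of rV True]] uv by simp
  have "?s6(rW := unary (Suc ?w'), rV := unary (Suc v)) =
      put k (pair_gadgets (listed_adjacent (nats_from 0 (s rL))) n i j u v @ gs) (s(rV := unary (Suc v)))"
    using out by (auto simp: fun_eq_iff put_def pair_gadgets_def)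
  with 8 have 8: "exec_le (Seq (Push rW True) (Push rV True)) ?s6 (1 + 1)
      (put k (pair_gadgets (listed_adjacent (nats_from 0 (s rL))) n i j u v @ gs) (s(rV := unary (Suc v))))"
    by metis
  show ?thesis
    unfolding pair_step_def
    by (rule exec_le_mono,
        rule exec_le_Seq[OF 1 exec_le_Seq[OF 2 exec_le_Seq[OF 3 exec_le_Seq[OF 4 exec_le_Seq[OF 5
            exec_le_Seq[OF 6 exec_le_Seq[OF 7 8]]]]]]])
      (simp add: algebra_simps)
qed

definition v_loop :: prog where
  "v_loop = Seq (for_unary rN cV pair_step) (clear rV)"

abbreviation pair_time :: "nat \<Rightarrow> nat" where
  "pair_time Z \<equiv> 132 * (Z * Z) + 200 * Z + 100"

abbreviation loop_time :: "nat \<Rightarrow> nat \<Rightarrow> nat" where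
  "loop_time Z T \<equiv> 13 * Z + 4 + Z * (T + 3)"

text \<open>The index \<open>r\<close> is reset afterwards, so that the enclosing loop can start
  this one again.\<close>

lemma exec_le_loop:
  assumes "exec_le (for_unary i c p) s (9 * Z + 3 + Z * (T + 3)) (s'(r := unary n))" "n \<le> Z" "s' r = []"
  shows "exec_le (Seq (for_unary i c p) (clear r)) s (loop_time Z T) s'"
proof -
  have "exec_le (clear r) (s'(r := unary n)) (4 * Z + 1) s'"
    using exec_le_clear[of "s'(r := unary n)" r Z] assms(2,3) by (simp add: fun_upd_idem)
  from exec_le_Seq[OF assms(1) this] show ?thesis
    by (rule exec_le_mono) simp
qed

lemma length_pair_gadgets: "length (pair_gadgets adj n i j u v) \<le> 2"
  by (simp add: pair_gadgets_def)

lemma length_downfrom: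
  assumes "\<And>i. i < m \<Longrightarrow> length (f i) \<le> b"
  shows "length (downfrom m f) \<le> m * b"
  using assms
proof (induction m)
  case (Suc m)
  from Suc.prems[of m] Suc.IH Suc.prems show ?case
    by (simp add: add_mono)
qed simp

text \<open>The part of the invariant common to all loops; index stacks are left out because each
  loop changes its own.\<close>

definition holds_gadgets :: "nat \<Rightarrow> nat \<Rightarrow> bool list \<Rightarrow> store \<Rightarrow> gadget list \<Rightarrow> bool" where
  "holds_gadgets k n L s gs \<longleftrightarrow> scratch_empty s \<and> s rN = unary n \<and> s rL = L \<and> s rOut = enc (flat (gadget_entries k gs)) \<and>
     s rW = unary (k + length gs)"

lemma base_simps:
  "holds_gadgets k n L s gs \<Longrightarrow> s rN = unary n" "holds_gadgets k n L s gs \<Longrightarrow> s rL = L" "holds_gadgets k n L s gs \<Longrightarrow> s rT = []"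
  by (simp_all add: holds_gadgets_def scratch_empty_def)

lemma base_put: "holds_gadgets k n L s gs \<Longrightarrow> holds_gadgets k n L (put k gs' s) gs'"
  by (simp add: holds_gadgets_def put_def scratch_empty_def)

lemma base_upd:
  "holds_gadgets k n L s gs \<Longrightarrow> i \<notin> {rOut, rN, rL, rW, rNum, rPh, rT, rX, rY, rD, rHit, rNe, rFst, rScan} \<Longrightarrow>
   holds_gadgets k n L (s(i := x)) gs"
  by (auto simp add: holds_gadgets_def scratch_empty_def)

lemma put_base: "holds_gadgets k n L s gs \<Longrightarrow> put k gs s = s"
  by (simp add: holds_gadgets_def put_def fun_upd_idem)

lemma put_apply: "i \<notin> {rOut, rW} \<Longrightarrow> put k gs s i = s i"
  by (simp add: put_def)

context
  fixes Z k n :: nat and L :: "bool list"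
  assumes bounds: "length L \<le> Z" "n \<le> Z"
begin

abbreviation "adjL \<equiv> listed_adjacent (nats_from 0 L)"

abbreviation "base \<equiv> holds_gadgets k n L"

abbreviation "v_gadgets i j u m \<equiv> downfrom m (pair_gadgets adjL n i j u)"
abbreviation "u_gadgets i j m \<equiv> downfrom m (\<lambda>u. v_gadgets i j u n)"

text \<open>Every edge written copies the vertex counter, so the number of gadgets enters the time
  bounds and has to be kept within \<open>Z\<close>.\<close>

lemma length_v_gadgets: "length (v_gadgets i j u m) \<le> m * 2"
  by (intro length_downfrom length_pair_gadgets)

lemma length_u_gadgets: "length (u_gadgets i j m) \<le> m * (n * 2)"
  by (intro length_downfrom length_v_gadgets)

lemma exec_le_v_loop:
  assumes s: "base s gs" "s rI = unary i" "s rJ = unary j" "s rBi = unary (i * n)"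
      "s rBj = unary (j * n)" "s rU = unary u" "s rV = []" "s cV = []"
    and le: "i \<le> Z" "j \<le> Z" "u \<le> Z" "i * n \<le> Z" "j * n \<le> Z" "k + length gs + n * 2 \<le> Z"
  shows "exec_le v_loop s (loop_time Z (pair_time Z)) (put k (v_gadgets i j u n @ gs) s)"
  unfolding v_loop_def
proof (rule exec_le_loop)
  let ?S = "\<lambda>m. (put k (v_gadgets i j u m @ gs) s)(rV := unary m)"
  show "exec_le (for_unary rN cV pair_step) s (9 * Z + 3 + Z * (pair_time Z + 3)) (?S n)"
  proof (rule exec_le_for_unary[where S = ?S])
    fix m assume "m < n"
    let ?s = "(?S m)(cV := unary (n - Suc m))"
    have base: "base ?s (v_gadgets i j u m @ gs)"
      by (intro base_upd base_put[OF s(1)]) simp_all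
    \<comment> \<open>A further round adds up to two gadgets; the room reserved for them gives the
      strict bound that \<open>pair_step\<close> requires.\<close>
    have "m * 2 + 2 \<le> n * 2"
      using \<open>m < n\<close> by simp
    then have "k + length (v_gadgets i j u m @ gs) < Z"
      using le(6) length_v_gadgets[of m i j u] by simp
    then have "exec_le pair_step ?s (pair_time Z)
        (put k (pair_gadgets (listed_adjacent (nats_from 0 (?s rL))) n i j u m @ v_gadgets i j u m @ gs)
          (?s(rV := unary (Suc m))))"
      using base s le bounds \<open>m < n\<close>
      by (intro exec_le_pair_step) (simp_all add: holds_gadgets_def put_apply)
    moreover have "?s rL = L"
      using base by (rule base_simps)
    moreover have "put k gs' (?s(rV := x)) = ((put k gs' s)(rV := x))(cV := unary (n - Suc m))" for gs' x
      by (simp add: put_def fun_eq_iff)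
    ultimately show "exec_le pair_step ?s (pair_time Z) ((?S (Suc m))(cV := unary (n - Suc m)))"
      by simp
  qed (use s bounds in \<open>simp_all add: base_simps put_base put_apply fun_upd_idem\<close>)
qed (use s bounds in \<open>simp_all add: put_apply\<close>)

definition u_loop :: prog where
  "u_loop = Seq (for_unary rN cU (Seq v_loop (Push rU True))) (clear rU)"

abbreviation "u_time \<equiv> loop_time Z (pair_time Z) + 1"

lemma exec_le_u_loop:
  assumes s: "base s gs" "s rI = unary i" "s rJ = unary j" "s rBi = unary (i * n)"
      "s rBj = unary (j * n)" "s rU = []" "s rV = []" "s cV = []" "s cU = []"
    and le: "i \<le> Z" "j \<le> Z" "i * n \<le> Z" "j * n \<le> Z" "k + length gs + n * (n * 2) \<le> Z"
  shows "exec_le u_loop s (loop_time Z u_time) (put k (u_gadgets i j n @ gs) s)"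
  unfolding u_loop_def
proof (rule exec_le_loop)
  let ?S = "\<lambda>m. (put k (u_gadgets i j m @ gs) s)(rU := unary m)"
  show "exec_le (for_unary rN cU (Seq v_loop (Push rU True))) s (9 * Z + 3 + Z * (u_time + 3)) (?S n)"
  proof (rule exec_le_for_unary[where S = ?S])
    fix m assume "m < n"
    let ?s = "(?S m)(cU := unary (n - Suc m))"
    let ?gs = "v_gadgets i j m n @ u_gadgets i j m @ gs"
    have base: "base ?s (u_gadgets i j m @ gs)"
      by (intro base_upd base_put[OF s(1)]) simp_all
    have "Suc m * (n * 2) \<le> n * (n * 2)"
      using \<open>m < n\<close> by (intro mult_le_mono1) simp
    then have "k + length (u_gadgets i j m @ gs) + n * 2 \<le> Z"
      using le(5) length_u_gadgets[of m i j] by simp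
    then have "exec_le v_loop ?s (loop_time Z (pair_time Z)) (put k ?gs ?s)"
      using base s le bounds \<open>m < n\<close>
      by (intro exec_le_v_loop) (simp_all add: put_apply)
    from exec_le_Seq[OF this exec_le_Push]
    have "exec_le (Seq v_loop (Push rU True)) ?s u_time ((put k ?gs ?s)(rU := True # put k ?gs ?s rU))" .
    moreover have "(put k ?gs ?s)(rU := True # put k ?gs ?s rU) = (?S (Suc m))(cU := unary (n - Suc m))"
      by (simp add: put_def fun_eq_iff)
    ultimately show "exec_le (Seq v_loop (Push rU True)) ?s u_time ((?S (Suc m))(cU := unary (n - Suc m)))"
      by simp
  qed (use s bounds in \<open>simp_all add: base_simps put_base put_apply fun_upd_idem\<close>)
qed (use s bounds in \<open>simp_all add: put_apply\<close>)

text \<open>The two copies of \<open>n\<close> onto \<open>rTgt\<close> are the \<open>2 * n\<close>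
  that the pair \<open>i, j\<close> adds to the target; the last copy advances the offset
  \<open>j * n\<close> by \<open>n\<close>.\<close>

definition j_body :: prog where
  "j_body = Seq (copy rN rTgt rT) (Seq (copy rN rTgt rT) (Seq u_loop (Seq (Push rJ True) (copy rN rBj rT))))"

definition j_loop :: prog where
  "j_loop = Seq (for_unary rI cJ j_body) (Seq (clear rJ) (clear rBj))"

abbreviation "j_time \<equiv> 9 * Z + 2 + (9 * Z + 2 + (loop_time Z u_time + (1 + (9 * Z + 2))))"

abbreviation "j_gadgets i m \<equiv> downfrom m (\<lambda>j. u_gadgets i j n)"

lemma length_j_gadgets: "length (j_gadgets i m) \<le> m * (n * (n * 2))"
  by (intro length_downfrom length_u_gadgets)

lemma exec_le_j_loop:
  assumes s: "base s gs" "s rI = unary i" "s rBi = unary (i * n)" "s rTgt = unary t"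
      "s rJ = []" "s rBj = []" "s rU = []" "s rV = []" "s cV = []" "s cU = []" "s cJ = []"
    and le: "i \<le> Z" "i * n \<le> Z" "k + length gs + i * (n * (n * 2)) \<le> Z"
  shows "exec_le j_loop s (loop_time Z j_time + 4 * Z + 1)
    (put k (j_gadgets i i @ gs) (s(rTgt := unary (t + i * (2 * n)))))"
proof -
  let ?S = "\<lambda>m. (put k (j_gadgets i m @ gs)
    (s(rTgt := unary (t + m * (2 * n)), rJ := unary m, rBj := unary (m * n))))"
  have 1: "exec_le (for_unary rI cJ j_body) s (9 * Z + 3 + Z * (j_time + 3)) (?S i)"
  proof (rule exec_le_for_unary[where S = ?S])
    fix m assume "m < i"
    let ?s = "(?S m)(cJ := unary (i - Suc m))"
    let ?s1 = "?s(rTgt := unary (t + m * (2 * n) + n))"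
    let ?s2 = "?s(rTgt := unary (t + m * (2 * n) + n + n))"
    let ?gs = "u_gadgets i m n @ j_gadgets i m @ gs"
    let ?s3 = "put k ?gs ?s2"
    let ?s4 = "?s3(rJ := unary (Suc m))"
    have base: "base ?s (j_gadgets i m @ gs)"
      by (intro base_upd base_put[where gs = gs] s(1)) simp_all
    have mi: "Suc m * n \<le> i * n"
      using \<open>m < i\<close> by (intro mult_le_mono1) simp
    have "Suc m * (n * (n * 2)) \<le> i * (n * (n * 2))"
      using \<open>m < i\<close> by (intro mult_le_mono1) simp
    then have len: "k + length (j_gadgets i m @ gs) + n * (n * 2) \<le> Z"
      using le(3) length_j_gadgets[of m i] by simp
    have 1: "exec_le (copy rN rTgt rT) ?s (9 * Z + 2) ?s1"
      using exec_le_copy_unary[of rN rTgt rT ?s n Z] base_simps[OF base] bounds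
      by (simp add: put_apply replicate_add[symmetric] ac_simps)
    have base1: "base ?s1 (j_gadgets i m @ gs)"
      by (intro base_upd[OF base]) simp
    have 2: "exec_le (copy rN rTgt rT) ?s1 (9 * Z + 2) ?s2"
      using exec_le_copy_unary[of rN rTgt rT ?s1 n Z] base_simps[OF base1] bounds
      by (simp add: put_apply replicate_add[symmetric] ac_simps)
    have base2: "base ?s2 (j_gadgets i m @ gs)"
      by (intro base_upd[OF base]) simp
    have 3: "exec_le u_loop ?s2 (loop_time Z u_time) ?s3"
      using s le len mi \<open>m < i\<close>
      by (intro exec_le_u_loop base2) (simp_all add: put_apply)
    have 4: "exec_le (Push rJ True) ?s3 1 ?s4"
      using exec_le_Push[of rJ True ?s3] by (simp add: put_apply)
    have base4: "base ?s4 ?gs"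
      by (intro base_upd base_put[OF base2]) simp
    have "exec_le (copy rN rBj rT) ?s4 (9 * Z + 2) (?s4(rBj := unary n @ ?s4 rBj))"
      by (intro exec_le_copy_unary base_simps[OF base4] bounds) simp_all
    moreover have "?s4(rBj := unary n @ ?s4 rBj) = (?S (Suc m))(cJ := unary (i - Suc m))"
      by (auto simp: put_def fun_eq_iff replicate_add[symmetric] ac_simps)
    ultimately have 5: "exec_le (copy rN rBj rT) ?s4 (9 * Z + 2) ((?S (Suc m))(cJ := unary (i - Suc m)))"
      by simp
    show "exec_le j_body ?s j_time ((?S (Suc m))(cJ := unary (i - Suc m)))"
      unfolding j_body_def
      by (rule exec_le_Seq[OF 1 exec_le_Seq[OF 2 exec_le_Seq[OF 3 exec_le_Seq[OF 4 5]]]])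
  qed (use s le bounds in \<open>simp_all add: base_simps put_base put_apply fun_upd_idem\<close>)
  have 2: "exec_le (clear rJ) (?S i) (4 * Z + 1) ((?S i)(rJ := []))"
    by (rule exec_le_clear) (use le in \<open>simp add: put_apply\<close>)
  have "exec_le (clear rBj) ((?S i)(rJ := [])) (4 * Z + 1) ((?S i)(rJ := [], rBj := []))"
    by (rule exec_le_clear) (use le in \<open>simp add: put_apply\<close>)
  moreover have "(?S i)(rJ := [], rBj := []) = put k (j_gadgets i i @ gs) (s(rTgt := unary (t + i * (2 * n))))"
    using s by (simp add: put_def fun_eq_iff)
  ultimately have 3: "exec_le (clear rBj) ((?S i)(rJ := [])) (4 * Z + 1)
      (put k (j_gadgets i i @ gs) (s(rTgt := unary (t + i * (2 * n)))))"
    by simp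
  show ?thesis
    unfolding j_loop_def
    by (rule exec_le_mono, rule exec_le_Seq[OF 1 exec_le_Seq[OF 2 3]]) simp
qed

definition p_body :: prog where
  "p_body = Seq (emit rI rBi rU) (Seq (Push rW True) (Push rU True))"

definition p_loop :: prog where
  "p_loop = Seq (for_unary rN cU p_body) (clear rU)"

abbreviation "p_time \<equiv> 36 * Z + 11 + (1 + 1)"

abbreviation "p_gadgets i m \<equiv> downfrom m (\<lambda>u. [[(i, i * n + u)]])"

lemma length_p_gadgets: "length (p_gadgets i m) \<le> m * 1"
  by (intro length_downfrom) simp

lemma exec_le_p_loop:
  assumes s: "base s gs" "s rI = unary i" "s rBi = unary (i * n)" "s rU = []" "s cU = []"
    and le: "i \<le> Z" "i * n \<le> Z" "k + length gs + n \<le> Z"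
  shows "exec_le p_loop s (loop_time Z p_time) (put k (p_gadgets i n @ gs) s)"
  unfolding p_loop_def
proof (rule exec_le_loop)
  let ?S = "\<lambda>m. (put k (p_gadgets i m @ gs) s)(rU := unary m)"
  show "exec_le (for_unary rN cU p_body) s (9 * Z + 3 + Z * (p_time + 3)) (?S n)"
  proof (rule exec_le_for_unary[where S = ?S])
    fix m assume "m < n"
    let ?s = "(?S m)(cU := unary (n - Suc m))"
    let ?w = "k + length (p_gadgets i m @ gs)"
    let ?s1 = "?s(rOut := enc [i, ?w, i * n + m] @ ?s rOut)"
    have base: "base ?s (p_gadgets i m @ gs)"
      by (intro base_upd base_put[OF s(1)]) simp_all
    have w: "?w \<le> Z"
      using le(3) length_p_gadgets[of m i] \<open>m < n\<close> by simp
    have 1: "exec_le (emit rI rBi rU) ?s (36 * Z + 11) ?s1"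
      by (rule exec_le_emit)
        (use base s le w bounds \<open>m < n\<close> in \<open>simp_all add: base_simps put_apply, simp_all add: put_def\<close>)
    have 2: "exec_le (Seq (Push rW True) (Push rU True)) ?s1 (1 + 1)
        (?s1(rW := True # ?s1 rW, rU := True # ?s1 rU))"
      using exec_le_Seq[OF exec_le_Push[of rW True ?s1] exec_le_Push[of rU True]] by simp
    have "?s1(rW := True # ?s1 rW, rU := True # ?s1 rU) = (?S (Suc m))(cU := unary (n - Suc m))"
      by (simp add: put_def fun_eq_iff)
    with exec_le_Seq[OF 1 2]
    show "exec_le p_body ?s p_time ((?S (Suc m))(cU := unary (n - Suc m)))"
      unfolding p_body_def by simp
  qed (use s bounds in \<open>simp_all add: base_simps put_base put_apply fun_upd_idem\<close>)
qed (use s bounds in \<open>simp_all add: put_apply\<close>)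

text \<open>The push onto \<open>rTgt\<close> is the summand 1 of \<open>target\<close>. The
  pendants are written before the pairs because \<open>selector_gadgets\<close> has them at its
  end.\<close>

definition i_body :: prog where
  "i_body = Seq (Push rTgt True) (Seq p_loop (Seq j_loop (Seq (Push rI True) (copy rN rBi rT))))"

abbreviation "i_time \<equiv> 1 + (loop_time Z p_time + (loop_time Z j_time + 4 * Z + 1 + (1 + (9 * Z + 2))))"

lemma length_selector_gadgets: "length (selector_gadgets adjL n i) \<le> i * (n * (n * 2)) + n"
  unfolding selector_gadgets_def using length_j_gadgets[of i i] length_p_gadgets[of n i] by simp

lemma length_all_gadgets:
  assumes "m \<le> k"
  shows "length (all_gadgets adjL n m) \<le> m * (k * (n * (n * 2)) + n)"
  unfolding all_gadgets_def
proof (rule length_downfrom)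
  fix i assume "i < m"
  then have "i * (n * (n * 2)) \<le> k * (n * (n * 2))"
    using assms by (intro mult_le_mono1) simp
  then show "length (selector_gadgets adjL n i) \<le> k * (n * (n * 2)) + n"
    using length_selector_gadgets[of i] by linarith
qed

lemma exec_le_i_loop:
  assumes s: "base s []" "s rK = unary k" "\<And>i. i \<in> {rI, rBi, rTgt, rJ, rBj, rU, rV, cV, cU, cJ, cI} \<Longrightarrow> s i = []"
    and le: "k \<le> Z" "k * n \<le> Z" "k + k * (k * (n * (n * 2)) + n) \<le> Z"
  shows "exec_le (for_unary rK cI i_body) s (9 * Z + 3 + Z * (i_time + 3))
    (put k (all_gadgets adjL n k)
      (s(rTgt := unary (target n k), rI := unary k, rBi := unary (k * n))))"
proof -
  let ?S = "\<lambda>m. put k (all_gadgets adjL n m)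
      (s(rTgt := unary (target n m), rI := unary m, rBi := unary (m * n)))"
  show ?thesis
  proof (rule exec_le_for_unary[where S = ?S])
    fix m assume "m < k"
    let ?s = "(?S m)(cI := unary (k - Suc m))"
    let ?s1 = "?s(rTgt := unary (Suc (target n m)))"
    let ?gs = "all_gadgets adjL n m"
    let ?gs2 = "p_gadgets m n @ ?gs"
    let ?s2 = "put k ?gs2 ?s1"
    let ?gs3 = "j_gadgets m m @ ?gs2"
    let ?s3 = "put k ?gs3 (?s2(rTgt := unary (Suc (target n m) + m * (2 * n))))"
    let ?s4 = "?s3(rI := unary (Suc m))"
    have mn: "m * n \<le> Z"
      using le(2) mult_le_mono1[of m k n] \<open>m < k\<close> by linarith
    have mk: "m * (n * (n * 2)) \<le> k * (n * (n * 2))"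
      using \<open>m < k\<close> by (intro mult_le_mono1) simp
    have "Suc m * (k * (n * (n * 2)) + n) \<le> k * (k * (n * (n * 2)) + n)"
      using \<open>m < k\<close> by (intro mult_le_mono1) simp
    then have len: "k + length ?gs + (k * (n * (n * 2)) + n) \<le> Z"
      using length_all_gadgets[of m] \<open>m < k\<close> le(3) by simp
    have base1: "base ?s1 ?gs"
      by (intro base_upd base_put[where gs = "[]"] s(1)) simp_all
    have 1: "exec_le (Push rTgt True) ?s 1 ?s1"
      using exec_le_Push[of rTgt True ?s] by (simp add: put_apply)
    have 2: "exec_le p_loop ?s1 (loop_time Z p_time) ?s2"
      by (intro exec_le_p_loop base1) (use s le mn len \<open>m < k\<close> in \<open>simp_all add: put_apply\<close>)
    have base2: "base ?s2 ?gs2"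
      by (rule base_put[OF base1])
    have len2: "k + length ?gs2 + m * (n * (n * 2)) \<le> Z"
      using len mk length_p_gadgets[of n m] unfolding length_append by linarith
    have 3: "exec_le j_loop ?s2 (loop_time Z j_time + 4 * Z + 1) ?s3"
      by (intro exec_le_j_loop base2) (use s le mn len2 \<open>m < k\<close> in \<open>simp_all add: put_apply\<close>)
    have 4: "exec_le (Push rI True) ?s3 1 ?s4"
      using exec_le_Push[of rI True ?s3] by (simp add: put_apply)
    have base4: "base ?s4 ?gs3"
      by (intro base_upd base_put[where gs = ?gs2] base2) simp_all
    have "exec_le (copy rN rBi rT) ?s4 (9 * Z + 2) (?s4(rBi := unary n @ ?s4 rBi))"
      by (intro exec_le_copy_unary base_simps[OF base4] bounds) simp_all
    moreover have "?s4(rBi := unary n @ ?s4 rBi) = (?S (Suc m))(cI := unary (k - Suc m))"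
      by (auto simp: put_def fun_eq_iff replicate_add[symmetric] ac_simps
          all_gadgets_def selector_gadgets_def target_def)
    ultimately have 5: "exec_le (copy rN rBi rT) ?s4 (9 * Z + 2) ((?S (Suc m))(cI := unary (k - Suc m)))"
      by simp
    show "exec_le i_body ?s i_time ((?S (Suc m))(cI := unary (k - Suc m)))"
      unfolding i_body_def
      by (rule exec_le_Seq[OF 1 exec_le_Seq[OF 2 exec_le_Seq[OF 3 exec_le_Seq[OF 4 5]]]])
  qed (use s le in \<open>simp_all add: base_simps put_base put_apply fun_upd_idem all_gadgets_def target_def\<close>)
qed

end

section \<open>Parsing the input\<close>

definition parse_step ::
    "nat \<times> nat \<times> nat \<times> bool list \<times> bool list \<Rightarrow> bool \<Rightarrow> nat \<times> nat \<times> nat \<times> bool list \<times> bool list" where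
  "parse_step = (\<lambda>(n, a, k, ph, l) x. case ph of
     [] \<Rightarrow> if x then (Suc n, a, k, ph, l) else (n, a, k, False # ph, l)
   | False # _ \<Rightarrow> if x then (n, Suc a, k, ph, l) else (n, 0, a + k, True # ph, l)
   | True # _ \<Rightarrow> (n, a, k, ph, x # l))"

lemma parse_step_simps [simp]:
  "parse_step (n, a, k, [], l) True = (Suc n, a, k, [], l)"
  "parse_step (n, a, k, [], l) False = (n, a, k, [False], l)"
  "parse_step (n, a, k, False # ph, l) True = (n, Suc a, k, False # ph, l)"
  "parse_step (n, a, k, False # ph, l) False = (n, 0, a + k, True # False # ph, l)"
  "parse_step (n, a, k, True # ph, l) x = (n, a, k, True # ph, x # l)"
  by (simp_all add: parse_step_def)

lemma parse_step_bounds: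
  assumes "parse_step (n, a, k, ph, l) x = (n', a', k', ph', l')"
  shows "n' + a' + k' + length l' \<le> Suc (n + a + k + length l)" "length ph' \<le> Suc (length ph)"
proof -
  consider "ph = []" x | "ph = []" "\<not> x" | r where "ph = False # r" x | r where "ph = False # r" "\<not> x"
    | r where "ph = True # r"
    by (metis (full_types) list.exhaust)
  then have "n' + a' + k' + length l' \<le> Suc (n + a + k + length l) \<and> length ph' \<le> Suc (length ph)"
    using assms by cases auto
  then show "n' + a' + k' + length l' \<le> Suc (n + a + k + length l)" "length ph' \<le> Suc (length ph)"
    by simp_all
qed

definition parse_result :: "bool list \<Rightarrow> nat \<times> nat \<times> nat \<times> bool list \<times> bool list" where
  "parse_result xs = foldl parse_step (0, 0, 0, [], []) xs"

lemma parse_result_snoc: "parse_result (xs @ [x]) = parse_step (parse_result xs) x"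
  by (simp add: parse_result_def)

lemma parse_result_bounds:
  "parse_result xs = (n, a, k, ph, l) \<Longrightarrow> n + a + k + length l \<le> length xs \<and> length ph \<le> length xs"
proof (induction xs arbitrary: n a k ph l rule: rev_induct)
  case Nil
  then show ?case by (simp add: parse_result_def)
next
  case (snoc x xs)
  obtain n' a' k' ph' l' where *: "parse_result xs = (n', a', k', ph', l')"
    by (rule prod_cases5[of "parse_result xs"])
  have "parse_step (n', a', k', ph', l') x = (n, a, k, ph, l)"
    using snoc.prems by (simp only: parse_result_snoc *)
  from parse_step_bounds[OF this] snoc.IH[OF *] show ?case
    by simp
qed

lemma foldl_parse_step_rest: "foldl parse_step (n, a, k, True # ph, l) xs = (n, a, k, True # ph, rev xs @ l)"
  by (induction xs arbitrary: l) simp_all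

lemma foldl_parse_step_second:
  "foldl parse_step (n, a, 0, [False], []) xs = (n', a', k', ph', l') \<Longrightarrow>
   n' = n \<and> (case nats_from a xs of [] \<Rightarrow> k' = 0 | k # r \<Rightarrow> k' = k \<and> nats_from 0 (rev l') = r)"
proof (induction xs arbitrary: a)
  case (Cons x xs)
  show ?case
  proof (cases x)
    case True
    with Cons show ?thesis by simp
  next
    case False
    with Cons.prems show ?thesis by (auto simp: foldl_parse_step_rest)
  qed
qed simp

lemma foldl_parse_step_first:
  "foldl parse_step (n, 0, 0, [], []) xs = (n', a', k', ph', l') \<Longrightarrow>
   (case nats_from n xs of n0 # k # r \<Rightarrow> n' = n0 \<and> k' = k \<and> nats_from 0 (rev l') = r | _ \<Rightarrow> k' = 0)"
proof (induction xs arbitrary: n)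
  case (Cons x xs)
  show ?case
  proof (cases x)
    case True
    with Cons show ?thesis by simp
  next
    case False
    with Cons.prems have "foldl parse_step (n, 0, 0, [False], []) xs = (n', a', k', ph', l')"
      by simp
    from foldl_parse_step_second[OF this] False show ?thesis
      by (simp split: list.splits)
  qed
qed simp

text \<open>If the header is incomplete, \<open>instance_of\<close> falls back to zeros while the
  parser may have read a number of vertices. It has not stored a clique size, however, so
  \<open>k\<close> is 0 on both sides.\<close>

lemma parse_result_instance:
  assumes "parse_result x = (n, a, k, ph, l)"
  shows "k = 0 \<and> inst_k x = 0 \<or> instance_of x = (n, k, nats_from 0 (rev l))"
  using foldl_parse_step_first[OF assms[unfolded parse_result_def]]
  by (auto simp: instance_of_def inst_k_def split: list.splits)

text \<open>\<open>rPh\<close> encodes the phase: empty while \<open>n\<close> is read, top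
  \<open>False\<close> while \<open>k\<close> is read, top \<open>True\<close> while the edge list
  is copied. The list arrives in \<open>rScan\<close> reversed, and the closing \<open>move\<close>
  restores its order.\<close>

definition parse :: prog where
  "parse = Seq (each_bit rOut
      (Branch rPh (Push rPh False) (Seq (move rNum rK) (Push rPh True)) (Push rScan False))
      (Branch rPh (Push rN True) (Push rNum True) (Push rScan True)))
    (Seq (move rScan rL) (Seq (clear rNum) (clear rPh)))"

definition parse_store :: "store \<Rightarrow> nat \<times> nat \<times> nat \<times> bool list \<times> bool list \<Rightarrow> store" where
  "parse_store s st = (case st of (n, a, k, ph, l) \<Rightarrow>
     s(rN := unary n, rNum := unary a, rK := unary k, rPh := ph, rScan := l))"

lemma exec_le_parse_step:
  assumes st: "st = (n, a, k, ph, l)" and "a \<le> Z"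
  shows "exec_le (if x then Branch rPh (Push rN True) (Push rNum True) (Push rScan True)
      else Branch rPh (Push rPh False) (Seq (move rNum rK) (Push rPh True)) (Push rScan False))
    (parse_store s st) (4 * Z + 3) (parse_store s (parse_step st x))"
proof (cases x)
  case True
  let ?s = "parse_store s st"
  have "exec_le (Branch rPh (Push rN True) (Push rNum True) (Push rScan True)) ?s (1 + 1)
      (parse_store s (parse_step st True))"
  proof (rule exec_le_Branch)
    assume "?s rPh = []"
    then have "?s(rN := True # ?s rN) = parse_store s (parse_step st True)"
      by (simp add: parse_store_def st fun_eq_iff)
    with exec_le_Push[of rN True ?s] show "exec_le (Push rN True) ?s 1 (parse_store s (parse_step st True))"
      by simp
  next
    fix xs assume "?s rPh = False # xs"
    then have "?s(rNum := True # ?s rNum) = parse_store s (parse_step st True)"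
      by (simp add: parse_store_def st fun_eq_iff)
    with exec_le_Push[of rNum True ?s] show "exec_le (Push rNum True) ?s 1 (parse_store s (parse_step st True))"
      by simp
  next
    fix xs assume "?s rPh = True # xs"
    then have "?s(rScan := True # ?s rScan) = parse_store s (parse_step st True)"
      by (simp add: parse_store_def st fun_eq_iff)
    with exec_le_Push[of rScan True ?s] show "exec_le (Push rScan True) ?s 1 (parse_store s (parse_step st True))"
      by simp
  qed
  then show ?thesis
    using True by (auto elim!: exec_le_mono)
next
  case False
  let ?s = "parse_store s st"
  have "exec_le (Branch rPh (Push rPh False) (Seq (move rNum rK) (Push rPh True)) (Push rScan False)) ?s
      (4 * Z + 1 + 1 + 1) (parse_store s (parse_step st False))"
  proof (rule exec_le_Branch)
    assume "?s rPh = []"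
    then have "?s(rPh := False # ?s rPh) = parse_store s (parse_step st False)"
      by (simp add: parse_store_def st fun_eq_iff)
    with exec_le_Push[of rPh False ?s]
    have "exec_le (Push rPh False) ?s 1 (parse_store s (parse_step st False))"
      by simp
    then show "exec_le (Push rPh False) ?s (4 * Z + 1 + 1) (parse_store s (parse_step st False))"
      by (rule exec_le_mono) simp
  next
    fix xs assume "?s rPh = True # xs"
    then have "?s(rScan := False # ?s rScan) = parse_store s (parse_step st False)"
      by (simp add: parse_store_def st fun_eq_iff)
    with exec_le_Push[of rScan False ?s]
    have "exec_le (Push rScan False) ?s 1 (parse_store s (parse_step st False))"
      by simp
    then show "exec_le (Push rScan False) ?s (4 * Z + 1 + 1) (parse_store s (parse_step st False))"
      by (rule exec_le_mono) simp
  next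
    fix xs assume ph: "?s rPh = False # xs"
    let ?t = "?s(rNum := [], rK := unary (a + k))"
    have "exec_le (move rNum rK) ?s (4 * Z + 1) ?t"
      using exec_le_move[of rNum rK ?s Z] assms by (simp add: parse_store_def replicate_add)
    from exec_le_Seq[OF this exec_le_Push]
    have "exec_le (Seq (move rNum rK) (Push rPh True)) ?s (4 * Z + 1 + 1) (?t(rPh := True # ?t rPh))" .
    moreover have "?t(rPh := True # ?t rPh) = parse_store s (parse_step st False)"
      using ph by (simp add: parse_store_def st fun_eq_iff)
    ultimately show "exec_le (Seq (move rNum rK) (Push rPh True)) ?s (4 * Z + 1 + 1)
        (parse_store s (parse_step st False))"
      by simp
  qed
  then show ?thesis
    using False by (simp add: numeral_3_eq_3)
qed

lemma exec_le_parse: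
  assumes res: "parse_result x = (n, a, k, ph, l)" and "length x \<le> Z"
  shows "exec_le parse (init_store x) (Z * (4 * Z + 6) + 1 + (12 * Z + 3))
    ((\<lambda>_. [])(rN := unary n, rK := unary k, rL := rev l))"
proof -
  let ?e = "(\<lambda>_. []) :: store"
  let ?S = "\<lambda>ys. parse_store ?e (parse_result ys)"
  have "exec_le (each_bit rOut
      (Branch rPh (Push rPh False) (Seq (move rNum rK) (Push rPh True)) (Push rScan False))
      (Branch rPh (Push rN True) (Push rNum True) (Push rScan True)))
    (init_store x) (length x * (4 * Z + 3 + 3) + 1) ((?S x)(rOut := []))"
  proof (rule exec_le_each_bit[where S = ?S])
    fix ys b zs assume eq: "x = ys @ b # zs"
    obtain n' a' k' ph' l' where *: "parse_result ys = (n', a', k', ph', l')"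
      by (rule prod_cases5[of "parse_result ys"])
    have "a' \<le> Z"
      using parse_result_bounds[OF *] assms(2) eq by simp
    moreover have "(parse_store ?e st)(rOut := zs) = parse_store (?e(rOut := zs)) st" for st
      by (simp add: parse_store_def fun_eq_iff split: prod.splits)
    ultimately show "exec_le (if b then Branch rPh (Push rN True) (Push rNum True) (Push rScan True)
        else Branch rPh (Push rPh False) (Seq (move rNum rK) (Push rPh True)) (Push rScan False))
      ((?S ys)(rOut := zs)) (4 * Z + 3) ((?S (ys @ [b]))(rOut := zs))"
      using exec_le_parse_step[OF *, of Z b "?e(rOut := zs)"] by (simp only: parse_result_snoc)
  qed (auto simp: parse_result_def parse_store_def init_store_def fun_eq_iff)
  moreover have "(?S x)(rOut := []) = ?S x"
    by (simp add: res parse_store_def fun_eq_iff)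
  ultimately have 1: "exec_le (each_bit rOut
      (Branch rPh (Push rPh False) (Seq (move rNum rK) (Push rPh True)) (Push rScan False))
      (Branch rPh (Push rN True) (Push rNum True) (Push rScan True)))
    (init_store x) (length x * (4 * Z + 3 + 3) + 1) (?S x)"
    by simp
  have le: "n + a + k + length l \<le> Z" "length ph \<le> Z"
    using parse_result_bounds[OF res] assms(2) by linarith+
  let ?s1 = "(?S x)(rScan := [], rL := rev l)"
  have 2: "exec_le (move rScan rL) (?S x) (4 * Z + 1) ?s1"
    using exec_le_move[of rScan rL "?S x" Z] le by (simp add: res parse_store_def)
  have 3: "exec_le (clear rNum) ?s1 (4 * Z + 1) (?s1(rNum := []))"
    by (rule exec_le_clear) (use le in \<open>simp add: res parse_store_def\<close>)
  have "exec_le (clear rPh) (?s1(rNum := [])) (4 * Z + 1) (?s1(rNum := [], rPh := []))"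
    by (rule exec_le_clear) (use le in \<open>simp add: res parse_store_def\<close>)
  moreover have "?s1(rNum := [], rPh := []) = ?e(rN := unary n, rK := unary k, rL := rev l)"
    by (simp add: res parse_store_def fun_eq_iff)
  ultimately have 4: "exec_le (clear rPh) (?s1(rNum := [])) (4 * Z + 1)
      (?e(rN := unary n, rK := unary k, rL := rev l))"
    by simp
  have "length x * (4 * Z + 3 + 3) \<le> Z * (4 * Z + 6)"
    using assms(2) by (intro mult_le_mono) simp_all
  then show ?thesis
    unfolding parse_def
    by (intro exec_le_mono[OF exec_le_Seq[OF 1 exec_le_Seq[OF 2 exec_le_Seq[OF 3 4]]]]) simp
qed

section \<open>The complete program and its polynomial running time\<close>

definition reduction_prog :: prog where
  "reduction_prog = Seq parse (Seq (copy rK rW rT) (Seq (for_unary rK cI i_body)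
     (Seq (Push rOut False) (Seq (copy rTgt rOut rT) (Seq (Push rOut False) (copy rW rOut rT))))))"

text \<open>The first two summands bound the vertex counter, the third the color offsets
  \<open>i * n\<close>, the last the target; the sum is a common bound \<open>Z\<close> for all
  these numbers.\<close>

definition loop_bound :: "nat \<Rightarrow> nat" where
  "loop_bound m = m + m * (m * (m * (m * 2)) + m) + m * m + m * (1 + m * (2 * m))"

definition reduction_time :: "nat \<Rightarrow> nat" where
  "reduction_time Z = Z * (4 * Z + 6) + 1 + (12 * Z + 3) + (9 * Z + 2 +
     (9 * Z + 3 + Z * (i_time Z + 3) + (1 + (9 * Z + 2 + (1 + (9 * Z + 2))))))"

lemma target_le: "target n k \<le> k * (1 + k * (2 * n))"
proof -
  have "1 + i * (2 * n) \<le> 1 + k * (2 * n)" if "i \<in> {..<k}" for i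
    using that by (intro add_left_mono mult_le_mono1) simp
  from sum_bounded_above[of "{..<k}" "\<lambda>i. 1 + i * (2 * n)", OF this] show ?thesis
    by (simp add: target_def)
qed

text \<open>With \<open>k = 0\<close> there are no gadgets and the target is 0, so an incomplete
  header leads to the same output whatever number of vertices the parser has read.\<close>

lemma reduction_eq:
  assumes "parse_result x = (n, a, k, ph, l)"
  shows "reduction x = (let gs = all_gadgets (listed_adjacent (nats_from 0 (rev l))) n k
     in enc ((k + length gs) # target n k # flat (gadget_entries k gs)))"
  using parse_result_instance[OF assms]
proof
  assume "k = 0 \<and> inst_k x = 0"
  moreover obtain n' k' r where "instance_of x = (n', k', r)"
    by (metis prod_cases3)
  ultimately show ?thesis
    by (simp add: reduction_def inst_k_def all_gadgets_def target_def)
qed (simp add: reduction_def)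

lemma exec_le_reduction_prog:
  "\<exists>s. exec_le reduction_prog (init_store x) (reduction_time (loop_bound (length x + 1))) s \<and>
     s rOut = reduction x"
proof -
  define m where "m = length x + 1"
  define Z where "Z = loop_bound m"
  obtain n a k ph l where res: "parse_result x = (n, a, k, ph, l)"
    by (rule prod_cases5[of "parse_result x"])
  have nk: "n \<le> m" "k \<le> m" and l: "length l \<le> m"
    using parse_result_bounds[OF res] by (auto simp: m_def)
  have "k + k * (k * (n * (n * 2)) + n) \<le> Z"
    unfolding Z_def loop_bound_def using nk
    by (intro trans_le_add1 add_mono mult_le_mono) auto
  moreover have "m * m \<le> Z" "m * (1 + m * (2 * m)) \<le> Z"
    unfolding Z_def loop_bound_def by (rule trans_le_add1, rule trans_le_add2, simp) (rule trans_le_add2, simp)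
  moreover have "k * n \<le> m * m"
    using nk by (intro mult_le_mono)
  moreover have "target n k \<le> m * (1 + m * (2 * m))"
    using nk by (intro order_trans[OF target_le] mult_le_mono add_mono) auto
  moreover have "m \<le> Z"
    by (simp add: Z_def loop_bound_def)
  ultimately have le: "k + k * (k * (n * (n * 2)) + n) \<le> Z" "k * n \<le> Z" "target n k \<le> Z"
      "n \<le> Z" "k \<le> Z" "length (rev l) \<le> Z" "length x \<le> Z"
    using nk l by (auto simp: m_def)
  define L where "L = rev l"
  let ?gs = "all_gadgets (listed_adjacent (nats_from 0 L)) n k"
  let ?w = "k + length ?gs"
  have "?w \<le> Z"
    using length_all_gadgets[of L Z n k k] le by (simp add: L_def)
  define s1 where "s1 = (\<lambda>_. [] :: bool list)(rN := unary n, rK := unary k, rL := L)"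
  define s2 where "s2 = s1(rW := unary k)"
  define s3 where "s3 = put k ?gs (s2(rTgt := unary (target n k), rI := unary k, rBi := unary (k * n)))"
  define s4 where "s4 = s3(rOut := False # s3 rOut)"
  define s5 where "s5 = s4(rOut := unary (target n k) @ s4 rOut)"
  define s6 where "s6 = s5(rOut := False # s5 rOut)"
  define s7 where "s7 = s6(rOut := unary ?w @ s6 rOut)"
  note defs = s1_def s2_def s3_def s4_def s5_def s6_def s7_def put_def
  have 1: "exec_le parse (init_store x) (Z * (4 * Z + 6) + 1 + (12 * Z + 3)) s1"
    unfolding s1_def L_def by (rule exec_le_parse[OF res le(7)])
  have "exec_le (copy rK rW rT) s1 (9 * Z + 2) (s1(rW := unary k @ s1 rW))"
    by (rule exec_le_copy_unary) (use le in \<open>simp_all add: defs\<close>)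
  then have 2: "exec_le (copy rK rW rT) s1 (9 * Z + 2) s2"
    by (simp add: defs)
  have 3: "exec_le (for_unary rK cI i_body) s2 (9 * Z + 3 + Z * (i_time Z + 3)) s3"
    unfolding s3_def
  proof (rule exec_le_i_loop)
    show "holds_gadgets k n L s2 []"
      by (simp add: holds_gadgets_def scratch_empty_def defs)
  qed (use le in \<open>auto simp: s1_def s2_def L_def\<close>)
  have 4: "exec_le (Push rOut False) s3 1 s4"
    unfolding s4_def by (rule exec_le_Push)
  have 5: "exec_le (copy rTgt rOut rT) s4 (9 * Z + 2) s5"
    unfolding s5_def by (rule exec_le_copy_unary) (use le in \<open>simp_all add: defs\<close>)
  have 6: "exec_le (Push rOut False) s5 1 s6"
    unfolding s6_def by (rule exec_le_Push)
  have 7: "exec_le (copy rW rOut rT) s6 (9 * Z + 2) s7"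
    unfolding s7_def by (rule exec_le_copy_unary) (use \<open>?w \<le> Z\<close> in \<open>simp_all add: defs\<close>)
  have "exec_le reduction_prog (init_store x) (reduction_time Z) s7"
    unfolding reduction_prog_def reduction_time_def
    by (rule exec_le_Seq[OF 1 exec_le_Seq[OF 2 exec_le_Seq[OF 3 exec_le_Seq[OF 4
            exec_le_Seq[OF 5 exec_le_Seq[OF 6 7]]]]]])
  moreover have "s7 rOut = reduction x"
    unfolding reduction_eq[OF res] by (simp add: defs Let_def L_def)
  ultimately show ?thesis
    unfolding Z_def m_def by blast
qed

text \<open>The base \<open>m + 1\<close> is positive, so bounds with different exponents can be
  raised to a common one.\<close>

definition poly_bounded :: "(nat \<Rightarrow> nat) \<Rightarrow> bool" where
  "poly_bounded f \<longleftrightarrow> (\<exists>C d. \<forall>m. f m \<le> C * (m + 1) ^ d)"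

lemma poly_bounded_const: "poly_bounded (\<lambda>_. c)"
  unfolding poly_bounded_def by (rule exI[of _ c], rule exI[of _ 0]) simp

lemma poly_bounded_Suc: "poly_bounded (\<lambda>m. m + 1)"
  unfolding poly_bounded_def by (rule exI[of _ 1], rule exI[of _ 1]) simp

lemma poly_bounded_mult:
  assumes "poly_bounded f" "poly_bounded g"
  shows "poly_bounded (\<lambda>m. f m * g m)"
proof -
  from assms obtain C d C' d' where *: "\<And>m. f m \<le> C * (m + 1) ^ d" "\<And>m. g m \<le> C' * (m + 1) ^ d'"
    unfolding poly_bounded_def by metis
  have "f m * g m \<le> (C * C') * (m + 1) ^ (d + d')" for m
    using mult_le_mono[OF *(1)[of m] *(2)[of m]] by (simp add: power_add ac_simps)
  then show ?thesis
    unfolding poly_bounded_def by blast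
qed

lemma poly_bounded_add:
  assumes "poly_bounded f" "poly_bounded g"
  shows "poly_bounded (\<lambda>m. f m + g m)"
proof -
  from assms obtain C d C' d' where *: "\<And>m. f m \<le> C * (m + 1) ^ d" "\<And>m. g m \<le> C' * (m + 1) ^ d'"
    unfolding poly_bounded_def by metis
  have "f m + g m \<le> (C + C') * (m + 1) ^ (d + d')" for m
  proof -
    have "(m + 1) ^ d \<le> (m + 1) ^ (d + d')" "(m + 1) ^ d' \<le> (m + 1) ^ (d + d')"
      by (intro power_increasing; simp)+
    then have "C * (m + 1) ^ d \<le> C * (m + 1) ^ (d + d')" "C' * (m + 1) ^ d' \<le> C' * (m + 1) ^ (d + d')"
      by simp_all
    with *[of m] show ?thesis
      unfolding add_mult_distrib by linarith
  qed
  then show ?thesis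
    unfolding poly_bounded_def by blast
qed

text \<open>Unfolded, the time is a sum-and-product expression in \<open>loop_bound\<close>, which
  is one in \<open>m + 1\<close>; closure under both operations replaces expanding the
  polynomial.\<close>

lemma poly_bounded_reduction_time: "poly_bounded (\<lambda>m. reduction_time (loop_bound (m + 1)))"
proof -
  have "poly_bounded (\<lambda>m. loop_bound (m + 1))"
    unfolding loop_bound_def
    by (intro poly_bounded_add poly_bounded_mult poly_bounded_const poly_bounded_Suc)
  then show ?thesis
    unfolding reduction_time_def by (intro poly_bounded_add poly_bounded_mult poly_bounded_const)
qed

lemma computes_reduction:
  obtains C d where "computes_within reduction_prog reduction (\<lambda>x. C * (length x + 1) ^ d)"
proof -
  from poly_bounded_reduction_time obtain C d where
    "\<And>m. reduction_time (loop_bound (m + 1)) \<le> C * (m + 1) ^ d"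
    unfolding poly_bounded_def by blast
  then have "computes_within reduction_prog reduction (\<lambda>x. C * (length x + 1) ^ d)"
    using exec_le_reduction_prog unfolding computes_within_def exec_le_def by (meson le_trans)
  then show ?thesis by (rule that)
qed

section \<open>W[1]-hardness\<close>

text \<open>The constant \<open>e\<close> covers both parameters at once: 0 for the vertex cover
  number, and 2 for the tree-cut width, as \<open>max k 2 \<le> k + 2\<close>.\<close>

lemma W1_hard_if_reduction:
  assumes "\<And>x. snd B (reduction x) \<le> inst_k x + e" "fst B = bipartite_colored_clustering"
  shows "W1_hard B"
  unfolding W1_hard_def
proof
  fix A assume "A \<in> W1"
  then have A: "fpt_reducible A p_clique"
    by (simp add: W1_def)
  obtain C d where "computes_within reduction_prog reduction (\<lambda>x. C * (length x + 1) ^ d)"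
    by (rule computes_reduction)
  with A show "fpt_reducible A B"
  proof (rule fpt_reducible_poly_trans)
    show "x \<in> fst p_clique \<longleftrightarrow> reduction x \<in> fst B" for x
      using assms(2) reduction_correct by simp
    show "snd B (reduction x) \<le> snd p_clique x + e" for x
      using assms(1)[of x] by (simp add: p_clique_def)
  qed
qed

theorem theorem9:
  "W1_hard (bipartite_colored_clustering, vertex_cover_parameter) \<and>
   W1_hard (bipartite_colored_clustering, tree_cut_width_parameter)"
proof
  show "W1_hard (bipartite_colored_clustering, vertex_cover_parameter)"
    by (rule W1_hard_if_reduction[where e = 0]) (simp_all add: reduction_parameters)
  show "W1_hard (bipartite_colored_clustering, tree_cut_width_parameter)"
    by (rule W1_hard_if_reduction[where e = 2])
      (use reduction_parameters(2) in \<open>simp_all only: fst_conv snd_conv\<close>)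
qed

end
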